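(* Suppose $1\le p,q\le\infty$. (1) If $1\le q\le p\le\infty$, then for each real $b>0$ there is a constant $c_b>0$, independent of $p$ and $q$, such that for all integers $n\ge1$ and all $\alpha\in(0,b]$ $$e_n(R^\alpha:L_p[0,1]\to L_q[0,1])\le c_b\,n^{-\alpha}.$$ (2) If $1\le p<q\le\infty$, then for all $a>\frac1p-\frac1q$ and $b>a$ there is a constant $c_{a,b}>0$ (possibly depending on $p$ and $q$) such that for all integers $n\ge1$ and all $\alpha$ with $a\le\alpha\le b$ $$e_n(R^\alpha:L_p[0,1]\to L_q[0,1])\le c_{a,b}\,n^{-\alpha}.$$
   Context: For a real number $\alpha>0$, $R^\alpha$ is the classical Riemann--Liouville operator $$(R^\alpha f)(t)=\frac1{\Gamma(\alpha)}\int_0^t(t-s)^{\alpha-1}f(s)\,ds,\qquad t\in[0,1].$$ For a bounded operator $S$ between Banach spaces $E$ and $F$ with unit balls $B_E$, $B_F$, the $n$-th (dyadic) entropy number is $$e_n(S):=\inf\Big\{\varepsilon>0:\ \exists\,y_1,\dots,y_{2^{n-1}}\in F\ \text{such that}\ S(B_E)\subseteq\bigcup_{j=1}^{2^{n-1}}(y_j+\varepsilon B_F)\Big\}.$$ Here $1/\infty=0$. *)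

theory Defs
  imports "HOL-Analysis.Analysis" "HOL-Probability.Essential_Supremum"
begin

text \<open>
  The (real) space \<open>L\<^sub>p(M)\<close>, for \<open>1 \<le> p \<le> \<infinity>\<close>, is represented by its measurable functions
  rather than by their classes modulo equality almost everywhere; \<open>Lp_norm M p\<close> is then a
  seminorm on \<open>Lp_space M p\<close> that vanishes exactly on the functions which are \<open>0\<close> almost
  everywhere.
\<close>

definition Lp_space :: "'a measure \<Rightarrow> ereal \<Rightarrow> ('a \<Rightarrow> real) set" where
  "Lp_space M p = {f \<in> borel_measurable M.
     if p = \<infinity> then esssup M (\<lambda>x. ereal \<bar>f x\<bar>) < \<infinity>
     else integrable M (\<lambda>x. \<bar>f x\<bar> powr real_of_ereal p)}"

definition Lp_norm :: "'a measure \<Rightarrow> ereal \<Rightarrow> ('a \<Rightarrow> real) \<Rightarrow> real" where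
  "Lp_norm M p f =
     (if p = \<infinity> then real_of_ereal (esssup M (\<lambda>x. ereal \<bar>f x\<bar>))
      else (\<integral>x. \<bar>f x\<bar> powr real_of_ereal p \<partial>M) powr (1 / real_of_ereal p))"

abbreviation L01 :: "ereal \<Rightarrow> (real \<Rightarrow> real) set" where
  "L01 p \<equiv> Lp_space (lebesgue_on {0..1}) p"

abbreviation norm01 :: "ereal \<Rightarrow> (real \<Rightarrow> real) \<Rightarrow> real" where
  "norm01 p \<equiv> Lp_norm (lebesgue_on {0..1}) p"

text \<open>
  For \<open>f\<close> in \<open>L\<^sub>1[0,1]\<close> the integrand is integrable for almost every \<open>t\<close> in \<open>[0,1]\<close>; at the
  remaining points the Bochner integral has the default value \<open>0\<close>. Only the values of \<open>f\<close> and
  of the result on \<open>[0,1]\<close> matter.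
\<close>

definition riemann_liouville :: "real \<Rightarrow> (real \<Rightarrow> real) \<Rightarrow> real \<Rightarrow> real" where
  "riemann_liouville \<alpha> f t =
     1 / Gamma \<alpha> * (LINT s:{0..t}|lebesgue. (t - s) powr (\<alpha> - 1) * f s)"

text \<open>
  Entropy numbers of a map \<open>S\<close> from the space with carrier \<open>E\<close> and (semi)norm \<open>NE\<close> to the
  space with carrier \<open>F\<close> and (semi)norm \<open>NF\<close>. The set \<open>{z \<in> F. NF (z - y) \<le> \<epsilon>}\<close> is
  \<open>y + \<epsilon> B\<^sub>F\<close>. The infimum is taken in the extended nonnegative reals, so that it is \<open>\<infinity>\<close> when
  there is no admissible \<open>\<epsilon>\<close>; in particular a finite value forces \<open>S\<close> to map the unit ball of \<open>E\<close>
  into a bounded subset of \<open>F\<close>.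
\<close>

definition entropy_number ::
  "nat \<Rightarrow> 'a set \<Rightarrow> ('a \<Rightarrow> real) \<Rightarrow> 'b::minus set \<Rightarrow> ('b \<Rightarrow> real) \<Rightarrow> ('a \<Rightarrow> 'b) \<Rightarrow> ennreal" where
  "entropy_number n E NE F NF S =
     Inf {ennreal \<epsilon> | \<epsilon>. \<epsilon> > 0 \<and> (\<exists>y :: nat \<Rightarrow> 'b. (\<forall>j\<in>{1..2 ^ (n - 1)}. y j \<in> F) \<and>
       S ` {x \<in> E. NE x \<le> 1} \<subseteq> (\<Union>j\<in>{1..2 ^ (n - 1)}. {z \<in> F. NF (z - y j) \<le> \<epsilon>}))}"

end

theory Submission
  imports Defs
begin

text \<open>
  Write \<open>R\<^sup>\<alpha>\<close> for the operator of order \<open>\<alpha>\<close>, and let \<open>E\<^sub>j f\<close> be the average of \<open>f\<close> over the dyadic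
  intervals of length \<open>2\<^sup>-\<^sup>j\<close>. The differences \<open>E\<^sub>j\<^sub>+\<^sub>1 f - E\<^sub>j f\<close> are Haar sums with \<open>2\<^sup>j\<close> coefficients, so

    \<open>R\<^sup>\<alpha> f = R\<^sup>\<alpha> E\<^sub>0 f + (\<Sum>j<J. R\<^sup>\<alpha> (E\<^sub>j\<^sub>+\<^sub>1 f - E\<^sub>j f)) + R\<^sup>\<alpha> (f - E\<^sub>J f)\<close>.

  Everything rests on one analytic fact (\<open>RL_mean_zero_lp_le\<close>): if all dyadic averages of \<open>g\<close> at
  level \<open>j\<close> vanish and \<open>\<alpha> < 1\<close>, then \<open>\<parallel>R\<^sup>\<alpha> g\<parallel>\<^sub>q \<le> C 2\<^sup>-\<^sup>j\<^sup>\<alpha> \<parallel>g\<parallel>\<^sub>q\<close>, with the same \<open>C\<close> for all \<open>q\<close> and for all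
  \<open>\<alpha> \<le> \<alpha>\<^sub>0 < 1\<close>. Indeed the kernel may be replaced, away from the diagonal, by its increments over dyadic
  intervals, which leaves a convolution kernel of \<open>L\<^sub>1\<close> norm of order \<open>2\<^sup>-\<^sup>j\<^sup>\<alpha>\<close>, and Schur's test applies.

  An entropy estimate is obtained by rounding the Haar coefficients of each level to multiples of
  a step width and counting the integer vectors that can occur. The number of \<open>m \<in> \<int>\<^sup>N\<close> with
  \<open>\<Sum>|m\<^sub>k| \<le> M\<close> is at most \<open>(1 + 4z)\<^sup>N z\<^sup>-\<^sup>M\<close> for \<open>0 < z \<le> 1/2\<close> (\<open>card_int_ball\<close>). On the levels
  \<open>j < J\<close> the step is \<open>2\<close> to the power \<open>-\<gamma>(J - j)\<close> with \<open>\<alpha> < \<gamma> < 1\<close>: the numbers of bits form a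
  geometric sum of size \<open>2\<^sup>J\<close>, and the errors one of size \<open>2\<^sup>-\<^sup>J\<^sup>\<alpha>\<close> (\<open>has_net_low_part\<close>).

  For equal exponents the tail \<open>R\<^sup>\<alpha> (f - E\<^sub>J f)\<close> is already of size \<open>2\<^sup>-\<^sup>J\<^sup>\<alpha>\<close>. This proves the claim for
  \<open>\<alpha> \<le> 1/2\<close>, uniformly in \<open>\<alpha>\<close>; larger orders follow from \<open>R\<^sup>\<alpha> = (R\<^sup>\<alpha>\<^sup>/\<^sup>m)\<^sup>m\<close> and the multiplicativity
  of nets under composition. The case \<open>q \<le> p\<close> reduces to \<open>p = q\<close>, because the unit ball of \<open>L\<^sub>p\<close> is
  contained in that of \<open>L\<^sub>q\<close>.

  For \<open>p < q\<close> put \<open>d = 1/p - 1/q\<close> and let first \<open>d < \<alpha> < 1\<close>. On the levels \<open>j \<ge> J\<close> the step width now grows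
  with \<open>j\<close>, so that most coefficients are rounded to \<open>0\<close>: few bits are used, and truncation at
  height \<open>\<delta>\<close> costs only \<open>\<delta>\<^sup>p\<^sup>d\<close> in \<open>L\<^sub>q\<close> (\<open>lp_le_truncated\<close>, \<open>has_net_haar_high\<close>). As \<open>\<alpha> > d\<close>, the errors are
  summable in \<open>j\<close>. One fixed order below \<open>a\<close> suffices, since \<open>R\<^sup>\<alpha> = R\<^sup>\<alpha>\<^sup>-\<^sup>\<beta> R\<^sup>\<beta>\<close>, and the first factor is treated on
  \<open>L\<^sub>q\<close> by the case of equal exponents. If \<open>d = 1\<close>, that is \<open>p = 1\<close> and \<open>q = \<infinity>\<close>, the order \<open>\<beta>\<close> is
  split into two halves, through \<open>L\<^sub>2\<close>.
\<close>

section \<open>Norm bounds on the unit interval\<close>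

text \<open>
  \<open>lp_le p f c\<close> says that \<open>f\<close> is Borel measurable, vanishes outside \<open>[0,1)\<close>, and has \<open>L\<^sub>p\<close> norm at
  most \<open>c\<close>, where \<open>c \<ge> 0\<close>. Functions live on the whole line so that the operators become convolutions, and Borel
  representatives avoid products of completed measures; the half-open interval fits the dyadic
  intervals below.
\<close>

definition lp_le :: "ereal \<Rightarrow> (real \<Rightarrow> real) \<Rightarrow> real \<Rightarrow> bool" where
  "lp_le p f c \<longleftrightarrow> f \<in> borel_measurable borel \<and> (\<forall>x. x \<notin> {0..<1} \<longrightarrow> f x = 0) \<and> 0 \<le> c \<and>
     (if p = \<infinity> then AE x in lborel. \<bar>f x\<bar> \<le> c
      else (\<integral>\<^sup>+x. ennreal (\<bar>f x\<bar> powr real_of_ereal p) \<partial>lborel) \<le> ennreal (c powr real_of_ereal p))"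

lemma lp_le_meas: "lp_le p f c \<Longrightarrow> f \<in> borel_measurable borel"
  and lp_le_supp: "lp_le p f c \<Longrightarrow> x \<notin> {0..<1} \<Longrightarrow> f x = 0"
  and lp_le_nonneg: "lp_le p f c \<Longrightarrow> 0 \<le> c"
  by (simp_all add: lp_le_def)

lemma lp_le_infinity:
  "lp_le \<infinity> f c \<longleftrightarrow> f \<in> borel_measurable borel \<and> (\<forall>x. x \<notin> {0..<1} \<longrightarrow> f x = 0) \<and> 0 \<le> c \<and>
     (AE x in lborel. \<bar>f x\<bar> \<le> c)"
  by (simp add: lp_le_def)

lemma lp_le_ereal:
  "lp_le (ereal r) f c \<longleftrightarrow> f \<in> borel_measurable borel \<and> (\<forall>x. x \<notin> {0..<1} \<longrightarrow> f x = 0) \<and> 0 \<le> c \<and>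
     (\<integral>\<^sup>+x. ennreal (\<bar>f x\<bar> powr r) \<partial>lborel) \<le> ennreal (c powr r)"
  by (simp add: lp_le_def)

lemma exponent_cases:
  fixes p :: ereal
  assumes "1 \<le> p"
  obtains (fin) r where "p = ereal r" "1 \<le> r" | (inf) "p = \<infinity>"
  using assms by (cases p) auto

lemma lp_le_mono:
  assumes "1 \<le> p" "lp_le p f c" "c \<le> d"
  shows "lp_le p f d"
  using assms(1)
proof (cases rule: exponent_cases)
  case (fin r)
  have "c powr r \<le> d powr r" using assms fin by (intro powr_mono2) (auto simp: lp_le_def)
  then have "ennreal (c powr r) \<le> ennreal (d powr r)" by (rule ennreal_leI)
  then show ?thesis using assms fin by (auto simp: lp_le_ereal intro: order_trans)
next
  case inf
  then show ?thesis using assms by (auto simp: lp_le_infinity elim: AE_mp)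
qed

lemma lp_le_zero_AE:
  assumes "1 \<le> p" "lp_le p f 0"
  shows "AE x in lborel. f x = 0"
  using assms(1)
proof (cases rule: exponent_cases)
  case (fin r)
  have "(\<integral>\<^sup>+x. ennreal (\<bar>f x\<bar> powr r) \<partial>lborel) = 0"
    using assms fin by (simp add: lp_le_ereal)
  moreover have "(\<lambda>x. ennreal (\<bar>f x\<bar> powr r)) \<in> borel_measurable lborel"
    using lp_le_meas[OF assms(2)] by measurable
  ultimately have "AE x in lborel. ennreal (\<bar>f x\<bar> powr r) = 0"
    by (simp add: nn_integral_0_iff_AE)
  then show ?thesis by eventually_elim simp
next
  case inf
  then show ?thesis using assms by (auto simp: lp_le_infinity elim: AE_mp)
qed

lemma lp_le_AE_mono:
  assumes "1 \<le> p" "lp_le p f c" "g \<in> borel_measurable borel" "\<And>x. x \<notin> {0..<1} \<Longrightarrow> g x = 0"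
    "AE x in lborel. \<bar>g x\<bar> \<le> \<bar>f x\<bar>"
  shows "lp_le p g c"
  using assms(1)
proof (cases rule: exponent_cases)
  case (fin r)
  have "(\<integral>\<^sup>+x. ennreal (\<bar>g x\<bar> powr r) \<partial>lborel) \<le> (\<integral>\<^sup>+x. ennreal (\<bar>f x\<bar> powr r) \<partial>lborel)"
    using assms(5) fin(2) by (intro nn_integral_mono_AE) (auto elim!: AE_mp intro!: ennreal_leI powr_mono2)
  then show ?thesis using assms fin by (auto simp: lp_le_ereal)
next
  case inf
  then have "AE x in lborel. \<bar>f x\<bar> \<le> c" using assms by (auto simp: lp_le_infinity)
  then have "AE x in lborel. \<bar>g x\<bar> \<le> c" using assms(5) by eventually_elim auto
  then show ?thesis using assms inf by (auto simp: lp_le_infinity)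
qed

lemma lp_le_AE_cong:
  assumes "1 \<le> p" "lp_le p f c" "g \<in> borel_measurable borel" "\<And>x. x \<notin> {0..<1} \<Longrightarrow> g x = 0"
    "AE x in lborel. g x = f x"
  shows "lp_le p g c"
  by (rule lp_le_AE_mono[OF assms(1-4)]) (use assms(5) in auto)

lemma lp_le_zero: "0 \<le> c \<Longrightarrow> lp_le p (\<lambda>x. 0) c"
  by (simp add: lp_le_def)

lemma lp_le_scale:
  assumes "1 \<le> p" "lp_le p f c"
  shows "lp_le p (\<lambda>x. a * f x) (\<bar>a\<bar> * c)"
  using assms(1)
proof (cases rule: exponent_cases)
  case (fin r)
  have [measurable]: "f \<in> borel_measurable borel" using assms(2) by (rule lp_le_meas)
  have "(\<integral>\<^sup>+x. ennreal (\<bar>a * f x\<bar> powr r) \<partial>lborel)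
      = (\<integral>\<^sup>+x. ennreal (\<bar>a\<bar> powr r) * ennreal (\<bar>f x\<bar> powr r) \<partial>lborel)"
    by (simp add: abs_mult powr_mult ennreal_mult)
  also have "\<dots> = ennreal (\<bar>a\<bar> powr r) * (\<integral>\<^sup>+x. ennreal (\<bar>f x\<bar> powr r) \<partial>lborel)"
    by (rule nn_integral_cmult) measurable
  also have "\<dots> \<le> ennreal (\<bar>a\<bar> powr r) * ennreal (c powr r)"
    using assms fin by (intro mult_left_mono) (auto simp: lp_le_ereal)
  also have "\<dots> = ennreal ((\<bar>a\<bar> * c) powr r)"
    using lp_le_nonneg[OF assms(2)] by (simp add: powr_mult ennreal_mult)
  finally show ?thesis using assms fin by (auto simp: lp_le_ereal)
next
  case inf
  have "AE x in lborel. \<bar>f x\<bar> \<le> c" using assms inf by (auto simp: lp_le_infinity)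
  then have "AE x in lborel. \<bar>a * f x\<bar> \<le> \<bar>a\<bar> * c"
    by eventually_elim (simp add: abs_mult mult_left_mono)
  then show ?thesis using assms inf by (auto simp: lp_le_infinity)
qed

lemma convex_on_powr_nonneg:
  fixes r :: real
  assumes "1 \<le> r"
  shows "convex_on {0..} (\<lambda>u. u powr r)"
proof (rule convex_onI)
  fix t x y :: real
  assume t: "0 < t" "t < 1" and xy: "x \<in> {0..}" "y \<in> {0..}"
  have le: "(s * z) powr r \<le> s * z powr r" if "0 < s" "s < 1" for s z :: real
    using that assms powr_mono'[of 1 r s] by (simp add: powr_mult mult_right_mono)
  consider "x = 0" | "y = 0" | "0 < x" "0 < y" using xy by fastforce
  then show "((1 - t) *\<^sub>R x + t *\<^sub>R y) powr r \<le> (1 - t) * x powr r + t * y powr r"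
  proof cases
    case 3
    then show ?thesis
      using convex_onD[OF powr_convex[OF assms], of t x y] t by auto
  qed (use t le[of t y] le[of "1 - t" x] in auto)
qed simp

text \<open>
  Convexity of \<open>u\<^sup>r\<close> at the point \<open>(x + y)/(a + b)\<close>, a convex combination of \<open>x/a\<close> and \<open>y/b\<close>. With
  \<open>a\<close> and \<open>b\<close> the norms of two functions, integration yields Minkowski's inequality.
\<close>

lemma powr_add_le:
  fixes x y a b r :: real
  assumes "1 \<le> r" "0 \<le> x" "0 \<le> y" "0 < a" "0 < b"
  shows "(x + y) powr r \<le> (a + b) powr (r - 1) * (a powr (1 - r) * x powr r + b powr (1 - r) * y powr r)"
proof -
  have c: "convex_on {0..} (\<lambda>u::real. u powr r)" using assms(1) by (rule convex_on_powr_nonneg)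
  define l where "l = b / (a + b)"
  have l: "0 \<le> l" "l \<le> 1" "1 - l = a / (a + b)" using assms by (auto simp: l_def field_simps)
  have "((1 - l) *\<^sub>R (x / a) + l *\<^sub>R (y / b)) powr r \<le> (1 - l) * (x / a) powr r + l * (y / b) powr r"
    using assms l by (intro convex_onD[OF c]) auto
  moreover have "(1 - l) *\<^sub>R (x / a) + l *\<^sub>R (y / b) = (x + y) / (a + b)"
    using assms by (simp add: l(3) add_divide_distrib) (simp add: l_def)
  ultimately have 1: "((x + y) / (a + b)) powr r \<le> a / (a + b) * (x / a) powr r + b / (a + b) * (y / b) powr r"
    by (simp only: l(3)) (simp add: l_def)
  have "(x + y) powr r = (a + b) powr r * ((x + y) / (a + b)) powr r"
    using assms by (simp add: powr_divide)
  also have "\<dots> \<le> (a + b) powr r * (a / (a + b) * (x / a) powr r + b / (a + b) * (y / b) powr r)"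
    using 1 by (intro mult_left_mono) auto
  also have "\<dots> = (a + b) powr (r - 1) * (a powr (1 - r) * x powr r + b powr (1 - r) * y powr r)"
  proof -
    have "s powr r * (u / s * (z / u) powr r) = s powr (r - 1) * (u powr (1 - r) * z powr r)"
      if "0 < s" "0 < u" "0 \<le> z" for s u z :: real
      using that by (simp add: powr_divide powr_diff field_simps)
    from this[of "a + b" a x] this[of "a + b" b y] assms show ?thesis by (simp add: distrib_left)
  qed
  finally show ?thesis .
qed

lemma lp_le_add_pos:
  assumes "1 \<le> p" "lp_le p f a" "lp_le p g b" "0 < a" "0 < b"
  shows "lp_le p (\<lambda>x. f x + g x) (a + b)"
  using assms(1)
proof (cases rule: exponent_cases)
  case (fin r)
  have [measurable]: "f \<in> borel_measurable borel" "g \<in> borel_measurable borel"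
    using assms lp_le_meas by blast+
  have F: "(\<integral>\<^sup>+x. ennreal (\<bar>f x\<bar> powr r) \<partial>lborel) \<le> ennreal (a powr r)"
    and G: "(\<integral>\<^sup>+x. ennreal (\<bar>g x\<bar> powr r) \<partial>lborel) \<le> ennreal (b powr r)"
    using assms fin by (auto simp: lp_le_ereal)
  have "(\<integral>\<^sup>+x. ennreal (\<bar>f x + g x\<bar> powr r) \<partial>lborel)
     \<le> (\<integral>\<^sup>+x. ennreal ((a + b) powr (r - 1) * a powr (1 - r)) * ennreal (\<bar>f x\<bar> powr r)
          + ennreal ((a + b) powr (r - 1) * b powr (1 - r)) * ennreal (\<bar>g x\<bar> powr r) \<partial>lborel)"
  proof (rule nn_integral_mono)
    fix x
    have "\<bar>f x + g x\<bar> powr r \<le> (\<bar>f x\<bar> + \<bar>g x\<bar>) powr r"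
      using fin by (intro powr_mono2) auto
    also have "\<dots> \<le> (a + b) powr (r - 1) * (a powr (1 - r) * \<bar>f x\<bar> powr r + b powr (1 - r) * \<bar>g x\<bar> powr r)"
      using assms fin by (intro powr_add_le) auto
    finally show "ennreal (\<bar>f x + g x\<bar> powr r) \<le> ennreal ((a + b) powr (r - 1) * a powr (1 - r)) * ennreal (\<bar>f x\<bar> powr r)
          + ennreal ((a + b) powr (r - 1) * b powr (1 - r)) * ennreal (\<bar>g x\<bar> powr r)"
      by (simp add: ennreal_mult[symmetric] ennreal_plus[symmetric] algebra_simps del: ennreal_plus)
  qed
  also have "\<dots> = ennreal ((a + b) powr (r - 1) * a powr (1 - r)) * (\<integral>\<^sup>+x. ennreal (\<bar>f x\<bar> powr r) \<partial>lborel)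
          + ennreal ((a + b) powr (r - 1) * b powr (1 - r)) * (\<integral>\<^sup>+x. ennreal (\<bar>g x\<bar> powr r) \<partial>lborel)"
    by (simp add: nn_integral_add nn_integral_cmult)
  also have "\<dots> \<le> ennreal ((a + b) powr (r - 1) * a powr (1 - r)) * ennreal (a powr r)
          + ennreal ((a + b) powr (r - 1) * b powr (1 - r)) * ennreal (b powr r)"
    using F G by (intro add_mono mult_left_mono) auto
  also have "\<dots> = ennreal ((a + b) powr (r - 1) * (a powr (1 - r) * a powr r + b powr (1 - r) * b powr r))"
    by (simp add: ennreal_mult[symmetric] ennreal_plus[symmetric] algebra_simps del: ennreal_plus)
  also have "(a + b) powr (r - 1) * (a powr (1 - r) * a powr r + b powr (1 - r) * b powr r) = (a + b) powr r"
    using assms by (simp add: powr_add[symmetric]) (simp add: powr_diff)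
  finally show ?thesis using assms fin by (auto simp: lp_le_ereal)
next
  case inf
  then have "AE x in lborel. \<bar>f x\<bar> \<le> a" "AE x in lborel. \<bar>g x\<bar> \<le> b" using assms by (auto simp: lp_le_infinity)
  then have "AE x in lborel. \<bar>f x + g x\<bar> \<le> a + b" by eventually_elim auto
  then show ?thesis using assms inf by (auto simp: lp_le_infinity)
qed

lemma lp_le_add:
  assumes "1 \<le> p" "lp_le p f a" "lp_le p g b"
  shows "lp_le p (\<lambda>x. f x + g x) (a + b)"
proof -
  have nn: "0 \<le> a" "0 \<le> b" using assms lp_le_nonneg by blast+
  have m: "(\<lambda>x. f x + g x) \<in> borel_measurable borel" using assms lp_le_meas by (intro borel_measurable_add) blast+
  have s: "f x + g x = 0" if "x \<notin> {0..<1}" for x using lp_le_supp[OF assms(2) that] lp_le_supp[OF assms(3) that] by simp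
  consider "0 < a" "0 < b" | "a = 0" | "b = 0" using nn by linarith
  then show ?thesis
  proof cases
    case 1 then show ?thesis using assms lp_le_add_pos by blast
  next
    case 2
    then have "AE x in lborel. f x = 0" using assms lp_le_zero_AE by blast
    then have "AE x in lborel. f x + g x = g x" by eventually_elim simp
    then show ?thesis using lp_le_AE_cong[OF assms(1,3) m s] 2 by simp
  next
    case 3
    then have "AE x in lborel. g x = 0" using assms lp_le_zero_AE by blast
    then have "AE x in lborel. f x + g x = f x" by eventually_elim simp
    then show ?thesis using lp_le_AE_cong[OF assms(1,2) m s] 3 by simp
  qed
qed

lemma lp_le_diff:
  assumes "1 \<le> p" "lp_le p f a" "lp_le p g b"
  shows "lp_le p (\<lambda>x. f x - g x) (a + b)"
  using lp_le_add[OF assms(1,2) lp_le_scale[OF assms(1,3), of "-1"]] by simp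

lemma lp_le_sum:
  assumes "1 \<le> p" "finite I" "\<And>i. i \<in> I \<Longrightarrow> lp_le p (f i) (c i)"
  shows "lp_le p (\<lambda>x. \<Sum>i\<in>I. f i x) (\<Sum>i\<in>I. c i)"
  using assms(2,3)
  by (induction I rule: finite_induct) (auto intro: lp_le_zero lp_le_add[OF assms(1)])

text \<open>
  The tangent of the concave function \<open>u \<mapsto> u\<^sup>1\<^sup>/\<^sup>q\<close> at \<open>A\<^sup>q\<close>, evaluated at \<open>u = x\<^sup>q\<close>. Integrated with a suitable \<open>A\<close>, it
  replaces the inequalities of Jensen and Hoelder below.
\<close>

lemma powr_le_tangent:
  fixes x A q :: real
  assumes "1 \<le> q" "0 \<le> x" "0 < A"
  shows "x \<le> (1 - 1 / q) * A + 1 / q * A powr (1 - q) * x powr q"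
proof -
  consider "x = 0" | "0 < x" using assms by linarith
  then show ?thesis
  proof cases
  case 2
  have "((x / A) powr q) powr (1 / q) * 1 powr (1 - 1 / q) \<le> 1 / q * (x / A) powr q + (1 - 1 / q) * 1"
    using assms 2 by (intro Youngs_inequality_0) auto
  then have "x / A \<le> 1 / q * (x / A) powr q + (1 - 1 / q)"
    using assms 2 by (simp add: powr_powr)
  then have "A * (x / A) \<le> A * (1 / q * (x / A) powr q + (1 - 1 / q))"
    using assms by (intro mult_left_mono) auto
  also have "\<dots> = (1 - 1 / q) * A + 1 / q * A powr (1 - q) * x powr q"
    using assms by (simp add: powr_divide powr_diff field_simps)
  finally show ?thesis using assms by simp
  qed (use assms in simp)
qed

lemma lp_le_antimono_exponent_fin:
  assumes "1 \<le> q" "q \<le> r" "lp_le (ereal r) f c"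
  shows "lp_le (ereal q) f c"
proof (cases "c = 0")
  case True
  then have "AE x in lborel. f x = 0" using assms lp_le_zero_AE[of "ereal r" f] by (simp add: one_ereal_def)
  then show ?thesis
    using assms True lp_le_AE_cong[of "ereal q" "\<lambda>x. 0" 0 f] lp_le_zero[of 0 "ereal q"]
    by (auto simp: one_ereal_def lp_le_ereal)
next
  case False
  then have c: "c > 0" using lp_le_nonneg[OF assms(3)] by simp
  have [measurable]: "f \<in> borel_measurable borel" using assms(3) by (rule lp_le_meas)
  define A where "A = c powr q"
  have A: "A > 0" using c by (simp add: A_def)
  have r: "r > 0" using assms by simp
  have "(\<integral>\<^sup>+x. ennreal (\<bar>f x\<bar> powr q) \<partial>lborel) \<le>
     (\<integral>\<^sup>+x. ennreal ((1 - q / r) * A) * indicator {0..<1} x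
        + ennreal (q / r * A powr (1 - r / q)) * ennreal (\<bar>f x\<bar> powr r) \<partial>lborel)"
  proof (rule nn_integral_mono)
    fix x :: real
    show "ennreal (\<bar>f x\<bar> powr q) \<le> ennreal ((1 - q / r) * A) * indicator {0..<1} x
        + ennreal (q / r * A powr (1 - r / q)) * ennreal (\<bar>f x\<bar> powr r)"
    proof (cases "x \<in> {0..<1}")
      case True
      have "\<bar>f x\<bar> powr q \<le> (1 - 1 / (r / q)) * A + 1 / (r / q) * A powr (1 - r / q) * (\<bar>f x\<bar> powr q) powr (r / q)"
        using assms A by (intro powr_le_tangent) auto
      also have "\<dots> = (1 - q / r) * A + q / r * A powr (1 - r / q) * \<bar>f x\<bar> powr r"
        using assms by (simp add: powr_powr)
      finally have 1: "\<bar>f x\<bar> powr q \<le> (1 - q / r) * A + q / r * A powr (1 - r / q) * \<bar>f x\<bar> powr r" .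
      have "0 \<le> (1 - q / r) * A" "0 \<le> q / r * A powr (1 - r / q)" using assms A by (auto simp: field_simps)
      then have "ennreal ((1 - q / r) * A) + ennreal (q / r * A powr (1 - r / q)) * ennreal (\<bar>f x\<bar> powr r)
          = ennreal ((1 - q / r) * A + q / r * A powr (1 - r / q) * \<bar>f x\<bar> powr r)"
        by (simp only: ennreal_plus[OF _ mult_nonneg_nonneg] ennreal_mult powr_ge_zero)
      with ennreal_leI[OF 1] True show ?thesis by simp
    next
      case False
      then have "f x = 0" using assms(3) by (simp add: lp_le_def)
      then show ?thesis by simp
    qed
  qed
  also have "\<dots> = ennreal ((1 - q / r) * A) + ennreal (q / r * A powr (1 - r / q)) * (\<integral>\<^sup>+x. ennreal (\<bar>f x\<bar> powr r) \<partial>lborel)"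
    by (simp add: nn_integral_add nn_integral_cmult nn_integral_cmult_indicator)
  also have "\<dots> \<le> ennreal ((1 - q / r) * A) + ennreal (q / r * A powr (1 - r / q)) * ennreal (c powr r)"
    using assms(3) by (intro add_left_mono mult_left_mono) (auto simp: lp_le_ereal)
  also have "\<dots> = ennreal ((1 - q / r) * A + q / r * A powr (1 - r / q) * c powr r)"
    using assms A by (simp add: ennreal_mult[symmetric] ennreal_plus[symmetric] del: ennreal_plus)
  also have "(1 - q / r) * A + q / r * A powr (1 - r / q) * c powr r = c powr q"
  proof -
    have "A powr (1 - r / q) * c powr r = c powr (q * (1 - r / q) + r)"
      by (simp add: A_def powr_powr powr_add)
    also have "q * (1 - r / q) + r = q" using assms by (simp add: field_simps)
    finally have "q / r * A powr (1 - r / q) * c powr r = q / r * A" by (simp add: A_def)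
    then show ?thesis by (simp add: A_def algebra_simps)
  qed
  finally show ?thesis using assms by (simp add: lp_le_ereal)
qed

lemma lp_le_antimono_exponent:
  assumes "1 \<le> q" "q \<le> p" "lp_le p f c"
  shows "lp_le q f c"
proof -
  have "1 \<le> p" using assms by simp
  then show ?thesis
  proof (cases rule: exponent_cases)
    case (fin r)
    with assms obtain s where "q = ereal s" by (cases q) auto
    with fin assms show ?thesis using lp_le_antimono_exponent_fin by (simp add: one_ereal_def)
  next
    case inf
    then have b: "AE x in lborel. \<bar>f x\<bar> \<le> c" and c: "0 \<le> c" using assms by (auto simp: lp_le_infinity)
    from \<open>1 \<le> q\<close> show ?thesis
    proof (cases rule: exponent_cases)
      case (fin s)
      have "(\<integral>\<^sup>+x. ennreal (\<bar>f x\<bar> powr s) \<partial>lborel) \<le> (\<integral>\<^sup>+x. ennreal (c powr s) * indicator {0..<1::real} x \<partial>lborel)"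
      proof (rule nn_integral_mono_AE)
        show "AE x in lborel. ennreal (\<bar>f x\<bar> powr s) \<le> ennreal (c powr s) * indicator {0..<1::real} x"
          using b
        proof eventually_elim
          case (elim x)
          then show ?case using fin assms(3)
            by (cases "x \<in> {0..<1}") (auto simp: lp_le_def intro!: ennreal_leI powr_mono2)
        qed
      qed
      also have "\<dots> = ennreal (c powr s)" by (simp add: nn_integral_cmult_indicator)
      finally show ?thesis using assms fin by (auto simp: lp_le_def)
    qed (use assms inf in simp)
  qed
qed

text \<open>
  Jensen's inequality \<open>(\<integral> w x)\<^sup>q \<le> W\<^sup>q\<^sup>-\<^sup>1 \<integral> w x\<^sup>q\<close> for a weight \<open>w\<close> of total mass at most \<open>W\<close>. The
  quantity on the left is represented by a real \<open>y\<close> below \<open>\<integral> w x\<close>; the right-hand side may be infinite.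
\<close>

lemma nn_integral_weighted_powr_le:
  fixes w :: "'a \<Rightarrow> ennreal" and x :: "'a \<Rightarrow> real" and q W y :: real
  assumes [measurable]: "w \<in> borel_measurable M" "x \<in> borel_measurable M"
    and q: "1 \<le> q" and W: "0 < W" "(\<integral>\<^sup>+s. w s \<partial>M) \<le> ennreal W"
    and x: "\<And>s. 0 \<le> x s" and y: "0 \<le> y" "ennreal y \<le> (\<integral>\<^sup>+s. w s * ennreal (x s) \<partial>M)"
  shows "ennreal (y powr q) \<le> ennreal (W powr (q - 1)) * (\<integral>\<^sup>+s. w s * ennreal (x s powr q) \<partial>M)"
proof -
  define D where "D = (\<integral>\<^sup>+s. w s * ennreal (x s powr q) \<partial>M)"
  consider "D = top" | "D = 0" | d where "D = ennreal d" "d > 0"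
    by (cases D) (auto simp: le_less)
  then show ?thesis
  proof cases
    case 1
    then show ?thesis using W by (simp add: D_def[symmetric] ennreal_mult_top)
  next
    case 2
    then have "AE s in M. w s * ennreal (x s powr q) = 0"
      unfolding D_def by (subst (asm) nn_integral_0_iff_AE) auto
    then have "AE s in M. w s * ennreal (x s) = 0"
      by eventually_elim (use x in auto)
    then have "(\<integral>\<^sup>+s. w s * ennreal (x s) \<partial>M) = 0"
      by (subst nn_integral_0_iff_AE) auto
    then have "y = 0" using y by simp
    then show ?thesis by simp
  next
    case 3
    \<comment> \<open>this choice of the point of tangency makes the integrated bound equal to W * A\<close>
    define A where "A = (d / W) powr (1 / q)"
    have A: "A > 0" using 3 W by (simp add: A_def)
    have Aq: "A powr q = d / W" using 3 W q by (simp add: A_def powr_powr)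
    have "ennreal y \<le> (\<integral>\<^sup>+s. ennreal ((1 - 1 / q) * A) * w s
        + ennreal (1 / q * A powr (1 - q)) * (w s * ennreal (x s powr q)) \<partial>M)"
    proof (rule order_trans[OF y(2)], rule nn_integral_mono)
      fix s
      have nn: "0 \<le> (1 - 1 / q) * A" "0 \<le> 1 / q * A powr (1 - q)" using q A by auto
      have "ennreal (x s) \<le> ennreal ((1 - 1 / q) * A + 1 / q * A powr (1 - q) * x s powr q)"
        by (intro ennreal_leI powr_le_tangent q x A)
      also have "\<dots> = ennreal ((1 - 1 / q) * A) + ennreal (1 / q * A powr (1 - q)) * ennreal (x s powr q)"
        using nn by (simp only: ennreal_plus[OF _ mult_nonneg_nonneg] ennreal_mult powr_ge_zero)
      finally have "w s * ennreal (x s) \<le> w s * \<dots>" by (rule mult_left_mono) simp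
      then show "w s * ennreal (x s) \<le> ennreal ((1 - 1 / q) * A) * w s
        + ennreal (1 / q * A powr (1 - q)) * (w s * ennreal (x s powr q))"
        by (simp add: distrib_left mult_ac)
    qed
    also have "\<dots> = ennreal ((1 - 1 / q) * A) * (\<integral>\<^sup>+s. w s \<partial>M) + ennreal (1 / q * A powr (1 - q)) * D"
      unfolding D_def by (simp add: nn_integral_add nn_integral_cmult)
    also have "\<dots> \<le> ennreal ((1 - 1 / q) * A) * ennreal W + ennreal (1 / q * A powr (1 - q)) * ennreal d"
      using W 3 by (intro add_mono mult_left_mono) auto
    also have "\<dots> = ennreal ((1 - 1 / q) * A * W + 1 / q * A powr (1 - q) * d)"
    proof -
      have n: "0 \<le> (1 - 1 / q) * A" "0 \<le> 1 / q * A powr (1 - q)" "0 \<le> W" "0 \<le> d" using q A W 3 by auto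
      show ?thesis
        by (simp only: ennreal_plus[OF mult_nonneg_nonneg mult_nonneg_nonneg] ennreal_mult n)
    qed
    also have "(1 - 1 / q) * A * W + 1 / q * A powr (1 - q) * d = W * A"
    proof -
      have "A powr (1 - q) * d = W * A" using A W 3 by (simp add: powr_diff Aq)
      then show ?thesis using q by (simp add: field_simps)
    qed
    finally have "y \<le> W * A" using A W by (simp add: ennreal_le_iff)
    then have "y powr q \<le> (W * A) powr q" using y q by (intro powr_mono2) auto
    also have "\<dots> = W powr (q - 1) * d" using A W by (simp add: powr_mult Aq powr_diff)
    finally have "ennreal (y powr q) \<le> ennreal (W powr (q - 1) * d)" by (rule ennreal_leI)
    then show ?thesis using 3 by (simp add: D_def[symmetric] ennreal_mult)
  qed
qed

text \<open>
  Schur's test: a nonnegative kernel all of whose row and column integrals are at most \<open>W\<close> maps \<open>L\<^sub>q\<close>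
  to itself with norm at most \<open>W\<close>. It is stated for any \<open>g\<close> that is dominated by the image of \<open>|f|\<close>.
\<close>

lemma lp_le_schur:
  fixes K :: "real \<Rightarrow> real \<Rightarrow> ennreal"
  assumes K[measurable]: "(\<lambda>(t, s). K t s) \<in> borel_measurable (lborel \<Otimes>\<^sub>M lborel)"
    and W: "0 < W" "\<And>t. (\<integral>\<^sup>+s. K t s \<partial>lborel) \<le> ennreal W" "\<And>s. (\<integral>\<^sup>+t. K t s \<partial>lborel) \<le> ennreal W"
    and q: "1 \<le> q" and f: "lp_le q f c"
    and g[measurable]: "g \<in> borel_measurable borel" and gs: "\<And>t. t \<notin> {0..<1} \<Longrightarrow> g t = 0"
    and le: "AE t in lborel. ennreal \<bar>g t\<bar> \<le> (\<integral>\<^sup>+s. K t s * ennreal \<bar>f s\<bar> \<partial>lborel)"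
  shows "lp_le q g (W * c)"
  using q
proof (cases rule: exponent_cases)
  case (fin r)
  have [measurable]: "f \<in> borel_measurable borel" using f by (rule lp_le_meas)
  have Kt[measurable]: "K t \<in> borel_measurable borel" for t using measurable_compose[OF measurable_Pair1' K, of t] by simp
  have "(\<integral>\<^sup>+t. ennreal (\<bar>g t\<bar> powr r) \<partial>lborel)
     \<le> (\<integral>\<^sup>+t. ennreal (W powr (r - 1)) * (\<integral>\<^sup>+s. K t s * ennreal (\<bar>f s\<bar> powr r) \<partial>lborel) \<partial>lborel)"
    using le
    by (intro nn_integral_mono_AE, elim AE_mp, intro AE_I2 impI nn_integral_weighted_powr_le)
       (use W fin in auto)
  also have "\<dots> = ennreal (W powr (r - 1)) * (\<integral>\<^sup>+t. (\<integral>\<^sup>+s. K t s * ennreal (\<bar>f s\<bar> powr r) \<partial>lborel) \<partial>lborel)"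
    by (rule nn_integral_cmult) measurable
  also have "(\<integral>\<^sup>+t. (\<integral>\<^sup>+s. K t s * ennreal (\<bar>f s\<bar> powr r) \<partial>lborel) \<partial>lborel)
      = (\<integral>\<^sup>+s. (\<integral>\<^sup>+t. K t s * ennreal (\<bar>f s\<bar> powr r) \<partial>lborel) \<partial>lborel)"
    by (rule lborel_pair.Fubini') measurable
  also have "\<dots> \<le> (\<integral>\<^sup>+s. ennreal W * ennreal (\<bar>f s\<bar> powr r) \<partial>lborel)"
  proof (rule nn_integral_mono)
    fix s :: real
    have "(\<lambda>t. K t s) \<in> borel_measurable borel" using measurable_compose[OF measurable_Pair2' K, of s] by simp
    then show "(\<integral>\<^sup>+t. K t s * ennreal (\<bar>f s\<bar> powr r) \<partial>lborel) \<le> ennreal W * ennreal (\<bar>f s\<bar> powr r)"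
      by (simp add: nn_integral_multc mult_right_mono W)
  qed
  also have "\<dots> = ennreal W * (\<integral>\<^sup>+s. ennreal (\<bar>f s\<bar> powr r) \<partial>lborel)" by (rule nn_integral_cmult) measurable
  also have "\<dots> \<le> ennreal W * ennreal (c powr r)"
    using f fin by (intro mult_left_mono) (auto simp: lp_le_ereal)
  finally have "(\<integral>\<^sup>+t. ennreal (\<bar>g t\<bar> powr r) \<partial>lborel) \<le> ennreal (W powr (r - 1)) * (ennreal W * ennreal (c powr r))"
    by (simp add: mult_left_mono)
  also have "\<dots> = ennreal ((W * c) powr r)"
    using W lp_le_nonneg[OF f] by (simp add: ennreal_mult[symmetric] powr_mult powr_diff)
  finally show ?thesis using fin W gs lp_le_nonneg[OF f] by (auto simp: lp_le_ereal)
next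
  case inf
  then have b: "AE s in lborel. \<bar>f s\<bar> \<le> c" and c: "0 \<le> c" using f by (auto simp: lp_le_infinity)
  have Kt[measurable]: "K t \<in> borel_measurable borel" for t using measurable_compose[OF measurable_Pair1' K, of t] by simp
  have "AE t in lborel. \<bar>g t\<bar> \<le> W * c"
    using le
  proof eventually_elim
    case (elim t)
    also have "(\<integral>\<^sup>+s. K t s * ennreal \<bar>f s\<bar> \<partial>lborel) \<le> (\<integral>\<^sup>+s. K t s * ennreal c \<partial>lborel)"
      using b by (intro nn_integral_mono_AE) (auto elim!: AE_mp intro!: mult_left_mono ennreal_leI)
    also have "\<dots> = (\<integral>\<^sup>+s. K t s \<partial>lborel) * ennreal c" by (rule nn_integral_multc) measurable
    also have "\<dots> \<le> ennreal W * ennreal c" by (intro mult_right_mono W) simp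
    also have "\<dots> = ennreal (W * c)" using W c by (simp add: ennreal_mult)
    finally show ?case using W c by (simp add: ennreal_le_iff)
  qed
  then show ?thesis using inf W c gs by (auto simp: lp_le_infinity)
qed

text \<open>
  Norm bounds pass to limits almost everywhere, by Fatou's lemma.
\<close>

lemma lp_le_limit:
  assumes q: "1 \<le> q" and g: "\<And>i::nat. lp_le q (g i) c"
    and h[measurable]: "h \<in> borel_measurable borel" and hs: "\<And>t. t \<notin> {0..<1} \<Longrightarrow> h t = 0"
    and lim: "AE t in lborel. (\<lambda>i. g i t) \<longlonglongrightarrow> h t"
  shows "lp_le q h c"
  using q
proof (cases rule: exponent_cases)
  case (fin r)
  have [measurable]: "g i \<in> borel_measurable borel" for i using g by (rule lp_le_meas)
  have "(\<integral>\<^sup>+t. ennreal (\<bar>h t\<bar> powr r) \<partial>lborel) = (\<integral>\<^sup>+t. liminf (\<lambda>i. ennreal (\<bar>g i t\<bar> powr r)) \<partial>lborel)"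
  proof (rule nn_integral_cong_AE)
    show "AE t in lborel. ennreal (\<bar>h t\<bar> powr r) = liminf (\<lambda>i. ennreal (\<bar>g i t\<bar> powr r))"
      using lim
    proof eventually_elim
      case (elim t)
      have "(\<lambda>i. \<bar>g i t\<bar> powr r) \<longlonglongrightarrow> \<bar>h t\<bar> powr r"
        using fin elim by (intro tendsto_powr2 tendsto_rabs tendsto_const) auto
      then have "(\<lambda>i. ennreal (\<bar>g i t\<bar> powr r)) \<longlonglongrightarrow> ennreal (\<bar>h t\<bar> powr r)" by (rule tendsto_ennrealI)
      then show ?case by (simp add: lim_imp_Liminf[symmetric])
    qed
  qed
  also have "\<dots> \<le> liminf (\<lambda>i. \<integral>\<^sup>+t. ennreal (\<bar>g i t\<bar> powr r) \<partial>lborel)"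
    by (rule nn_integral_liminf) measurable
  also have "\<dots> \<le> liminf (\<lambda>i::nat. ennreal (c powr r))"
    using g fin by (intro Liminf_mono) (auto simp: lp_le_ereal)
  also have "\<dots> = ennreal (c powr r)" by (simp add: Liminf_const)
  finally show ?thesis using fin hs g by (auto simp: lp_le_ereal)
next
  case inf
  have "AE t in lborel. \<forall>i. \<bar>g i t\<bar> \<le> c"
    using g inf by (subst AE_all_countable) (auto simp: lp_le_infinity)
  with lim have "AE t in lborel. \<bar>h t\<bar> \<le> c"
  proof eventually_elim
    case (elim t)
    have "(\<lambda>i. \<bar>g i t\<bar>) \<longlonglongrightarrow> \<bar>h t\<bar>" using elim by (intro tendsto_rabs) auto
    then show ?case by (rule LIMSEQ_le_const2) (use elim in auto)
  qed
  then show ?thesis using inf hs g by (auto simp: lp_le_infinity)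
qed

lemma lp_le_1_integrable:
  assumes "lp_le 1 f c"
  shows "integrable lborel f" "(\<integral>x. \<bar>f x\<bar> \<partial>lborel) \<le> c"
proof -
  have [measurable]: "f \<in> borel_measurable borel" using assms by (rule lp_le_meas)
  have b: "(\<integral>\<^sup>+x. ennreal \<bar>f x\<bar> \<partial>lborel) \<le> ennreal c"
    using assms lp_le_nonneg[OF assms] by (simp add: one_ereal_def lp_le_ereal)
  then have "(\<integral>\<^sup>+x. ennreal (norm (f x)) \<partial>lborel) < \<infinity>" by (simp add: le_less_trans)
  then show i: "integrable lborel f" by (intro integrableI_bounded) auto
  have "ennreal (\<integral>x. \<bar>f x\<bar> \<partial>lborel) = (\<integral>\<^sup>+x. ennreal \<bar>f x\<bar> \<partial>lborel)"
    using i by (intro nn_integral_eq_integral[symmetric]) auto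
  with b have "ennreal (\<integral>x. \<bar>f x\<bar> \<partial>lborel) \<le> ennreal c" by simp
  then show "(\<integral>x. \<bar>f x\<bar> \<partial>lborel) \<le> c"
    using lp_le_nonneg[OF assms] by (simp add: ennreal_le_iff)
qed

lemma lp_le_integrable:
  assumes "1 \<le> p" "lp_le p f c"
  shows "integrable lborel f" "(\<integral>x. \<bar>f x\<bar> \<partial>lborel) \<le> c"
  using lp_le_1_integrable lp_le_antimono_exponent[OF _ assms] by auto

section \<open>Riemann--Liouville operators as convolutions\<close>

text \<open>
  The convolution kernel \<open>u\<^sup>\<alpha>\<^sup>-\<^sup>1 / \<Gamma>(\<alpha>)\<close> on \<open>u > 0\<close>, and the operator that it induces on functions
  on the line that vanish outside \<open>[0,1)\<close>; the image is again cut off to \<open>[0,1)\<close>. Where the integral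
  does not exist, which happens only on a null set for \<open>f\<close> in \<open>L\<^sub>1\<close> and \<open>\<alpha> > 0\<close>, its value is \<open>0\<close>. Linearity
  in \<open>f\<close> is therefore only available almost everywhere.
\<close>

definition rl_kernel :: "real \<Rightarrow> real \<Rightarrow> real" where
  "rl_kernel \<alpha> u = (if 0 < u then u powr (\<alpha> - 1) / Gamma \<alpha> else 0)"

definition RL :: "real \<Rightarrow> (real \<Rightarrow> real) \<Rightarrow> real \<Rightarrow> real" where
  "RL \<alpha> f t = indicator {0..<1} t * (LINT s|lborel. rl_kernel \<alpha> (t - s) * f s)"

lemma rl_kernel_measurable [measurable]: "rl_kernel \<alpha> \<in> borel_measurable borel"
  unfolding rl_kernel_def[abs_def] by measurable

lemma rl_kernel_nonneg: "0 < \<alpha> \<Longrightarrow> 0 \<le> rl_kernel \<alpha> u"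
  by (simp add: rl_kernel_def Gamma_real_pos less_imp_le)

lemma RL_measurable:
  assumes [measurable]: "f \<in> borel_measurable borel"
  shows "RL \<alpha> f \<in> borel_measurable borel"
  unfolding RL_def[abs_def] by measurable

lemma RL_supp: "t \<notin> {0..<1} \<Longrightarrow> RL \<alpha> f t = 0"
  by (simp add: RL_def)

lemma RL_scale: "RL \<alpha> (\<lambda>s. a * f s) t = a * RL \<alpha> f t"
proof -
  have "(LINT s|lborel. rl_kernel \<alpha> (t - s) * (a * f s)) = a * (LINT s|lborel. rl_kernel \<alpha> (t - s) * f s)"
    by (subst integral_mult_right_zero[symmetric]) (simp add: mult_ac)
  then show ?thesis by (simp add: RL_def mult_ac)
qed

lemma nn_integral_reflect_translate:
  fixes k :: "real \<Rightarrow> ennreal"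
  assumes [measurable]: "k \<in> borel_measurable borel"
  shows "(\<integral>\<^sup>+s. k (t - s) \<partial>lborel) = (\<integral>\<^sup>+u. k u \<partial>lborel)"
    and "(\<integral>\<^sup>+t. k (t - s) \<partial>lborel) = (\<integral>\<^sup>+u. k u \<partial>lborel)"
  using nn_integral_real_affine[of k "-1" t] nn_integral_real_affine[of k 1 "-s"] by (simp_all add: add.commute)

lemma lp_le_convolution:
  fixes k :: "real \<Rightarrow> real"
  assumes [measurable]: "k \<in> borel_measurable borel"
    and W: "0 < W" "(\<integral>\<^sup>+u. ennreal (k u) \<partial>lborel) \<le> ennreal W"
    and q: "1 \<le> q" and f: "lp_le q f c"
    and g: "g \<in> borel_measurable borel" "\<And>t. t \<notin> {0..<1} \<Longrightarrow> g t = 0"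
    and le: "AE t in lborel. ennreal \<bar>g t\<bar> \<le> (\<integral>\<^sup>+s. ennreal (k (t - s)) * ennreal \<bar>f s\<bar> \<partial>lborel)"
  shows "lp_le q g (W * c)"
proof (rule lp_le_schur[where K = "\<lambda>t s. ennreal (k (t - s))" and f = f])
  show "(\<integral>\<^sup>+s. ennreal (k (t - s)) \<partial>lborel) \<le> ennreal W" for t
    using W nn_integral_reflect_translate(1)[of "\<lambda>u. ennreal (k u)" t] by simp
  show "(\<integral>\<^sup>+t. ennreal (k (t - s)) \<partial>lborel) \<le> ennreal W" for s
    using W nn_integral_reflect_translate(2)[of "\<lambda>u. ennreal (k u)" s] by simp
qed (use assms in auto)

lemma nn_integral_rl_kernel:
  assumes "0 < \<alpha>" "0 \<le> c"
  shows "(\<integral>\<^sup>+u. ennreal (rl_kernel \<alpha> u * indicator {..c} u) \<partial>lborel) = ennreal (c powr \<alpha> / Gamma (\<alpha> + 1))"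
proof -
  have G: "Gamma \<alpha> > 0" using assms by (simp add: Gamma_real_pos)
  have "(\<integral>\<^sup>+u. ennreal (rl_kernel \<alpha> u * indicator {..c} u) \<partial>lborel)
      = (\<integral>\<^sup>+u. ennreal (1 / Gamma \<alpha>) * (ennreal (u powr (\<alpha> - 1)) * indicator {0..c} u) \<partial>lborel)"
    using G by (intro nn_integral_cong)
      (auto simp: rl_kernel_def indicator_def ennreal_mult[symmetric] not_less)
  also have "\<dots> = ennreal (1 / Gamma \<alpha>) * (\<integral>\<^sup>+u. ennreal (u powr (\<alpha> - 1)) * indicator {0..c} u \<partial>lborel)"
    by (rule nn_integral_cmult) measurable
  also have "(\<integral>\<^sup>+u. ennreal (u powr (\<alpha> - 1)) * indicator {0..c} u \<partial>lborel) = ennreal (c powr (\<alpha> - 1 + 1) / (\<alpha> - 1 + 1))"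
    using assms by (intro nn_integral_has_integral_lebesgue' has_integral_powr_from_0) auto
  finally show ?thesis using assms G Gamma_plus1[of \<alpha>]
    by (simp add: ennreal_mult[symmetric] nonpos_Ints_def mult_ac)
qed

text \<open>
  For \<open>t\<close> in \<open>[0,1)\<close> only the values of the kernel on \<open>(0,1]\<close> matter, where it is integrable.
\<close>

lemma RL_integrand_bound:
  assumes "0 < \<alpha>" "lp_le p f c" "t \<in> {0..<1}"
  shows "\<bar>rl_kernel \<alpha> (t - s) * f s\<bar> = rl_kernel \<alpha> (t - s) * indicator {..1} (t - s) * \<bar>f s\<bar>"
  using assms(3) rl_kernel_nonneg[OF assms(1), of "t - s"] lp_le_supp[OF assms(2), of s]
  by (cases "s \<in> {0..<1}") (auto simp: abs_mult indicator_def)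

lemma RL_AE_integrable:
  assumes a: "0 < \<alpha>" and f: "lp_le 1 f c"
  shows "AE t in lborel. t \<in> {0..<1} \<longrightarrow> integrable lborel (\<lambda>s. rl_kernel \<alpha> (t - s) * f s)"
proof -
  have [measurable]: "f \<in> borel_measurable borel" using f by (rule lp_le_meas)
  define k where "k = (\<lambda>u. rl_kernel \<alpha> u * indicator {..1} u)"
  have [measurable]: "k \<in> borel_measurable borel" unfolding k_def by measurable
  have k0: "0 \<le> k u" for u using rl_kernel_nonneg[OF a] by (simp add: k_def)
  define H where "H = (\<lambda>t. \<integral>\<^sup>+s. ennreal (k (t - s)) * ennreal \<bar>f s\<bar> \<partial>lborel)"
  have [measurable]: "H \<in> borel_measurable borel" unfolding H_def by measurable
  have "(\<integral>\<^sup>+t. H t \<partial>lborel) = (\<integral>\<^sup>+s. (\<integral>\<^sup>+t. ennreal (k (t - s)) * ennreal \<bar>f s\<bar> \<partial>lborel) \<partial>lborel)"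
    unfolding H_def by (rule lborel_pair.Fubini') measurable
  also have "\<dots> = (\<integral>\<^sup>+s. (\<integral>\<^sup>+u. ennreal (k u) \<partial>lborel) * ennreal \<bar>f s\<bar> \<partial>lborel)"
    by (intro nn_integral_cong, subst nn_integral_multc, measurable)
       (simp add: nn_integral_reflect_translate(2)[of "\<lambda>u. ennreal (k u)"])
  also have "\<dots> = (\<integral>\<^sup>+u. ennreal (k u) \<partial>lborel) * (\<integral>\<^sup>+s. ennreal \<bar>f s\<bar> \<partial>lborel)"
    by (rule nn_integral_cmult) measurable
  also have "\<dots> < \<infinity>"
  proof -
    have "(\<integral>\<^sup>+u. ennreal (k u) \<partial>lborel) < \<infinity>"
      using nn_integral_rl_kernel[OF a, of 1] by (simp add: k_def)
    moreover have "(\<integral>\<^sup>+s. ennreal \<bar>f s\<bar> \<partial>lborel) < \<infinity>"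
      using lp_le_1_integrable(1)[OF f] by (simp add: integrable_iff_bounded)
    ultimately show ?thesis by (simp add: ennreal_mult_less_top)
  qed
  finally have "AE t in lborel. H t \<noteq> \<infinity>" by (intro nn_integral_PInf_AE) auto
  then show ?thesis
  proof eventually_elim
    case (elim t)
    show ?case
    proof
      assume t: "t \<in> {0..<1}"
      have "(\<integral>\<^sup>+s. ennreal (norm (rl_kernel \<alpha> (t - s) * f s)) \<partial>lborel) = H t"
        unfolding H_def
      proof (rule nn_integral_cong)
        fix s
        show "ennreal (norm (rl_kernel \<alpha> (t - s) * f s)) = ennreal (k (t - s)) * ennreal \<bar>f s\<bar>"
          using RL_integrand_bound[OF a f t, of s] k0[of "t - s"] by (simp add: k_def ennreal_mult)
      qed
      then show "integrable lborel (\<lambda>s. rl_kernel \<alpha> (t - s) * f s)"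
        using elim by (intro integrableI_bounded) (auto simp: less_top)
    qed
  qed
qed

lemma RL_add:
  assumes "0 < \<alpha>" "lp_le 1 f c" "lp_le 1 g d"
  shows "AE t in lborel. RL \<alpha> (\<lambda>s. f s + g s) t = RL \<alpha> f t + RL \<alpha> g t"
  using RL_AE_integrable[OF assms(1,2)] RL_AE_integrable[OF assms(1,3)]
  by eventually_elim (auto simp: RL_def distrib_left indicator_def)

lemma RL_diff:
  assumes "0 < \<alpha>" "lp_le 1 f c" "lp_le 1 g d"
  shows "AE t in lborel. RL \<alpha> (\<lambda>s. f s - g s) t = RL \<alpha> f t - RL \<alpha> g t"
  using RL_AE_integrable[OF assms(1,2)] RL_AE_integrable[OF assms(1,3)]
  by eventually_elim (auto simp: RL_def right_diff_distrib indicator_def)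

lemma RL_sum:
  assumes "0 < \<alpha>" "finite I" "\<And>i. i \<in> I \<Longrightarrow> lp_le 1 (f i) (c i)"
  shows "AE t in lborel. RL \<alpha> (\<lambda>s. \<Sum>i\<in>I. f i s) t = (\<Sum>i\<in>I. RL \<alpha> (f i) t)"
proof -
  have "AE t in lborel. \<forall>i\<in>I. t \<in> {0..<1} \<longrightarrow> integrable lborel (\<lambda>s. rl_kernel \<alpha> (t - s) * f i s)"
    using assms RL_AE_integrable by (intro AE_finite_allI) blast+
  then show ?thesis
    by eventually_elim (auto simp: RL_def sum_distrib_left indicator_def)
qed

lemma RL_lp_le:
  assumes a: "0 < \<alpha>" and p: "1 \<le> p" and f: "lp_le p f c"
  shows "lp_le p (RL \<alpha> f) (1 / Gamma (\<alpha> + 1) * c)"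
proof (rule lp_le_convolution[where k = "\<lambda>u. rl_kernel \<alpha> u * indicator {..1} u", OF _ _ _ p f])
  have [measurable]: "f \<in> borel_measurable borel" using f by (rule lp_le_meas)
  show "0 < 1 / Gamma (\<alpha> + 1)" using a by (simp add: Gamma_real_pos)
  show "(\<integral>\<^sup>+u. ennreal (rl_kernel \<alpha> u * indicator {..1} u) \<partial>lborel) \<le> ennreal (1 / Gamma (\<alpha> + 1))"
    using nn_integral_rl_kernel[OF a, of 1] by simp
  show "RL \<alpha> f \<in> borel_measurable borel" by (rule RL_measurable) measurable
  show "AE t in lborel. ennreal \<bar>RL \<alpha> f t\<bar> \<le>
      (\<integral>\<^sup>+s. ennreal (rl_kernel \<alpha> (t - s) * indicator {..1} (t - s)) * ennreal \<bar>f s\<bar> \<partial>lborel)"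
  proof (rule AE_I2)
    fix t
    show "ennreal \<bar>RL \<alpha> f t\<bar> \<le> (\<integral>\<^sup>+s. ennreal (rl_kernel \<alpha> (t - s) * indicator {..1} (t - s)) * ennreal \<bar>f s\<bar> \<partial>lborel)"
    proof (cases "t \<in> {0..<1}")
      case True
      have "ennreal \<bar>RL \<alpha> f t\<bar> \<le> (\<integral>\<^sup>+s. ennreal (norm (rl_kernel \<alpha> (t - s) * f s)) \<partial>lborel)"
        using True integral_norm_bound_ennreal[of lborel "\<lambda>s. rl_kernel \<alpha> (t - s) * f s"]
        by (cases "integrable lborel (\<lambda>s. rl_kernel \<alpha> (t - s) * f s)")
           (auto simp: RL_def not_integrable_integral_eq)
      also have "\<dots> = (\<integral>\<^sup>+s. ennreal (rl_kernel \<alpha> (t - s) * indicator {..1} (t - s)) * ennreal \<bar>f s\<bar> \<partial>lborel)"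
        using RL_integrand_bound[OF a f True] rl_kernel_nonneg[OF a] by (simp add: ennreal_mult)
      finally show ?thesis .
    qed (simp add: RL_def)
  qed
qed (auto simp: RL_def)

text \<open>
  The kernels form a convolution semigroup, by Euler's Beta integral.
\<close>

lemma nn_integral_rl_kernel_convolution:
  assumes "0 < \<alpha>" "0 < \<beta>"
  shows "(\<integral>\<^sup>+s. ennreal (rl_kernel \<alpha> (t - s) * rl_kernel \<beta> (s - r)) \<partial>lborel) = ennreal (rl_kernel (\<alpha> + \<beta>) (t - r))"
proof (cases "r < t")
  case False
  then have z: "rl_kernel \<alpha> (t - s) * rl_kernel \<beta> (s - r) = 0" for s by (auto simp: rl_kernel_def)
  show ?thesis using False by (simp only: z) (simp add: rl_kernel_def)
next
  case True
  define h where "h = t - r"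
  define w where "w = h powr (\<alpha> + \<beta> - 2) / (Gamma \<alpha> * Gamma \<beta>)"
  have h: "h > 0" using True by (simp add: h_def)
  have G: "Gamma \<alpha> > 0" "Gamma \<beta> > 0" "Gamma (\<alpha> + \<beta>) > 0" using assms by (auto intro: Gamma_real_pos)
  have w: "w \<ge> 0" using G by (simp add: w_def)
  have "(\<integral>\<^sup>+s. ennreal (rl_kernel \<alpha> (t - s) * rl_kernel \<beta> (s - r)) \<partial>lborel)
      = \<bar>h\<bar> * (\<integral>\<^sup>+x. ennreal (rl_kernel \<alpha> (t - (r + h * x)) * rl_kernel \<beta> (r + h * x - r)) \<partial>lborel)"
    using h by (intro nn_integral_real_affine) auto
  also have "(\<lambda>x. ennreal (rl_kernel \<alpha> (t - (r + h * x)) * rl_kernel \<beta> (r + h * x - r)))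
      = (\<lambda>x. ennreal w * (ennreal (x powr (\<beta> - 1) * (1 - x) powr (\<alpha> - 1)) * indicator {0..1} x))"
  proof
    fix x
    have 1: "t - (r + h * x) = h * (1 - x)" by (simp add: h_def algebra_simps)
    show "ennreal (rl_kernel \<alpha> (t - (r + h * x)) * rl_kernel \<beta> (r + h * x - r))
      = ennreal w * (ennreal (x powr (\<beta> - 1) * (1 - x) powr (\<alpha> - 1)) * indicator {0..1} x)"
    proof (cases "0 < x \<and> x < 1")
      case True
      have "rl_kernel \<alpha> (h * (1 - x)) * rl_kernel \<beta> (h * x) = w * (x powr (\<beta> - 1) * (1 - x) powr (\<alpha> - 1))"
      proof -
        have "h powr (\<alpha> - 1) * h powr (\<beta> - 1) = h powr (\<alpha> + \<beta> - 2)" by (simp add: powr_add[symmetric])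
        then show ?thesis using True h by (simp add: rl_kernel_def w_def powr_mult)
      qed
      then show ?thesis using True w by (simp add: 1 ennreal_mult[symmetric])
    next
      case False
      then have "x \<le> 0 \<or> x \<ge> 1" by auto
      then show ?thesis using h by (auto simp: 1 rl_kernel_def zero_less_mult_iff indicator_def)
    qed
  qed
  also have "(\<integral>\<^sup>+x. ennreal w * (ennreal (x powr (\<beta> - 1) * (1 - x) powr (\<alpha> - 1)) * indicator {0..1} x) \<partial>lborel)
      = ennreal w * ennreal (Beta \<beta> \<alpha>)"
    by (subst nn_integral_cmult, measurable, subst nn_integral_has_integral_lebesgue'[OF _ has_integral_Beta_real])
       (use assms in auto)
  also have "ennreal \<bar>h\<bar> * (ennreal w * ennreal (Beta \<beta> \<alpha>)) = ennreal (h * (w * Beta \<beta> \<alpha>))"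
    using h w G by (simp add: ennreal_mult[symmetric] Beta_def add.commute)
  also have "h * (w * Beta \<beta> \<alpha>) = rl_kernel (\<alpha> + \<beta>) h"
  proof -
    have "h * h powr (\<alpha> + \<beta> - 2) = h powr (\<alpha> + \<beta> - 1)"
      using h powr_add[of h 1 "\<alpha> + \<beta> - 2"] by simp
    then show ?thesis using h G by (simp add: w_def Beta_def rl_kernel_def add.commute field_simps)
  qed
  finally show ?thesis by (simp add: h_def)
qed

lemma RL_semigroup:
  assumes ab: "0 < \<alpha>" "0 < \<beta>" and f: "lp_le 1 f c"
  shows "AE t in lborel. RL \<alpha> (RL \<beta> f) t = RL (\<alpha> + \<beta>) f t"
proof -
  have [measurable]: "f \<in> borel_measurable borel" using f by (rule lp_le_meas)
  have "AE t in lborel. t \<in> {0..<1} \<longrightarrow> integrable lborel (\<lambda>s. rl_kernel (\<alpha> + \<beta>) (t - s) * f s)"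
    using ab f by (intro RL_AE_integrable) auto
  then show ?thesis
  proof eventually_elim
    case (elim t)
    show ?case
    proof (cases "t \<in> {0..<1}")
      case True
      with elim have int: "integrable lborel (\<lambda>s. rl_kernel (\<alpha> + \<beta>) (t - s) * f s)" by blast
      define F where "F = (\<lambda>r s. rl_kernel \<alpha> (t - s) * rl_kernel \<beta> (s - r) * f r)"
      have kk: "integrable lborel (\<lambda>s. rl_kernel \<alpha> (t - s) * rl_kernel \<beta> (s - r))"
               "(LINT s|lborel. rl_kernel \<alpha> (t - s) * rl_kernel \<beta> (s - r)) = rl_kernel (\<alpha> + \<beta>) (t - r)" for r
        using ab rl_kernel_nonneg nn_integral_rl_kernel_convolution[OF ab, of t r]
        by (auto intro!: integrableI_nn_integral_finite[where x = "rl_kernel (\<alpha> + \<beta>) (t - r)"] integral_eq_nn_integral[THEN trans])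
      have "integrable (lborel \<Otimes>\<^sub>M lborel) (\<lambda>(r, s). F r s)"
      proof (rule integrableI_bounded)
        show "(\<lambda>(r, s). F r s) \<in> borel_measurable (lborel \<Otimes>\<^sub>M lborel)" unfolding F_def by measurable
        have "(\<integral>\<^sup>+z. ennreal (norm (case z of (r, s) \<Rightarrow> F r s)) \<partial>(lborel \<Otimes>\<^sub>M lborel))
           = (\<integral>\<^sup>+r. (\<integral>\<^sup>+s. ennreal (norm (F r s)) \<partial>lborel) \<partial>lborel)"
          unfolding F_def by (subst lborel.nn_integral_fst[symmetric]) (auto simp: split_beta')
        also have "\<dots> = (\<integral>\<^sup>+r. ennreal (norm (rl_kernel (\<alpha> + \<beta>) (t - r) * f r)) \<partial>lborel)"
        proof (rule nn_integral_cong)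
          fix r
          have "(\<integral>\<^sup>+s. ennreal (norm (F r s)) \<partial>lborel)
            = (\<integral>\<^sup>+s. ennreal (rl_kernel \<alpha> (t - s) * rl_kernel \<beta> (s - r)) * ennreal \<bar>f r\<bar> \<partial>lborel)"
            using ab rl_kernel_nonneg
            by (intro nn_integral_cong) (simp add: F_def abs_mult ennreal_mult)
          also have "\<dots> = ennreal (rl_kernel (\<alpha> + \<beta>) (t - r)) * ennreal \<bar>f r\<bar>"
            by (subst nn_integral_multc) (auto simp: nn_integral_rl_kernel_convolution[OF ab])
          finally show "(\<integral>\<^sup>+s. ennreal (norm (F r s)) \<partial>lborel) = ennreal (norm (rl_kernel (\<alpha> + \<beta>) (t - r) * f r))"
            using ab rl_kernel_nonneg[of "\<alpha> + \<beta>"] by (simp add: abs_mult ennreal_mult)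
        qed
        also have "\<dots> < \<infinity>" using int by (simp add: integrable_iff_bounded)
        finally show "(\<integral>\<^sup>+z. ennreal (norm (case z of (r, s) \<Rightarrow> F r s)) \<partial>(lborel \<Otimes>\<^sub>M lborel)) < \<infinity>" .
      qed
      then have fub: "(LINT s|lborel. LINT r|lborel. F r s) = (LINT r|lborel. LINT s|lborel. F r s)"
        by (rule lborel_pair.Fubini_integral)
      have "RL \<alpha> (RL \<beta> f) t = (LINT s|lborel. LINT r|lborel. F r s)"
      proof -
        \<comment> \<open>the cut-off of the inner operator is harmless: the integrand already vanishes for s outside [0,1)\<close>
        have "rl_kernel \<alpha> (t - s) * RL \<beta> f s = (LINT r|lborel. F r s)" for s
        proof -
          have "rl_kernel \<alpha> (t - s) * (indicator {0..<1} s * (rl_kernel \<beta> (s - r) * f r)) = F r s" for r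
          proof (cases "s \<in> {0..<1}")
            case False
            then consider "s < 0" | "1 \<le> s" by fastforce
            then show ?thesis
            proof cases
              case 1
              then have "rl_kernel \<beta> (s - r) * f r = 0"
                using lp_le_supp[OF f, of r] by (cases "r < 0") (auto simp: rl_kernel_def)
              then show ?thesis by (simp add: F_def)
            next
              case 2
              then show ?thesis using True by (simp add: F_def rl_kernel_def)
            qed
          qed (simp add: F_def)
          then have "(LINT r|lborel. F r s) = (LINT r|lborel. rl_kernel \<alpha> (t - s) * (indicator {0..<1} s * (rl_kernel \<beta> (s - r) * f r)))"
            by simp
          then show ?thesis by (simp only: integral_mult_right_zero RL_def)
        qed
        then show ?thesis using True by (simp add: RL_def[of \<alpha>])
      qed
      also have "\<dots> = (LINT r|lborel. rl_kernel (\<alpha> + \<beta>) (t - r) * f r)"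
        unfolding fub unfolding F_def by (simp only: integral_mult_left_zero kk)
      finally show ?thesis using True by (simp add: RL_def)
    qed (simp add: RL_def)
  qed
qed

section \<open>Dyadic averages and Haar sums\<close>

text \<open>
  The unit interval is divided at level \<open>j\<close> into the intervals \<open>dyadic j k = [k/2\<^sup>j, (k+1)/2\<^sup>j)\<close>, \<open>k < 2\<^sup>j\<close>;
  \<open>cell j x\<close> is the index of the one that contains \<open>x\<close>, for \<open>x\<close> in \<open>[0,1)\<close>.
\<close>

definition cell :: "nat \<Rightarrow> real \<Rightarrow> nat" where
  "cell j x = nat \<lfloor>2 ^ j * x\<rfloor>"

definition dyadic :: "nat \<Rightarrow> nat \<Rightarrow> real set" where
  "dyadic j k = {real k / 2 ^ j ..< (real k + 1) / 2 ^ j}"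

text \<open>
  The mean value of \<open>f\<close> over \<open>dyadic j k\<close>, and the step function \<open>dyadic_mean j f\<close> with these values (the
  conditional expectation of \<open>f\<close> at level \<open>j\<close>).
\<close>

definition cell_mean :: "nat \<Rightarrow> (real \<Rightarrow> real) \<Rightarrow> nat \<Rightarrow> real" where
  "cell_mean j f k = 2 ^ j * (LINT s|lborel. f s * indicator (dyadic j k) s)"

definition dyadic_mean :: "nat \<Rightarrow> (real \<Rightarrow> real) \<Rightarrow> real \<Rightarrow> real" where
  "dyadic_mean j f t = indicator {0..<1} t * cell_mean j f (cell j t)"

text \<open>
  The unnormalized Haar sum of level \<open>j\<close>: it is \<open>c k\<close> on the left half and \<open>- c k\<close> on the right half of
  \<open>dyadic j k\<close>. The halves are the intervals of level \<open>j + 1\<close> with even and odd index.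
\<close>

definition haar :: "nat \<Rightarrow> (nat \<Rightarrow> real) \<Rightarrow> real \<Rightarrow> real" where
  "haar j c t = indicator {0..<1} t * (if even (cell (Suc j) t) then c (cell j t) else - c (cell j t))"

text \<open>
  The coefficients for which \<open>haar j (haar_coef j f)\<close> is the increment \<open>dyadic_mean (j + 1) f - dyadic_mean j f\<close>.
\<close>

definition haar_coef :: "nat \<Rightarrow> (real \<Rightarrow> real) \<Rightarrow> nat \<Rightarrow> real" where
  "haar_coef j f k = 2 ^ j * ((LINT s|lborel. f s * indicator (dyadic (Suc j) (2 * k)) s)
     - (LINT s|lborel. f s * indicator (dyadic (Suc j) (2 * k + 1)) s))"

text \<open>
  All averages of \<open>g\<close> over the dyadic intervals of level \<open>j\<close> vanish.
\<close>

definition mean_zero :: "nat \<Rightarrow> (real \<Rightarrow> real) \<Rightarrow> bool" where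
  "mean_zero j g \<longleftrightarrow> (\<forall>k<2 ^ j. (LINT s|lborel. g s * indicator (dyadic j k) s) = 0)"

lemma cell_measurable [measurable]: "cell j \<in> measurable borel (count_space UNIV)"
  unfolding cell_def[abs_def] by measurable

lemma dyadic_measurable [measurable]: "dyadic j k \<in> sets borel"
  unfolding dyadic_def by measurable

lemma mem_dyadic_iff: "x \<in> dyadic j k \<longleftrightarrow> \<lfloor>2 ^ j * x\<rfloor> = int k"
  by (auto simp: dyadic_def floor_eq_iff field_simps)

lemma mem_dyadic_cell: "0 \<le> x \<Longrightarrow> x \<in> dyadic j k \<longleftrightarrow> cell j x = k"
  by (auto simp: mem_dyadic_iff cell_def)

lemma cell_less: "x \<in> {0..<1} \<Longrightarrow> cell j x < 2 ^ j"
  by (auto simp: cell_def nat_less_iff floor_less_iff)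

lemma dyadic_subset: "k < 2 ^ j \<Longrightarrow> dyadic j k \<subseteq> {0..<1}"
proof -
  assume "k < 2 ^ j"
  then have "Suc k \<le> 2 ^ j" by simp
  then have "real (Suc k) \<le> real (2 ^ j)" by (rule of_nat_mono)
  then have "(real k + 1) / 2 ^ j \<le> 1" by (simp add: field_simps)
  moreover have "0 \<le> real k / 2 ^ j" by simp
  ultimately have "x \<in> {0..<1}" if "real k / 2 ^ j \<le> x \<and> x < (real k + 1) / 2 ^ j" for x
    using that unfolding atLeastLessThan_iff by linarith
  then show ?thesis unfolding dyadic_def by (intro subsetI) (simp only: atLeastLessThan_iff)
qed

lemma emeasure_dyadic: "emeasure lborel (dyadic j k) = ennreal (1 / 2 ^ j)"
proof -
  have "emeasure lborel (dyadic j k) = ennreal ((real k + 1) / 2 ^ j - real k / 2 ^ j)"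
    unfolding dyadic_def by (rule emeasure_lborel_Ico) (simp add: field_simps)
  also have "(real k + 1) / 2 ^ j - real k / 2 ^ j = 1 / 2 ^ j" by (simp add: add_divide_distrib)
  finally show ?thesis .
qed

lemma measure_dyadic: "measure lborel (dyadic j k) = 1 / 2 ^ j"
  using emeasure_dyadic[of j k] by (simp add: measure_def)

lemma cell_Suc: "0 \<le> x \<Longrightarrow> cell j x = cell (Suc j) x div 2"
proof -
  assume x: "0 \<le> x"
  have "\<lfloor>2 ^ j * x\<rfloor> = \<lfloor>2 ^ Suc j * x\<rfloor> div 2"
    using floor_divide_real_eq_div[of 2 "2 ^ Suc j * x"] by (simp add: mult.assoc)
  then show ?thesis unfolding cell_def by (simp add: nat_div_distrib del: power_Suc)
qed

lemma indicator_dyadic_Suc: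
  "(indicator (dyadic j k) s :: real) = indicator (dyadic (Suc j) (2 * k)) s + indicator (dyadic (Suc j) (2 * k + 1)) s"
proof (cases "0 \<le> s")
  case True
  then show ?thesis
    using cell_Suc[OF True, of j] by (auto simp: indicator_def mem_dyadic_cell)
next
  case False
  then have "s \<notin> dyadic i l" for i l
  proof -
    have "0 \<le> real l / 2 ^ i" by simp
    with False show ?thesis unfolding dyadic_def atLeastLessThan_iff by linarith
  qed
  then show ?thesis by simp
qed

lemma sum_indicator_dyadic:
  assumes "t \<in> {0..<1}"
  shows "(\<Sum>k<2 ^ j. \<phi> k * indicator (dyadic j k) t) = (\<phi> (cell j t) :: 'b::semiring_1)"
proof -
  have "(\<Sum>k<2 ^ j. \<phi> k * indicator (dyadic j k) t) = (\<Sum>k<2 ^ j. if cell j t = k then \<phi> k else 0)"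
    using assms by (intro sum.cong) (auto simp: indicator_def mem_dyadic_cell)
  then show ?thesis using cell_less[OF assms, of j] by (simp add: sum.delta')
qed

lemma haar_measurable: "haar j c \<in> borel_measurable borel"
proof -
  have [measurable]: "(\<lambda>t. c (cell j t)) \<in> borel_measurable borel"
    by (rule measurable_compose[OF cell_measurable]) simp
  show ?thesis unfolding haar_def[abs_def] by measurable
qed

lemma dyadic_mean_measurable: "dyadic_mean j f \<in> borel_measurable borel"
proof -
  have [measurable]: "(\<lambda>t. cell_mean j f (cell j t)) \<in> borel_measurable borel"
    by (rule measurable_compose[OF cell_measurable]) simp
  show ?thesis unfolding dyadic_mean_def[abs_def] by measurable
qed

lemma dyadic_mean_Suc_diff:
  assumes "integrable lborel f"
  shows "dyadic_mean (Suc j) f t - dyadic_mean j f t = haar j (haar_coef j f) t"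
proof (cases "t \<in> {0..<1}")
  case True
  define k where "k = cell j t"
  have i: "integrable lborel (\<lambda>s. f s * indicator (dyadic i l) s)" for i l
    using assms by (intro integrable_real_mult_indicator) auto
  have a: "(LINT s|lborel. f s * indicator (dyadic j k) s)
    = (LINT s|lborel. f s * indicator (dyadic (Suc j) (2 * k)) s) + (LINT s|lborel. f s * indicator (dyadic (Suc j) (2 * k + 1)) s)"
    unfolding indicator_dyadic_Suc[of j k] distrib_left by (rule Bochner_Integration.integral_add[OF i i])
  have c: "cell (Suc j) t = (if even (cell (Suc j) t) then 2 * k else 2 * k + 1)"
    using True cell_Suc[of t j] by (auto simp: k_def)
  show ?thesis
  proof (cases "even (cell (Suc j) t)")
    case e: True
    then have "cell (Suc j) t = 2 * k" using c by simp
    then show ?thesis using True e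
      by (simp add: dyadic_mean_def haar_def cell_mean_def haar_coef_def a[unfolded k_def] k_def[symmetric]) (simp add: a algebra_simps)
  next
    case o: False
    then have "cell (Suc j) t = 2 * k + 1" using c by simp
    then show ?thesis using True o
      by (simp add: dyadic_mean_def haar_def cell_mean_def haar_coef_def a[unfolded k_def] k_def[symmetric]) (simp add: a algebra_simps)
  qed
qed (simp add: dyadic_mean_def haar_def)

lemma haar_abs: "\<bar>haar j c t\<bar> = indicator {0..<1} t * \<bar>c (cell j t)\<bar>"
  by (simp add: haar_def abs_mult)

lemma haar_diff: "haar j (\<lambda>k. c k - d k) t = haar j c t - haar j d t"
  by (simp add: haar_def indicator_def)

lemma haar_mean_zero: "mean_zero j (haar j c)"
  unfolding mean_zero_def
proof (intro allI impI)
  fix k :: nat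
  assume k: "k < 2 ^ j"
  have "haar j c s * indicator (dyadic j k) s
      = c k * (indicator (dyadic (Suc j) (2 * k)) s - indicator (dyadic (Suc j) (2 * k + 1)) s)" for s
  proof (cases "s \<in> dyadic j k")
    case True
    then have s: "s \<in> {0..<1}" using dyadic_subset[OF k] by blast
    then have c: "cell j s = k" using True mem_dyadic_cell by auto
    show ?thesis using s c True cell_Suc[of s j] by (auto simp: haar_def indicator_def mem_dyadic_cell)
  next
    case False
    have "(indicator (dyadic (Suc j) (2 * k)) s :: real) + indicator (dyadic (Suc j) (2 * k + 1)) s = 0"
      using False indicator_dyadic_Suc[of j k s] by simp
    then have "(indicator (dyadic (Suc j) (2 * k)) s :: real) = 0" "(indicator (dyadic (Suc j) (2 * k + 1)) s :: real) = 0"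
      using add_nonneg_eq_0_iff[of "indicator (dyadic (Suc j) (2 * k)) s :: real" "indicator (dyadic (Suc j) (2 * k + 1)) s"]
      by simp_all
    then show ?thesis using False by simp
  qed
  then have "(LINT s|lborel. haar j c s * indicator (dyadic j k) s)
     = (LINT s|lborel. c k * (indicator (dyadic (Suc j) (2 * k)) s - indicator (dyadic (Suc j) (2 * k + 1)) s))"
    by simp
  also have "\<dots> = 0"
    by (subst integral_mult_right_zero, subst Bochner_Integration.integral_diff)
       (auto simp: measure_dyadic emeasure_dyadic intro!: integrable_real_indicator)
  finally show "(LINT s|lborel. haar j c s * indicator (dyadic j k) s) = 0" .
qed

lemma mean_zero_diff_dyadic_mean:
  assumes "integrable lborel f"
  shows "mean_zero j (\<lambda>t. f t - dyadic_mean j f t)"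
  unfolding mean_zero_def
proof (intro allI impI)
  fix k :: nat
  assume k: "k < 2 ^ j"
  have "(f s - dyadic_mean j f s) * indicator (dyadic j k) s = f s * indicator (dyadic j k) s - cell_mean j f k * indicator (dyadic j k) s" for s
  proof (cases "s \<in> dyadic j k")
    case True
    then have s: "s \<in> {0..<1}" using dyadic_subset[OF k] by blast
    then have c: "cell j s = k" using True mem_dyadic_cell by auto
    show ?thesis using s c by (simp add: dyadic_mean_def algebra_simps)
  qed simp
  then have "(LINT s|lborel. (f s - dyadic_mean j f s) * indicator (dyadic j k) s)
     = (LINT s|lborel. f s * indicator (dyadic j k) s - cell_mean j f k * indicator (dyadic j k) s)" by simp
  also have "\<dots> = (LINT s|lborel. f s * indicator (dyadic j k) s) - cell_mean j f k * measure lborel (dyadic j k)"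
    using assms by (subst Bochner_Integration.integral_diff)
      (auto simp: emeasure_dyadic intro!: integrable_real_mult_indicator integrable_real_indicator)
  also have "\<dots> = 0" by (simp add: measure_dyadic cell_mean_def)
  finally show "(LINT s|lborel. (f s - dyadic_mean j f s) * indicator (dyadic j k) s) = 0" .
qed

text \<open>
  A function whose averages of level \<open>j\<close> vanish is orthogonal to every step function of that level.
\<close>

lemma mean_zero_integral_step:
  assumes m: "mean_zero j g" and g: "integrable lborel g" and s: "\<And>x. x \<notin> {0..<1} \<Longrightarrow> g x = 0"
  shows "integrable lborel (\<lambda>s. b (cell j s) * g s)" "(LINT s|lborel. b (cell j s) * g s) = 0"
proof -
  have e: "b (cell j s) * g s = (\<Sum>k<2 ^ j. b k * (g s * indicator (dyadic j k) s))" for s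
  proof (cases "s \<in> {0..<1}")
    case True
    have "(\<Sum>k<2 ^ j. b k * (g s * indicator (dyadic j k) s)) = (\<Sum>k<2 ^ j. b k * indicator (dyadic j k) s) * g s"
      unfolding sum_distrib_right by (intro sum.cong) simp_all
    then show ?thesis using sum_indicator_dyadic[OF True, of b j] by simp
  qed (simp add: s)
  have i: "integrable lborel (\<lambda>s. b k * (g s * indicator (dyadic j k) s))" for k
    using g by (intro integrable_mult_right integrable_real_mult_indicator) auto
  show "integrable lborel (\<lambda>s. b (cell j s) * g s)"
    unfolding e using i by (intro Bochner_Integration.integrable_sum)
  show "(LINT s|lborel. b (cell j s) * g s) = 0"
    unfolding e using i m by (subst Bochner_Integration.integral_sum) (auto simp: mean_zero_def)
qed

lemma nn_integral_step:
  "(\<integral>\<^sup>+t. \<phi> (cell j t) * indicator {0..<1} t \<partial>lborel) = (\<Sum>k<2 ^ j. \<phi> k * ennreal (1 / 2 ^ j))"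
proof -
  have "\<phi> (cell j t) * indicator {0..<1} t = (\<Sum>k<2 ^ j. \<phi> k * indicator (dyadic j k) t)" for t
  proof (cases "t \<in> {0..<1}")
    case True
    then show ?thesis using sum_indicator_dyadic[OF True, of \<phi> j] by simp
  next
    case False
    then have "t \<notin> dyadic j k" if "k < 2 ^ j" for k using dyadic_subset[OF that] by blast
    then show ?thesis using False by simp
  qed
  then have "(\<integral>\<^sup>+t. \<phi> (cell j t) * indicator {0..<1} t \<partial>lborel) = (\<integral>\<^sup>+t. (\<Sum>k<2 ^ j. \<phi> k * indicator (dyadic j k) t) \<partial>lborel)"
    by simp
  also have "\<dots> = (\<Sum>k<2 ^ j. \<phi> k * ennreal (1 / 2 ^ j))"
    by (subst nn_integral_sum) (auto simp: nn_integral_cmult_indicator emeasure_dyadic)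
  finally show ?thesis .
qed

lemma haar_coef_sum_le:
  assumes "1 \<le> r" "lp_le (ereal r) (haar j c) B"
  shows "(\<Sum>k<2 ^ j. \<bar>c k\<bar> powr r) \<le> 2 ^ j * B powr r"
proof -
  have "(\<integral>\<^sup>+t. ennreal (\<bar>haar j c t\<bar> powr r) \<partial>lborel) = (\<integral>\<^sup>+t. ennreal (\<bar>c (cell j t)\<bar> powr r) * indicator {0..<1} t \<partial>lborel)"
    using assms(1) by (intro nn_integral_cong) (auto simp: haar_abs indicator_def)
  also have "\<dots> = (\<Sum>k<2 ^ j. ennreal (\<bar>c k\<bar> powr r) * ennreal (1 / 2 ^ j))" by (rule nn_integral_step)
  also have "\<dots> = ennreal ((\<Sum>k<2 ^ j. \<bar>c k\<bar> powr r) / 2 ^ j)"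
    by (simp add: ennreal_mult[symmetric] sum_ennreal sum_divide_distrib)
  finally have "ennreal ((\<Sum>k<2 ^ j. \<bar>c k\<bar> powr r) / 2 ^ j) \<le> ennreal (B powr r)"
    using assms by (simp add: lp_le_ereal)
  then show ?thesis by (simp add: ennreal_le_iff field_simps)
qed

lemma haar_lp_le_sup:
  assumes "1 \<le> p" "0 \<le> B" "\<And>k. k < 2 ^ j \<Longrightarrow> \<bar>c k\<bar> \<le> B"
  shows "lp_le p (haar j c) B"
proof (rule lp_le_antimono_exponent[OF assms(1)])
  show "lp_le \<infinity> (haar j c) B"
    unfolding lp_le_infinity
  proof (intro conjI allI impI AE_I2)
    show "haar j c x = 0" if "x \<notin> {0..<1}" for x using that by (simp add: haar_def)
    show "\<bar>haar j c x\<bar> \<le> B" for x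
      using assms(2) assms(3)[OF cell_less] by (cases "x \<in> {0..<1}") (simp_all add: haar_abs)
  qed (use assms haar_measurable in auto)
qed simp

text \<open>
  Averaging over dyadic intervals is a contraction of every \<open>L\<^sub>p\<close>, by Schur's test.
\<close>

lemma dyadic_mean_lp_le:
  assumes p: "1 \<le> p" and f: "lp_le p f c"
  shows "lp_le p (dyadic_mean j f) c"
proof -
  have int: "integrable lborel f" using lp_le_integrable(1)[OF p f] .
  have [measurable]: "f \<in> borel_measurable borel" using f by (rule lp_le_meas)
  define r where "r = (\<lambda>t. real (cell j t))"
  have [measurable]: "r \<in> borel_measurable borel"
    unfolding r_def by (rule measurable_compose[OF cell_measurable]) simp
  define K where "K = (\<lambda>t s. ennreal (2 ^ j) * (indicator {0..<1} t * (indicator {0..<1} s * (if r t = r s then 1 else 0))) :: ennreal)"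
  have sym: "K t s = K s t" for s t by (cases "r t = r s") (simp_all add: K_def mult.commute)
  have c: "K t s = ennreal (2 ^ j) * indicator (dyadic j (cell j t)) s" if "t \<in> {0..<1}" for t s
  proof (cases "s \<in> {0..<1}")
    case True
    then show ?thesis using that by (auto simp: K_def r_def indicator_def mem_dyadic_cell)
  next
    case False
    then have "s \<notin> dyadic j (cell j t)" using dyadic_subset[OF cell_less[OF that], of j] by blast
    then show ?thesis using False by (simp add: K_def)
  qed
  have le: "(\<integral>\<^sup>+s. K t s \<partial>lborel) \<le> ennreal 1" for t
  proof (cases "t \<in> {0..<1}")
    case True
    then show ?thesis
      by (simp add: c nn_integral_cmult_indicator emeasure_dyadic ennreal_mult[symmetric] del: ennreal_1)
  qed (simp add: K_def)
  have "lp_le p (dyadic_mean j f) (1 * c)"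
  proof (rule lp_le_schur[where K = K, OF _ _ le _ p f])
    show "(\<lambda>(t, s). K t s) \<in> borel_measurable (lborel \<Otimes>\<^sub>M lborel)" unfolding K_def by measurable
    show "(\<integral>\<^sup>+t. K t s \<partial>lborel) \<le> ennreal 1" for s
    proof -
      have "(\<lambda>t. K t s) = K s" by (rule ext) (rule sym)
      then show ?thesis using le[of s] by simp
    qed
    show "AE t in lborel. ennreal \<bar>dyadic_mean j f t\<bar> \<le> (\<integral>\<^sup>+s. K t s * ennreal \<bar>f s\<bar> \<partial>lborel)"
    proof (rule AE_I2)
      fix t
      show "ennreal \<bar>dyadic_mean j f t\<bar> \<le> (\<integral>\<^sup>+s. K t s * ennreal \<bar>f s\<bar> \<partial>lborel)"
      proof (cases "t \<in> {0..<1}")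
        case True
        let ?I = "dyadic j (cell j t)"
        have i: "integrable lborel (\<lambda>s. f s * indicator ?I s)"
          using int by (intro integrable_real_mult_indicator) auto
        have "ennreal \<bar>dyadic_mean j f t\<bar> = ennreal (2 ^ j) * ennreal \<bar>LINT s|lborel. f s * indicator ?I s\<bar>"
          using True by (simp add: dyadic_mean_def cell_mean_def abs_mult ennreal_mult)
        also have "\<dots> \<le> ennreal (2 ^ j) * (\<integral>\<^sup>+s. ennreal (norm (f s * indicator ?I s)) \<partial>lborel)"
          using integral_norm_bound_ennreal[OF i] by (intro mult_left_mono) auto
        also have "\<dots> = (\<integral>\<^sup>+s. ennreal (2 ^ j) * ennreal (norm (f s * indicator ?I s)) \<partial>lborel)"
          by (intro nn_integral_cmult[symmetric]) measurable
        also have "\<dots> = (\<integral>\<^sup>+s. K t s * ennreal \<bar>f s\<bar> \<partial>lborel)"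
          unfolding c[OF True] by (intro nn_integral_cong) (simp add: indicator_def)
        finally show ?thesis .
      qed (simp add: dyadic_mean_def)
    qed
  qed (auto simp: dyadic_mean_measurable dyadic_mean_def)
  then show ?thesis by simp
qed

section \<open>Localization on functions with vanishing dyadic averages\<close>

text \<open>
  The kernel that dominates \<open>R\<^sup>\<alpha>\<close> on functions whose averages over dyadic intervals of length \<open>h\<close> vanish. Near the diagonal it
  is the original kernel; at distance \<open>u \<ge> h\<close> it gains a factor \<open>h/u\<close>, which makes it integrable at
  infinity when \<open>\<alpha> < 1\<close>.
\<close>

definition local_kernel :: "real \<Rightarrow> real \<Rightarrow> real \<Rightarrow> real" where
  "local_kernel \<alpha> h u = rl_kernel \<alpha> u * indicator {..2 * h} u + h / Gamma \<alpha> * (u powr (\<alpha> - 2) * indicator {h..} u)"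

lemma local_kernel_measurable [measurable]: "local_kernel \<alpha> h \<in> borel_measurable borel"
  unfolding local_kernel_def[abs_def] by measurable

lemma powr_neg_diff_le:
  fixes u w h \<alpha> :: real
  assumes "0 < \<alpha>" "\<alpha> < 1" "0 < u" "u \<le> w" "w \<le> u + h"
  shows "0 \<le> u powr (\<alpha> - 1) - w powr (\<alpha> - 1)" "u powr (\<alpha> - 1) - w powr (\<alpha> - 1) \<le> h * u powr (\<alpha> - 2)"
proof -
  show "0 \<le> u powr (\<alpha> - 1) - w powr (\<alpha> - 1)"
    using assms powr_mono2'[of "\<alpha> - 1" u w] by simp
  have w: "w > 0" using assms by simp
  have "u / w \<le> (u / w) powr (1 - \<alpha>)"
    using assms w powr_mono'[of "1 - \<alpha>" 1 "u / w"] by simp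
  also have "\<dots> = w powr (\<alpha> - 1) / u powr (\<alpha> - 1)"
    using assms w by (simp add: powr_divide powr_diff)
  finally have 1: "u powr (\<alpha> - 1) * (u / w) \<le> w powr (\<alpha> - 1)"
    using assms by (simp add: field_simps)
  have "u powr (\<alpha> - 1) - w powr (\<alpha> - 1) \<le> u powr (\<alpha> - 1) * (1 - u / w)"
    using 1 by (simp add: algebra_simps)
  also have "1 - u / w \<le> h / u"
  proof -
    have "1 - u / w = (w - u) / w" using w by (simp add: diff_divide_distrib)
    also have "\<dots> \<le> h / u" using assms w by (intro frac_le) auto
    finally show ?thesis .
  qed
  then have "u powr (\<alpha> - 1) * (1 - u / w) \<le> u powr (\<alpha> - 1) * (h / u)" by (intro mult_left_mono) auto
  also have "u powr (\<alpha> - 1) * (h / u) = h * u powr (\<alpha> - 2)"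
  proof -
    have "u powr (\<alpha> - 1) = u powr (\<alpha> - 2) * u" using powr_add[of u "\<alpha> - 2" 1] assms by simp
    then show ?thesis using assms by simp
  qed
  finally show "u powr (\<alpha> - 1) - w powr (\<alpha> - 1) \<le> h * u powr (\<alpha> - 2)" .
qed

lemma nn_integral_local_kernel:
  assumes "0 < \<alpha>" "\<alpha> < 1" "0 < h"
  shows "(\<integral>\<^sup>+u. ennreal (local_kernel \<alpha> h u) \<partial>lborel)
     \<le> ennreal ((2 + \<alpha> / (1 - \<alpha>)) / Gamma (\<alpha> + 1) * h powr \<alpha>)"
proof -
  have G: "Gamma \<alpha> > 0" "Gamma (\<alpha> + 1) > 0" "Gamma (\<alpha> + 1) = \<alpha> * Gamma \<alpha>"
    using assms Gamma_plus1[of \<alpha>] nonpos_Ints_nonpos[of \<alpha>] by (auto intro: Gamma_real_pos)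
  have "(\<integral>\<^sup>+u. ennreal (local_kernel \<alpha> h u) \<partial>lborel)
     = (\<integral>\<^sup>+u. ennreal (rl_kernel \<alpha> u * indicator {..2 * h} u) + ennreal (h / Gamma \<alpha>) * (ennreal (u powr (\<alpha> - 2)) * indicator {h..} u) \<partial>lborel)"
  proof (rule nn_integral_cong)
    fix u
    have "0 \<le> rl_kernel \<alpha> u * indicator {..2 * h} u" using rl_kernel_nonneg assms by simp
    moreover have "ennreal (h / Gamma \<alpha>) * (ennreal (u powr (\<alpha> - 2)) * indicator {h..} u) = ennreal (h / Gamma \<alpha> * (u powr (\<alpha> - 2) * indicator {h..} u))"
      using assms G by (simp add: ennreal_mult[symmetric] ennreal_indicator[symmetric] del: ennreal_indicator)
    ultimately show "ennreal (local_kernel \<alpha> h u) = ennreal (rl_kernel \<alpha> u * indicator {..2 * h} u) + ennreal (h / Gamma \<alpha>) * (ennreal (u powr (\<alpha> - 2)) * indicator {h..} u)"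
      using assms G unfolding local_kernel_def by simp
  qed
  also have "\<dots> = ennreal ((2 * h) powr \<alpha> / Gamma (\<alpha> + 1)) + ennreal (h / Gamma \<alpha>) * (\<integral>\<^sup>+u. ennreal (u powr (\<alpha> - 2)) * indicator {h..} u \<partial>lborel)"
    using assms by (subst nn_integral_add, measurable, subst nn_integral_rl_kernel, simp, simp, subst nn_integral_cmult, measurable)
  also have "(\<integral>\<^sup>+u. ennreal (u powr (\<alpha> - 2)) * indicator {h..} u \<partial>lborel) = ennreal (- (h powr (\<alpha> - 2 + 1)) / (\<alpha> - 2 + 1))"
    using assms by (intro nn_integral_has_integral_lebesgue' has_integral_powr_to_inf) auto
  also have "- (h powr (\<alpha> - 2 + 1)) / (\<alpha> - 2 + 1) = h powr (\<alpha> - 1) / (1 - \<alpha>)"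
    using assms by (simp add: field_simps)
  also have "ennreal ((2 * h) powr \<alpha> / Gamma (\<alpha> + 1)) + ennreal (h / Gamma \<alpha>) * ennreal (h powr (\<alpha> - 1) / (1 - \<alpha>))
     = ennreal ((2 * h) powr \<alpha> / Gamma (\<alpha> + 1) + h / Gamma \<alpha> * (h powr (\<alpha> - 1) / (1 - \<alpha>)))"
  proof -
    have n: "0 \<le> (2 * h) powr \<alpha> / Gamma (\<alpha> + 1)" "0 \<le> h / Gamma \<alpha>" "0 \<le> h powr (\<alpha> - 1) / (1 - \<alpha>)" using assms G by auto
    show ?thesis by (simp only: ennreal_plus[OF _ mult_nonneg_nonneg] ennreal_mult n)
  qed
  also have "\<dots> \<le> ennreal ((2 + \<alpha> / (1 - \<alpha>)) / Gamma (\<alpha> + 1) * h powr \<alpha>)"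
  proof (rule ennreal_leI)
    have "(2 * h) powr \<alpha> = 2 powr \<alpha> * h powr \<alpha>" using assms by (simp add: powr_mult)
    also have "\<dots> \<le> 2 * h powr \<alpha>" using assms powr_mono[of \<alpha> 1 2] by (intro mult_right_mono) auto
    finally have "(2 * h) powr \<alpha> / Gamma (\<alpha> + 1) \<le> 2 * h powr \<alpha> / Gamma (\<alpha> + 1)"
      using G by (intro divide_right_mono) auto
    moreover have "h / Gamma \<alpha> * (h powr (\<alpha> - 1) / (1 - \<alpha>)) = \<alpha> / (1 - \<alpha>) / Gamma (\<alpha> + 1) * h powr \<alpha>"
    proof -
      have "h * h powr (\<alpha> - 1) = h powr \<alpha>" using assms powr_add[of h 1 "\<alpha> - 1"] by simp
      moreover have "h / Gamma \<alpha> * (h powr (\<alpha> - 1) / (1 - \<alpha>)) = (h * h powr (\<alpha> - 1)) / (Gamma \<alpha> * (1 - \<alpha>))" by simp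
      ultimately show ?thesis using assms G by (simp add: G(3))
    qed
    ultimately show "(2 * h) powr \<alpha> / Gamma (\<alpha> + 1) + h / Gamma \<alpha> * (h powr (\<alpha> - 1) / (1 - \<alpha>)) \<le> (2 + \<alpha> / (1 - \<alpha>)) / Gamma (\<alpha> + 1) * h powr \<alpha>"
      by (simp add: add_divide_distrib distrib_right)
  qed
  finally show ?thesis .
qed

text \<open>
  For fixed \<open>t\<close>, the value of the kernel at the left end point of the dyadic interval of \<open>s\<close> may be subtracted without changing the
  integral, provided that this interval lies at least two places to the left of that of \<open>t\<close>.
\<close>

lemma RL_mean_zero_local:
  assumes a: "0 < \<alpha>" "\<alpha> < 1" and g: "lp_le 1 g c" and m: "mean_zero j g"
  shows "AE t in lborel. ennreal \<bar>RL \<alpha> g t\<bar> \<le> (\<integral>\<^sup>+s. ennreal (local_kernel \<alpha> (1 / 2 ^ j) (t - s)) * ennreal \<bar>g s\<bar> \<partial>lborel)"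
  using RL_AE_integrable[OF a(1) g]
proof eventually_elim
  case (elim t)
  show ?case
  proof (cases "t \<in> {0..<1}")
    case True
    then have int: "integrable lborel (\<lambda>s. rl_kernel \<alpha> (t - s) * g s)" using elim by blast
    define h where "h = 1 / (2 ^ j :: real)"
    have h: "h > 0" by (simp add: h_def)
    have G: "Gamma \<alpha> > 0" using a by (simp add: Gamma_real_pos)
    define i where "i = cell j t"
    \<comment> \<open>the step function to be subtracted; it is zero on the cell of t and on its left neighbour\<close>
    define b where "b = (\<lambda>k. if k + 2 \<le> i then rl_kernel \<alpha> (t - real k * h) else 0)"
    have b: "integrable lborel (\<lambda>s. b (cell j s) * g s)" "(LINT s|lborel. b (cell j s) * g s) = 0"
      using mean_zero_integral_step[OF m lp_le_1_integrable(1)[OF g] lp_le_supp[OF g]] by auto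
    have cellb: "real (cell j x) * h \<le> x" "x < (real (cell j x) + 1) * h" if "x \<in> {0..<1}" for x
      using that mem_dyadic_cell[of x j "cell j x"] by (auto simp: dyadic_def h_def)
    have pw: "\<bar>rl_kernel \<alpha> (t - s) - b (cell j s)\<bar> \<le> local_kernel \<alpha> h (t - s)" if s: "s \<in> {0..<1}" for s
    proof (cases "cell j s + 2 \<le> i")
      case far: True
      define u where "u = t - s"
      define w where "w = t - real (cell j s) * h"
      have "(real (cell j s) + 2) * h \<le> real i * h" using far h by (intro mult_right_mono) linarith+
      then have "(real (cell j s) + 1) * h + h \<le> t" using cellb(1)[OF True] unfolding i_def by (simp add: algebra_simps)
      then have u: "h < u" using cellb(2)[OF s] by (simp add: u_def)
      have w: "u \<le> w" "w \<le> u + h" using cellb[OF s] by (auto simp: u_def w_def algebra_simps)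
      have n: "0 \<le> rl_kernel \<alpha> u * indicator {..2 * h} u" using rl_kernel_nonneg[OF a(1)] by simp
      have "\<bar>rl_kernel \<alpha> u - rl_kernel \<alpha> w\<bar> = (u powr (\<alpha> - 1) - w powr (\<alpha> - 1)) / Gamma \<alpha>"
        using powr_neg_diff_le(1)[OF a _ w] u w h G by (simp add: rl_kernel_def diff_divide_distrib[symmetric])
      also have "\<dots> \<le> h * u powr (\<alpha> - 2) / Gamma \<alpha>"
        using powr_neg_diff_le(2)[OF a _ w] u h G by (intro divide_right_mono) auto
      also have "\<dots> \<le> local_kernel \<alpha> h u" using n u by (simp add: local_kernel_def)
      finally show ?thesis using far by (simp add: b_def u_def w_def)
    next
      case near: False
      then have "real i + 1 \<le> real (cell j s) + 2" by simp
      then have "(real i + 1) * h \<le> (real (cell j s) + 2) * h" using h by (intro mult_right_mono) auto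
      then have u: "t - s < 2 * h" using cellb(2)[OF True] cellb(1)[OF s] unfolding i_def by (simp add: algebra_simps)
      have n: "0 \<le> h / Gamma \<alpha> * ((t - s) powr (\<alpha> - 2) * indicator {h..} (t - s))" using h G by simp
      have "\<bar>rl_kernel \<alpha> (t - s) - b (cell j s)\<bar> = rl_kernel \<alpha> (t - s)"
        using near rl_kernel_nonneg[OF a(1)] by (simp add: b_def)
      also have "\<dots> \<le> local_kernel \<alpha> h (t - s)" unfolding local_kernel_def using n u by simp
      finally show ?thesis .
    qed
    have "RL \<alpha> g t = (LINT s|lborel. rl_kernel \<alpha> (t - s) * g s - b (cell j s) * g s)"
      using True int b by (simp add: RL_def)
    then have "ennreal \<bar>RL \<alpha> g t\<bar> \<le> (\<integral>\<^sup>+s. ennreal (norm (rl_kernel \<alpha> (t - s) * g s - b (cell j s) * g s)) \<partial>lborel)"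
      using integral_norm_bound_ennreal[OF Bochner_Integration.integrable_diff[OF int b(1)]] by simp
    also have "\<dots> \<le> (\<integral>\<^sup>+s. ennreal (local_kernel \<alpha> h (t - s)) * ennreal \<bar>g s\<bar> \<partial>lborel)"
    proof (rule nn_integral_mono)
      fix s
      show "ennreal (norm (rl_kernel \<alpha> (t - s) * g s - b (cell j s) * g s)) \<le> ennreal (local_kernel \<alpha> h (t - s)) * ennreal \<bar>g s\<bar>"
      proof (cases "s \<in> {0..<1}")
        case s: True
        have "norm (rl_kernel \<alpha> (t - s) * g s - b (cell j s) * g s) = \<bar>rl_kernel \<alpha> (t - s) - b (cell j s)\<bar> * \<bar>g s\<bar>"
          by (simp add: left_diff_distrib[symmetric] abs_mult)
        also have "\<dots> \<le> local_kernel \<alpha> h (t - s) * \<bar>g s\<bar>" using pw[OF s] by (intro mult_right_mono) auto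
        finally have "ennreal (norm (rl_kernel \<alpha> (t - s) * g s - b (cell j s) * g s)) \<le> ennreal (local_kernel \<alpha> h (t - s) * \<bar>g s\<bar>)"
          by (rule ennreal_leI)
        then show ?thesis using order_trans[OF abs_ge_zero pw[OF s]] by (simp add: ennreal_mult)
      next
        case False
        then show ?thesis using lp_le_supp[OF g False] by simp
      qed
    qed
    finally show ?thesis by (simp add: h_def)
  qed (simp add: RL_def)
qed

lemma inverse_Gamma_bounded:
  "\<exists>G>0. \<forall>\<alpha>. 0 < \<alpha> \<and> \<alpha> \<le> 1 \<longrightarrow> 1 / Gamma (\<alpha> + 1) \<le> (G::real)"
proof -
  have "continuous_on {0..1} (\<lambda>\<alpha>::real. 1 / Gamma (\<alpha> + 1))"
    unfolding divide_inverse rGamma_inverse_Gamma[symmetric]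
    by (intro continuous_on_mult continuous_on_const continuous_on_compose2[OF continuous_on_rGamma[of UNIV]] continuous_intros) auto
  then have "compact ((\<lambda>\<alpha>::real. 1 / Gamma (\<alpha> + 1)) ` {0..1})" by (intro compact_continuous_image) auto
  then have "bounded ((\<lambda>\<alpha>::real. 1 / Gamma (\<alpha> + 1)) ` {0..1})" by (rule compact_imp_bounded)
  then obtain G where "G > 0" "\<forall>x\<in>(\<lambda>\<alpha>::real. 1 / Gamma (\<alpha> + 1)) ` {0..1}. norm x \<le> G"
    unfolding bounded_pos by blast
  then show ?thesis by (intro exI[of _ G]) (auto simp: abs_le_iff)
qed

text \<open>
  The key estimate. The constant depends only on \<open>\<alpha>0\<close>: as \<open>\<alpha>\<close> tends to \<open>0\<close>, the factor \<open>1/\<Gamma>(\<alpha>)\<close> of the kernel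
  compensates the factor \<open>1/\<alpha>\<close> from the integral of the kernel near \<open>0\<close>.
\<close>

lemma RL_mean_zero_lp_le:
  assumes \<alpha>0: "\<alpha>0 < 1"
  shows "\<exists>C>0. \<forall>\<alpha>. 0 < \<alpha> \<and> \<alpha> \<le> \<alpha>0 \<longrightarrow> (\<forall>j q f c. 1 \<le> q \<and> lp_le q f c \<and> mean_zero j f \<longrightarrow>
     lp_le q (RL \<alpha> f) (C * 2 powr (- (real j * \<alpha>)) * c))"
proof -
  obtain G :: real where G: "G > 0" and "\<forall>\<alpha>. 0 < \<alpha> \<and> \<alpha> \<le> 1 \<longrightarrow> 1 / Gamma (\<alpha> + 1) \<le> G"
    using inverse_Gamma_bounded by (elim exE conjE)
  then have G': "1 / Gamma (\<alpha> + 1) \<le> G" if "0 < \<alpha>" "\<alpha> \<le> 1" for \<alpha> using that by simp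
  define C where "C = (2 + 1 / (1 - \<alpha>0)) * G"
  have C: "C > 0" unfolding C_def using G \<alpha>0 by (intro mult_pos_pos add_pos_pos) auto
  show ?thesis
  proof (intro exI[of _ C] conjI allI impI C; elim conjE)
    fix \<alpha> c :: real and j q f
    assume a: "0 < \<alpha>" "\<alpha> \<le> \<alpha>0" and q: "1 \<le> q" and f: "lp_le q f c" and m: "mean_zero j f"
    have f1: "lp_le 1 f c" using lp_le_antimono_exponent[OF _ q f] by simp
    have a1: "\<alpha> < 1" using a \<alpha>0 by simp
    have h: "(1 / 2 ^ j :: real) powr \<alpha> = 2 powr (- (real j * \<alpha>))"
    proof -
      have "(1 / 2 ^ j :: real) = 2 powr (- real j)" by (simp add: powr_minus_divide powr_realpow)
      then show ?thesis by (simp add: powr_powr)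
    qed
    show "lp_le q (RL \<alpha> f) (C * 2 powr (- (real j * \<alpha>)) * c)"
    proof (rule lp_le_convolution[where k = "local_kernel \<alpha> (1 / 2 ^ j)", OF _ _ _ q f])
      show "0 < C * 2 powr (- (real j * \<alpha>))" using C by simp
      have "(2 + \<alpha> / (1 - \<alpha>)) / Gamma (\<alpha> + 1) * (1 / 2 ^ j) powr \<alpha> \<le> C * (1 / 2 ^ j) powr \<alpha>"
      proof (rule mult_right_mono)
        have "\<alpha> / (1 - \<alpha>) \<le> 1 / (1 - \<alpha>0)" using a \<alpha>0 by (intro frac_le) auto
        then have "(2 + \<alpha> / (1 - \<alpha>)) * (1 / Gamma (\<alpha> + 1)) \<le> (2 + 1 / (1 - \<alpha>0)) * G"
          using a a1 \<alpha>0 G G'[of \<alpha>] Gamma_real_pos[of "\<alpha> + 1"] by (intro mult_mono) (simp_all add: less_imp_le)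
        then show "(2 + \<alpha> / (1 - \<alpha>)) / Gamma (\<alpha> + 1) \<le> C" by (simp add: C_def)
      qed simp
      then show "(\<integral>\<^sup>+u. ennreal (local_kernel \<alpha> (1 / 2 ^ j) u) \<partial>lborel) \<le> ennreal (C * 2 powr (- (real j * \<alpha>)))"
        unfolding h by (rule order_trans[OF nn_integral_local_kernel[OF a(1) a1, of "1 / 2 ^ j", unfolded h] ennreal_leI, rotated]) simp
      show "RL \<alpha> f \<in> borel_measurable borel" using f by (intro RL_measurable lp_le_meas)
      show "AE t in lborel. ennreal \<bar>RL \<alpha> f t\<bar> \<le> (\<integral>\<^sup>+s. ennreal (local_kernel \<alpha> (1 / 2 ^ j) (t - s)) * ennreal \<bar>f s\<bar> \<partial>lborel)"
        by (rule RL_mean_zero_local[OF a(1) a1 f1 m])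
    qed (auto simp: RL_def)
  qed
qed

lemma RL_dyadic_mean_AE_subseq:
  assumes a: "0 < \<alpha>" "\<alpha> < 1" and f: "lp_le 1 f c"
  shows "\<exists>r. strict_mono r \<and> (AE t in lborel. (\<lambda>n. RL \<alpha> (\<lambda>s. f s - dyadic_mean (r n) f s) t) \<longlonglongrightarrow> 0)"
proof -
  from RL_mean_zero_lp_le[OF a(2)] obtain C where
    C: "\<forall>\<beta>. 0 < \<beta> \<and> \<beta> \<le> \<alpha> \<longrightarrow> (\<forall>j q f c. 1 \<le> q \<and> lp_le q f c \<and> mean_zero j f \<longrightarrow>
      lp_le q (RL \<beta> f) (C * 2 powr (- (real j * \<beta>)) * c))" by (elim exE conjE)
  have *: "lp_le q (RL \<alpha> g) (C * 2 powr (- (real j * \<alpha>)) * d)"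
    if "1 \<le> q" "lp_le q g d" "mean_zero j g" for j q g d
    using C[rule_format, of \<alpha>] a that by simp
  have l: "lp_le 1 (RL \<alpha> (\<lambda>s. f s - dyadic_mean j f s)) (C * 2 powr (- (real j * \<alpha>)) * (c + c))" for j
    using f by (intro * lp_le_diff dyadic_mean_lp_le mean_zero_diff_dyadic_mean lp_le_1_integrable) auto
  show ?thesis
  proof (rule tendsto_L1_AE_subseq)
    show "integrable lborel (RL \<alpha> (\<lambda>s. f s - dyadic_mean j f s))" for j by (rule lp_le_1_integrable(1)[OF l])
    show "(\<lambda>j. LINT t|lborel. norm (RL \<alpha> (\<lambda>s. f s - dyadic_mean j f s) t)) \<longlonglongrightarrow> 0"
    proof (rule tendsto_sandwich[OF _ _ tendsto_const])
      show "\<forall>\<^sub>F j in sequentially. (LINT t|lborel. norm (RL \<alpha> (\<lambda>s. f s - dyadic_mean j f s) t)) \<le> C * (2 powr (- \<alpha>)) ^ j * (c + c)"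
      proof (rule always_eventually, rule allI)
        fix j
        have "(2 powr (- \<alpha>)) ^ j = 2 powr (- (real j * \<alpha>))"
          by (simp add: powr_realpow[symmetric] powr_powr mult.commute)
        then show "(LINT t|lborel. norm (RL \<alpha> (\<lambda>s. f s - dyadic_mean j f s) t)) \<le> C * (2 powr (- \<alpha>)) ^ j * (c + c)"
          using lp_le_1_integrable(2)[OF l[of j]] by simp
      qed
      have "(\<lambda>j. (2 powr (- \<alpha>)) ^ j) \<longlonglongrightarrow> 0" using a powr_less_mono[of "-\<alpha>" 0 2] by (intro LIMSEQ_realpow_zero) auto
      from tendsto_mult[OF tendsto_mult[OF tendsto_const[of C] this] tendsto_const[of "c + c"]]
      show "(\<lambda>j. C * (2 powr (- \<alpha>)) ^ j * (c + c)) \<longlonglongrightarrow> 0" by simp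
    qed simp
  qed
qed

section \<open>Rounding and counting integer vectors\<close>

lemma sum_powers_abs_le:
  fixes z :: real
  assumes "0 < z" "z \<le> 1 / 2"
  shows "(\<Sum>a\<in>{- int L..int L}. z ^ nat \<bar>a\<bar>) \<le> 1 + 4 * z - 4 * z ^ Suc L"
proof (induction L)
  case 0
  then show ?case by simp
next
  case (Suc L)
  have "{- int (Suc L)..int (Suc L)} = insert (int (Suc L)) (insert (- int (Suc L)) {- int L..int L})" by auto
  then have "(\<Sum>a\<in>{- int (Suc L)..int (Suc L)}. z ^ nat \<bar>a\<bar>) = 2 * z ^ Suc L + (\<Sum>a\<in>{- int L..int L}. z ^ nat \<bar>a\<bar>)"
    by (simp add: nat_add_distrib)
  moreover have "z ^ Suc (Suc L) \<le> 1 / 2 * z ^ Suc L"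
    using assms mult_right_mono[of z "1 / 2" "z ^ Suc L"] by simp
  ultimately show ?case using Suc.IH by linarith
qed

text \<open>
  The integer vectors of length \<open>N\<close> with \<open>l\<^sub>1\<close> norm at most \<open>M\<close>, as functions that are undefined from \<open>N\<close> on.
\<close>

definition int_ball :: "nat \<Rightarrow> real \<Rightarrow> (nat \<Rightarrow> int) set" where
  "int_ball N M = {m \<in> {..<N} \<rightarrow>\<^sub>E UNIV. (\<Sum>k<N. real_of_int \<bar>m k\<bar>) \<le> M}"

text \<open>
  The bound is obtained by summing \<open>z\<close> to the power \<open>\<Sum>|m\<^sub>k| - M\<close>, which is at least \<open>1\<close> on the ball, over a whole cube of
  integer vectors; that sum factorizes.
\<close>

lemma card_int_ball:
  fixes z M :: real
  assumes z: "0 < z" "z \<le> 1 / 2"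
  shows "finite (int_ball N M)" "real (card (int_ball N M)) \<le> (1 + 4 * z) ^ N * z powr (- M)"
proof -
  define L where "L = nat \<lfloor>M\<rfloor>"
  define P where "P = ({..<N} \<rightarrow>\<^sub>E {- int L..int L})"
  have finP: "finite P" unfolding P_def by (intro finite_PiE) auto
  have sub: "int_ball N M \<subseteq> P"
  proof
    fix m
    assume m: "m \<in> int_ball N M"
    have "m k \<in> {- int L..int L}" if k: "k < N" for k
    proof -
      have "real_of_int \<bar>m k\<bar> \<le> (\<Sum>k<N. real_of_int \<bar>m k\<bar>)"
        using k by (intro member_le_sum) auto
      also have "\<dots> \<le> M" using m by (simp add: int_ball_def)
      finally have "\<bar>m k\<bar> \<le> \<lfloor>M\<rfloor>" by (simp add: le_floor_iff)
      moreover from this have "0 \<le> \<lfloor>M\<rfloor>" using abs_ge_zero order_trans by blast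
      ultimately show ?thesis unfolding L_def by (simp add: abs_le_iff)
    qed
    then show "m \<in> P" using m unfolding P_def int_ball_def by (auto simp: PiE_def Pi_def)
  qed
  then show fin: "finite (int_ball N M)" using finP by (rule finite_subset)
  have "real (card (int_ball N M)) = (\<Sum>m\<in>int_ball N M. 1)" by simp
  also have "\<dots> \<le> (\<Sum>m\<in>int_ball N M. z powr (- M) * (\<Prod>k<N. z ^ nat \<bar>m k\<bar>))"
  proof (rule sum_mono)
    fix m
    assume m: "m \<in> int_ball N M"
    have "(\<Prod>k<N. z ^ nat \<bar>m k\<bar>) = (\<Prod>k<N. z powr real_of_int \<bar>m k\<bar>)"
      using z by (intro prod.cong refl) (simp add: powr_realpow[symmetric] del: of_int_abs)
    also have "\<dots> = z powr (\<Sum>k<N. real_of_int \<bar>m k\<bar>)" using z by (simp add: powr_sum del: of_int_abs)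
    finally have e: "z powr (- M) * (\<Prod>k<N. z ^ nat \<bar>m k\<bar>) = z powr ((\<Sum>k<N. real_of_int \<bar>m k\<bar>) - M)"
      using z by (simp add: powr_add[symmetric])
    have "z powr 0 \<le> z powr ((\<Sum>k<N. real_of_int \<bar>m k\<bar>) - M)"
      using m z by (intro powr_mono') (auto simp: int_ball_def)
    then show "1 \<le> z powr (- M) * (\<Prod>k<N. z ^ nat \<bar>m k\<bar>)" using z unfolding e by simp
  qed
  also have "\<dots> \<le> (\<Sum>m\<in>P. z powr (- M) * (\<Prod>k<N. z ^ nat \<bar>m k\<bar>))"
    using z by (intro sum_mono2 finP sub) (auto intro!: mult_nonneg_nonneg prod_nonneg)
  also have "\<dots> = z powr (- M) * (\<Prod>k<N. \<Sum>a\<in>{- int L..int L}. z ^ nat \<bar>a\<bar>)"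
    unfolding P_def by (subst prod_sum_PiE) (auto simp: sum_distrib_left)
  also have "\<dots> \<le> z powr (- M) * (\<Prod>k<N. 1 + 4 * z)"
  proof (intro mult_left_mono prod_mono conjI)
    have "0 \<le> 4 * z ^ Suc L" using z by simp
    then show "(\<Sum>a\<in>{- int L..int L}. z ^ nat \<bar>a\<bar>) \<le> 1 + 4 * z" using sum_powers_abs_le[OF z, of L] by linarith
  qed (use z in \<open>auto intro!: sum_nonneg\<close>)
  finally show "real (card (int_ball N M)) \<le> (1 + 4 * z) ^ N * z powr (- M)" by (simp add: mult.commute)
qed

definition round_to_zero :: "real \<Rightarrow> int" where
  "round_to_zero x = (if 0 \<le> x then \<lfloor>x\<rfloor> else \<lceil>x\<rceil>)"

lemma round_to_zero:
  "\<bar>x - real_of_int (round_to_zero x)\<bar> \<le> 1"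
  "\<bar>x - real_of_int (round_to_zero x)\<bar> \<le> \<bar>x\<bar>"
  "real_of_int \<bar>round_to_zero x\<bar> \<le> \<bar>x\<bar>"
proof -
  have "(0 \<le> x \<and> 0 \<le> \<lfloor>x\<rfloor>) \<or> (x < 0 \<and> \<lceil>x\<rceil> \<le> 0)" by (cases "0 \<le> x") auto
  moreover have "real_of_int \<lfloor>x\<rfloor> \<le> x" "x < real_of_int \<lfloor>x\<rfloor> + 1" "x \<le> real_of_int \<lceil>x\<rceil>" "real_of_int \<lceil>x\<rceil> < x + 1"
    by linarith+
  ultimately show "\<bar>x - real_of_int (round_to_zero x)\<bar> \<le> 1"
    "\<bar>x - real_of_int (round_to_zero x)\<bar> \<le> \<bar>x\<bar>"
    "real_of_int \<bar>round_to_zero x\<bar> \<le> \<bar>x\<bar>"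
    unfolding round_to_zero_def by (cases "0 \<le> x"; simp; linarith)+
qed

lemma round_to_zero_le_powr:
  assumes "1 \<le> p"
  shows "real_of_int \<bar>round_to_zero x\<bar> \<le> \<bar>x\<bar> powr p"
proof (cases "1 \<le> \<bar>x\<bar>")
  case True
  then have "\<bar>x\<bar> powr 1 \<le> \<bar>x\<bar> powr p" using assms by (intro powr_mono) auto
  then show ?thesis using round_to_zero(3)[of x] True by simp
next
  case False
  then have "real_of_int \<bar>round_to_zero x\<bar> < 1" using round_to_zero(3)[of x] by linarith
  then have "\<bar>round_to_zero x\<bar> = 0" by linarith
  then show ?thesis by simp
qed

text \<open>
  \<open>exponent_gap r q = 1/r - 1/q\<close> as a real number, with \<open>1/\<infinity> = 0\<close>.
\<close>

definition exponent_gap :: "real \<Rightarrow> ereal \<Rightarrow> real" where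
  "exponent_gap r q = 1 / r - (if q = \<infinity> then 0 else 1 / real_of_ereal q)"

text \<open>
  The interpolation inequality \<open>|E|\<^sup>q \<le> \<delta>\<^sup>q\<^sup>-\<^sup>r |D|\<^sup>r\<close>, integrated. The exponent of \<open>\<delta>\<close> is
  \<open>r (1/r - 1/q) = 1 - r/q\<close>.
\<close>

lemma lp_le_truncated:
  assumes r: "1 \<le> r" "ereal r < q" and D: "lp_le (ereal r) D 1"
    and E: "E \<in> borel_measurable borel" "\<And>x. \<bar>E x\<bar> \<le> \<bar>D x\<bar>" "\<And>x. \<bar>E x\<bar> \<le> \<delta>" and \<delta>: "0 < \<delta>"
  shows "lp_le q E (\<delta> powr (r * exponent_gap r q))"
proof -
  have [measurable]: "E \<in> borel_measurable borel" "D \<in> borel_measurable borel"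
    using E D lp_le_meas by blast+
  have s: "E x = 0" if "x \<notin> {0..<1}" for x using E(2)[of x] lp_le_supp[OF D that] by simp
  have "1 \<le> ereal r" using r by (simp add: one_ereal_def)
  then have "1 \<le> q" using r by (cases q) (auto simp: one_ereal_def)
  then show ?thesis
  proof (cases rule: exponent_cases)
    case inf
    then show ?thesis using E s r \<delta> by (auto simp: lp_le_infinity exponent_gap_def)
  next
    case (fin u)
    then have u: "r < u" using r by simp
    have "(\<integral>\<^sup>+x. ennreal (\<bar>E x\<bar> powr u) \<partial>lborel) \<le> (\<integral>\<^sup>+x. ennreal (\<delta> powr (u - r)) * ennreal (\<bar>D x\<bar> powr r) \<partial>lborel)"
    proof (rule nn_integral_mono)
      fix x
      have "\<bar>E x\<bar> powr u = \<bar>E x\<bar> powr (u - r) * \<bar>E x\<bar> powr r" by (simp add: powr_add[symmetric])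
      also have "\<dots> \<le> \<delta> powr (u - r) * \<bar>D x\<bar> powr r"
        using E(2)[of x] E(3)[of x] u r by (intro mult_mono powr_mono2) auto
      finally show "ennreal (\<bar>E x\<bar> powr u) \<le> ennreal (\<delta> powr (u - r)) * ennreal (\<bar>D x\<bar> powr r)"
        by (simp add: ennreal_mult[symmetric] ennreal_leI)
    qed
    also have "\<dots> = ennreal (\<delta> powr (u - r)) * (\<integral>\<^sup>+x. ennreal (\<bar>D x\<bar> powr r) \<partial>lborel)"
      by (rule nn_integral_cmult) measurable
    also have "\<dots> \<le> ennreal (\<delta> powr (u - r)) * 1"
      using D by (intro mult_left_mono) (auto simp: lp_le_ereal)
    also have "\<dots> = ennreal ((\<delta> powr (r * exponent_gap r q)) powr u)"
    proof -
      have "r * exponent_gap r q * u = u - r" using fin u r by (simp add: exponent_gap_def field_simps)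
      then show ?thesis by (simp add: powr_powr)
    qed
    finally show ?thesis using fin s by (simp add: lp_le_ereal)
  qed
qed

section \<open>Finite nets\<close>

text \<open>
  \<open>has_net S p q x \<epsilon>\<close>: the image under \<open>S\<close> of the unit ball of \<open>L\<^sub>p\<close> is covered by at most \<open>2\<^sup>x\<close> balls of
  radius \<open>\<epsilon>\<close> in \<open>L\<^sub>q\<close>. The number \<open>x\<close> of bits is real, so that bits can be added up and estimated freely; the entropy number
  \<open>e\<^sub>n\<close> corresponds to \<open>x = n - 1\<close>.
\<close>

definition has_net :: "((real \<Rightarrow> real) \<Rightarrow> real \<Rightarrow> real) \<Rightarrow> ereal \<Rightarrow> ereal \<Rightarrow> real \<Rightarrow> real \<Rightarrow> bool" where
  "has_net S p q x \<epsilon> \<longleftrightarrow> (\<exists>Y. finite Y \<and> real (card Y) \<le> 2 powr x \<and> (\<forall>y\<in>Y. \<exists>c. lp_le q y c) \<and>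
     (\<forall>f. lp_le p f 1 \<longrightarrow> (\<exists>y\<in>Y. lp_le q (\<lambda>t. S f t - y t) \<epsilon>)))"

lemma has_netI:
  assumes "finite Y" "real (card Y) \<le> 2 powr x" "\<And>y. y \<in> Y \<Longrightarrow> \<exists>c. lp_le q y c"
    "\<And>f. lp_le p f 1 \<Longrightarrow> \<exists>y\<in>Y. lp_le q (\<lambda>t. S f t - y t) \<epsilon>"
  shows "has_net S p q x \<epsilon>"
  using assms unfolding has_net_def by blast

lemma has_netE:
  assumes "has_net S p q x \<epsilon>"
  obtains Y where "finite Y" "real (card Y) \<le> 2 powr x" "\<And>y. y \<in> Y \<Longrightarrow> \<exists>c. lp_le q y c"
    "\<And>f. lp_le p f 1 \<Longrightarrow> \<exists>y\<in>Y. lp_le q (\<lambda>t. S f t - y t) \<epsilon>"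
  using assms unfolding has_net_def by blast

lemma has_net_mono:
  assumes "1 \<le> q" "has_net S p q x \<epsilon>" "x \<le> x'" "\<epsilon> \<le> \<epsilon>'"
  shows "has_net S p q x' \<epsilon>'"
proof (rule has_netE[OF assms(2)])
  fix Y
  assume Y: "finite Y" "real (card Y) \<le> 2 powr x" "\<And>y. y \<in> Y \<Longrightarrow> \<exists>c. lp_le q y c"
    "\<And>f. lp_le p f 1 \<Longrightarrow> \<exists>y\<in>Y. lp_le q (\<lambda>t. S f t - y t) \<epsilon>"
  have "2 powr x \<le> 2 powr x'" using assms(3) by (intro powr_mono) auto
  then have "real (card Y) \<le> 2 powr x'" using Y(2) by linarith
  then show ?thesis
  proof (rule has_netI[OF Y(1) _ Y(3)])
    show "\<exists>y\<in>Y. lp_le q (\<lambda>t. S f t - y t) \<epsilon>'" if "lp_le p f 1" for f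
      using Y(4)[OF that] lp_le_mono[OF assms(1) _ assms(4)] by blast
  qed
qed

lemma has_net_antimono_exponent:
  assumes "1 \<le> q" "q \<le> p" "has_net S q r x \<epsilon>"
  shows "has_net S p r x \<epsilon>"
  using assms(3) lp_le_antimono_exponent[OF assms(1,2)] unfolding has_net_def by blast

lemma has_net_AE_cong:
  assumes q: "1 \<le> q" and S: "has_net S p q x \<epsilon>"
    and T: "\<And>f. lp_le p f 1 \<Longrightarrow> T f \<in> borel_measurable borel" "\<And>f t. lp_le p f 1 \<Longrightarrow> t \<notin> {0..<1} \<Longrightarrow> T f t = 0"
    and ae: "\<And>f. lp_le p f 1 \<Longrightarrow> AE t in lborel. T f t = S f t"
  shows "has_net T p q x \<epsilon>"
proof (rule has_netE[OF S])
  fix Y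
  assume Y: "finite Y" "real (card Y) \<le> 2 powr x" "\<And>y. y \<in> Y \<Longrightarrow> \<exists>c. lp_le q y c"
    "\<And>f. lp_le p f 1 \<Longrightarrow> \<exists>y\<in>Y. lp_le q (\<lambda>t. S f t - y t) \<epsilon>"
  show ?thesis
  proof (rule has_netI[OF Y(1-3)])
    fix f
    assume f: "lp_le p f 1"
    obtain y where y: "y \<in> Y" "lp_le q (\<lambda>t. S f t - y t) \<epsilon>" using Y(4)[OF f] by blast
    obtain c where c: "lp_le q y c" using Y(3)[OF y(1)] by blast
    have "lp_le q (\<lambda>t. T f t - y t) \<epsilon>"
    proof (rule lp_le_AE_cong[OF q y(2)])
      show "(\<lambda>t. T f t - y t) \<in> borel_measurable borel"
        using T(1)[OF f] lp_le_meas[OF c] by (rule borel_measurable_diff)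
      show "T f t - y t = 0" if "t \<notin> {0..<1}" for t using T(2)[OF f that] lp_le_supp[OF c that] by simp
      show "AE t in lborel. T f t - y t = S f t - y t" using ae[OF f] by eventually_elim simp
    qed
    then show "\<exists>y\<in>Y. lp_le q (\<lambda>t. T f t - y t) \<epsilon>" using y(1) by blast
  qed
qed

lemma has_net_of_bounded:
  assumes "\<And>f. lp_le p f 1 \<Longrightarrow> lp_le q (S f) \<epsilon>"
  shows "has_net S p q 0 \<epsilon>"
  using assms by (intro has_netI[of "{\<lambda>_. 0}"]) (auto intro: lp_le_zero[of 0])

lemma has_net_bounded:
  assumes q: "1 \<le> q" and S: "has_net S p q x \<epsilon>" and f: "lp_le p f 1"
  shows "\<exists>c. lp_le q (S f) c"
proof (rule has_netE[OF S])
  fix Y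
  assume Y: "finite Y" "real (card Y) \<le> 2 powr x" "\<And>y. y \<in> Y \<Longrightarrow> \<exists>c. lp_le q y c"
    "\<And>f. lp_le p f 1 \<Longrightarrow> \<exists>y\<in>Y. lp_le q (\<lambda>t. S f t - y t) \<epsilon>"
  obtain y where y: "y \<in> Y" "lp_le q (\<lambda>t. S f t - y t) \<epsilon>" using Y(4)[OF f] by blast
  obtain c where c: "lp_le q y c" using Y(3)[OF y(1)] by blast
  show ?thesis using lp_le_add[OF q y(2) c] by auto
qed

lemma has_net_add:
  assumes q: "1 \<le> q" and S: "has_net S p q x \<epsilon>" and T: "has_net T p q x' \<epsilon>'"
  shows "has_net (\<lambda>f t. S f t + T f t) p q (x + x') (\<epsilon> + \<epsilon>')"
proof (rule has_netE[OF S], rule has_netE[OF T])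
  fix Y Z
  assume Y: "finite Y" "real (card Y) \<le> 2 powr x" "\<And>y. y \<in> Y \<Longrightarrow> \<exists>c. lp_le q y c"
    "\<And>f. lp_le p f 1 \<Longrightarrow> \<exists>y\<in>Y. lp_le q (\<lambda>t. S f t - y t) \<epsilon>"
  assume Z: "finite Z" "real (card Z) \<le> 2 powr x'" "\<And>y. y \<in> Z \<Longrightarrow> \<exists>c. lp_le q y c"
    "\<And>f. lp_le p f 1 \<Longrightarrow> \<exists>y\<in>Z. lp_le q (\<lambda>t. T f t - y t) \<epsilon>'"
  let ?W = "(\<lambda>(y, z) t. y t + z t) ` (Y \<times> Z)"
  show ?thesis
  proof (rule has_netI[of ?W])
    show "finite ?W" using Y Z by simp
    have "card ?W \<le> card (Y \<times> Z)" using Y Z by (intro card_image_le) simp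
    then have "real (card ?W) \<le> real (card Y) * real (card Z)" by (simp add: card_cartesian_product flip: of_nat_mult)
    also have "\<dots> \<le> 2 powr x * 2 powr x'" using Y Z by (intro mult_mono) auto
    finally show "real (card ?W) \<le> 2 powr (x + x')" by (simp add: powr_add)
    show "\<exists>c. lp_le q w c" if "w \<in> ?W" for w
    proof -
      from that obtain y z where w: "w = (\<lambda>t. y t + z t)" "y \<in> Y" "z \<in> Z" by auto
      obtain c d where "lp_le q y c" "lp_le q z d" using Y(3)[OF w(2)] Z(3)[OF w(3)] by blast
      then show ?thesis unfolding w using lp_le_add[OF q] by blast
    qed
    fix f
    assume f: "lp_le p f 1"
    obtain y where y: "y \<in> Y" "lp_le q (\<lambda>t. S f t - y t) \<epsilon>" using Y(4)[OF f] by blast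
    obtain z where z: "z \<in> Z" "lp_le q (\<lambda>t. T f t - z t) \<epsilon>'" using Z(4)[OF f] by blast
    have "lp_le q (\<lambda>t. S f t + T f t - (y t + z t)) (\<epsilon> + \<epsilon>')"
      using lp_le_add[OF q y(2) z(2)] by (simp add: algebra_simps)
    then show "\<exists>w\<in>?W. lp_le q (\<lambda>t. S f t + T f t - w t) (\<epsilon> + \<epsilon>')"
      using y(1) z(1) by (intro bexI[of _ "\<lambda>t. y t + z t"]) auto
  qed
qed

lemma has_net_sum:
  assumes q: "1 \<le> q" and "finite I" "\<And>i. i \<in> I \<Longrightarrow> has_net (S i) p q (x i) (\<epsilon> i)"
  shows "has_net (\<lambda>f t. \<Sum>i\<in>I. S i f t) p q (\<Sum>i\<in>I. x i) (\<Sum>i\<in>I. \<epsilon> i)"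
  using assms(2,3)
proof (induction I rule: finite_induct)
  case empty
  show ?case using has_net_of_bounded[of p q "\<lambda>f t. 0" 0] lp_le_zero[of 0 q] by simp
next
  case (insert i I)
  then show ?case using has_net_add[OF q, of "S i" p "x i" "\<epsilon> i"] by simp
qed

text \<open>
  If each \<open>S f\<close> is approximated by some \<open>\<Phi> m\<close> with an integer vector \<open>m\<close> of length \<open>N\<close> and \<open>l\<^sub>1\<close> norm at most \<open>M\<close>,
  then these \<open>\<Phi> m\<close> form a net.
\<close>

lemma has_net_of_int_vectors:
  fixes z M :: real
  assumes z: "0 < z" "z \<le> 1 / 2" "(1 + 4 * z) ^ N * z powr (- M) \<le> 2 powr x"
    and \<Phi>: "\<And>m. \<exists>c. lp_le q (\<Phi> m) c" "\<And>m. \<Phi> (restrict m {..<N}) = \<Phi> m"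
    and S: "\<And>f. lp_le p f 1 \<Longrightarrow> \<exists>m. (\<Sum>k<N. real_of_int \<bar>m k\<bar>) \<le> M \<and> lp_le q (\<lambda>t. S f t - \<Phi> m t) \<epsilon>"
  shows "has_net S p q x \<epsilon>"
proof (rule has_netI[of "\<Phi> ` int_ball N M"])
  note c = card_int_ball[OF z(1,2), of N M]
  show "finite (\<Phi> ` int_ball N M)" using c(1) by simp
  have "real (card (\<Phi> ` int_ball N M)) \<le> real (card (int_ball N M))"
    using c(1) by (intro of_nat_mono card_image_le)
  then show "real (card (\<Phi> ` int_ball N M)) \<le> 2 powr x" using c(2) z(3) by linarith
  show "\<exists>c. lp_le q y c" if "y \<in> \<Phi> ` int_ball N M" for y using that \<Phi>(1) by blast
  fix f
  assume "lp_le p f 1"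
  then obtain m where m: "(\<Sum>k<N. real_of_int \<bar>m k\<bar>) \<le> M" "lp_le q (\<lambda>t. S f t - \<Phi> m t) \<epsilon>" using S by blast
  then have "restrict m {..<N} \<in> int_ball N M" by (simp add: int_ball_def)
  then show "\<exists>y\<in>\<Phi> ` int_ball N M. lp_le q (\<lambda>t. S f t - y t) \<epsilon>"
    using m(2) \<Phi>(2)[of m] by (intro bexI[of _ "\<Phi> m"]) (auto simp: image_iff intro!: bexI[of _ "restrict m {..<N}"])
qed

text \<open>
  Entropy numbers are submultiplicative under composition. Only the outer map has to be linear, and
  linearity almost everywhere is enough.
\<close>

lemma has_net_RL_comp:
  assumes a: "0 < \<alpha>" and r: "1 \<le> r" and q: "1 \<le> q" and S: "has_net S p r x \<epsilon>" and R: "has_net (RL \<alpha>) r q x' \<epsilon>'" and \<epsilon>: "0 < \<epsilon>"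
  shows "has_net (\<lambda>f. RL \<alpha> (S f)) p q (x + x') (\<epsilon> * \<epsilon>')"
proof (rule has_netE[OF S], rule has_netE[OF R])
  fix Y Z
  assume Y: "finite Y" "real (card Y) \<le> 2 powr x" "\<And>y. y \<in> Y \<Longrightarrow> \<exists>c. lp_le r y c"
    "\<And>f. lp_le p f 1 \<Longrightarrow> \<exists>y\<in>Y. lp_le r (\<lambda>t. S f t - y t) \<epsilon>"
  assume Z: "finite Z" "real (card Z) \<le> 2 powr x'" "\<And>y. y \<in> Z \<Longrightarrow> \<exists>c. lp_le q y c"
    "\<And>f. lp_le r f 1 \<Longrightarrow> \<exists>y\<in>Z. lp_le q (\<lambda>t. RL \<alpha> f t - y t) \<epsilon>'"
  let ?W = "(\<lambda>(y, z) t. RL \<alpha> y t + \<epsilon> * z t) ` (Y \<times> Z)"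
  have bdd: "\<exists>d. lp_le q (RL \<alpha> y) d" if y: "lp_le r y c" for y c
  proof -
    have c: "0 < c + 1" using lp_le_nonneg[OF y] by simp
    have "lp_le r (\<lambda>t. 1 / (c + 1) * y t) (\<bar>1 / (c + 1)\<bar> * (c + 1))"
      using lp_le_mono[OF r y, of "c + 1"] by (intro lp_le_scale r) simp
    then have "lp_le r (\<lambda>t. 1 / (c + 1) * y t) 1" using c by simp
    then obtain d where "lp_le q (RL \<alpha> (\<lambda>t. 1 / (c + 1) * y t)) d" using has_net_bounded[OF q R] by blast
    moreover have "(\<lambda>t. (c + 1) * RL \<alpha> (\<lambda>t. 1 / (c + 1) * y t) t) = RL \<alpha> y"
    proof
      fix t
      show "(c + 1) * RL \<alpha> (\<lambda>t. 1 / (c + 1) * y t) t = RL \<alpha> y t"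
        unfolding RL_scale[of \<alpha> "1 / (c + 1)" y t] using c by simp
    qed
    ultimately show ?thesis using lp_le_scale[OF q, of "RL \<alpha> (\<lambda>t. 1 / (c + 1) * y t)" d "c + 1"] by auto
  qed
  show ?thesis
  proof (rule has_netI[of ?W])
    show "finite ?W" using Y Z by simp
    have "card ?W \<le> card (Y \<times> Z)" using Y Z by (intro card_image_le) simp
    then have "real (card ?W) \<le> real (card Y) * real (card Z)" by (simp add: card_cartesian_product flip: of_nat_mult)
    also have "\<dots> \<le> 2 powr x * 2 powr x'" using Y Z by (intro mult_mono) auto
    finally show "real (card ?W) \<le> 2 powr (x + x')" by (simp add: powr_add)
    show "\<exists>c. lp_le q w c" if "w \<in> ?W" for w
    proof -
      from that obtain y z where w: "w = (\<lambda>t. RL \<alpha> y t + \<epsilon> * z t)" "y \<in> Y" "z \<in> Z" by auto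
      obtain c d where "lp_le r y c" "lp_le q z d" using Y(3)[OF w(2)] Z(3)[OF w(3)] by blast
      then obtain c' where "lp_le q (RL \<alpha> y) c'" "lp_le q z d" using bdd by blast
      then show ?thesis unfolding w using lp_le_add[OF q _ lp_le_scale[OF q]] by blast
    qed
    fix f
    assume f: "lp_le p f 1"
    obtain y where y: "y \<in> Y" "lp_le r (\<lambda>t. S f t - y t) \<epsilon>" using Y(4)[OF f] by blast
    obtain c where c: "lp_le r y c" using Y(3)[OF y(1)] by blast
    define g where "g = (\<lambda>t. 1 / \<epsilon> * (S f t - y t))"
    have "lp_le r g (\<bar>1 / \<epsilon>\<bar> * \<epsilon>)" unfolding g_def by (rule lp_le_scale[OF r y(2)])
    then have g: "lp_le r g 1" using \<epsilon> by simp
    obtain z where z: "z \<in> Z" "lp_le q (\<lambda>t. RL \<alpha> g t - z t) \<epsilon>'" using Z(4)[OF g] by blast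
    obtain d where d: "lp_le q z d" using Z(3)[OF z(1)] by blast
    have Sf: "S f = (\<lambda>t. y t + \<epsilon> * g t)" using \<epsilon> by (auto simp: g_def)
    have "AE t in lborel. RL \<alpha> (\<lambda>t. y t + \<epsilon> * g t) t = RL \<alpha> y t + RL \<alpha> (\<lambda>t. \<epsilon> * g t) t"
      using lp_le_antimono_exponent[OF _ r c] lp_le_antimono_exponent[OF _ r lp_le_scale[OF r g]]
      by (intro RL_add[OF a]) auto
    then have ae: "AE t in lborel. RL \<alpha> (S f) t - (RL \<alpha> y t + \<epsilon> * z t) = \<epsilon> * (RL \<alpha> g t - z t)"
      unfolding Sf by eventually_elim (simp add: RL_scale algebra_simps)
    have "lp_le q (\<lambda>t. RL \<alpha> (S f) t - (RL \<alpha> y t + \<epsilon> * z t)) (\<bar>\<epsilon>\<bar> * \<epsilon>')"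
    proof (rule lp_le_AE_cong[OF q lp_le_scale[OF q z(2)] _ _ ae])
      have "S f \<in> borel_measurable borel"
        unfolding Sf using lp_le_meas[OF c] lp_le_meas[OF g] by measurable
      then show "(\<lambda>t. RL \<alpha> (S f) t - (RL \<alpha> y t + \<epsilon> * z t)) \<in> borel_measurable borel"
        using RL_measurable[of "S f"] RL_measurable[OF lp_le_meas[OF c]] lp_le_meas[OF d] by measurable
      show "RL \<alpha> (S f) t - (RL \<alpha> y t + \<epsilon> * z t) = 0" if "t \<notin> {0..<1}" for t
        using that lp_le_supp[OF d that] by (simp add: RL_supp)
    qed
    then show "\<exists>w\<in>?W. lp_le q (\<lambda>t. RL \<alpha> (S f) t - w t) (\<epsilon> * \<epsilon>')"
      using \<epsilon> y(1) z(1) by (intro bexI[of _ "\<lambda>t. RL \<alpha> y t + \<epsilon> * z t"]) auto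
  qed
qed

section \<open>Nets for the Haar levels\<close>

text \<open>
  \<open>C\<close> is an admissible constant in the key estimate for the order \<open>\<alpha>\<close>, simultaneously for all exponents
  and levels.
\<close>

definition RL_local_bound :: "real \<Rightarrow> real \<Rightarrow> bool" where
  "RL_local_bound \<alpha> C \<longleftrightarrow> 0 < \<alpha> \<and> \<alpha> < 1 \<and> 0 < C \<and> (\<forall>j q f c. 1 \<le> q \<and> lp_le q f c \<and> mean_zero j f \<longrightarrow>
     lp_le q (RL \<alpha> f) (C * 2 powr (- (real j * \<alpha>)) * c))"

lemma RL_local_boundD:
  assumes "RL_local_bound \<alpha> C" "1 \<le> q" "lp_le q f c" "mean_zero j f"
  shows "lp_le q (RL \<alpha> f) (C * 2 powr (- (real j * \<alpha>)) * c)"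
  using assms unfolding RL_local_bound_def by blast

lemma RL_local_bound_pos: "RL_local_bound \<alpha> C \<Longrightarrow> 0 < \<alpha>" "RL_local_bound \<alpha> C \<Longrightarrow> \<alpha> < 1" "RL_local_bound \<alpha> C \<Longrightarrow> 0 < C"
  by (simp_all add: RL_local_bound_def)

lemma RL_local_bound_ex: "\<alpha>0 < 1 \<Longrightarrow> \<exists>C. \<forall>\<alpha>. 0 < \<alpha> \<and> \<alpha> \<le> \<alpha>0 \<longrightarrow> RL_local_bound \<alpha> C"
proof -
  assume a: "\<alpha>0 < 1"
  from RL_mean_zero_lp_le[OF a] obtain C where C: "C > 0"
    "\<forall>\<alpha>. 0 < \<alpha> \<and> \<alpha> \<le> \<alpha>0 \<longrightarrow> (\<forall>j q f c. 1 \<le> q \<and> lp_le q f c \<and> mean_zero j f \<longrightarrow>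
     lp_le q (RL \<alpha> f) (C * 2 powr (- (real j * \<alpha>)) * c))" by (elim exE conjE)
  show ?thesis
    unfolding RL_local_bound_def using C(2) a
    by (intro exI[of _ C] allI impI conjI C(1)) simp_all
qed

lemma haar_lp_le_ex: "1 \<le> p \<Longrightarrow> \<exists>B. lp_le p (haar j c) B"
proof -
  assume p: "1 \<le> p"
  have "\<bar>c k\<bar> \<le> (\<Sum>k<2 ^ j. \<bar>c k\<bar>)" if "k < 2 ^ j" for k
    using that by (intro member_le_sum) auto
  then show ?thesis using haar_lp_le_sup[OF p, of "\<Sum>k<2 ^ j. \<bar>c k\<bar>" j c] by (auto intro: sum_nonneg)
qed

lemma haar_cong: "(\<And>k. k < 2 ^ j \<Longrightarrow> c k = d k) \<Longrightarrow> haar j c = haar j d"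
  by (rule ext) (use cell_less in \<open>auto simp: haar_def indicator_def\<close>)

lemma haar_scale: "haar j (\<lambda>k. a * c k) t = a * haar j c t"
  by (simp add: haar_def)

lemma haar_haar_coef_lp_le:
  assumes "1 \<le> p" "lp_le p f c"
  shows "lp_le p (haar j (haar_coef j f)) (2 * c)"
proof -
  have "lp_le p (\<lambda>t. dyadic_mean (Suc j) f t - dyadic_mean j f t) (c + c)"
    using assms by (intro lp_le_diff dyadic_mean_lp_le)
  then show ?thesis using dyadic_mean_Suc_diff[OF lp_le_integrable(1)[OF assms]] by simp
qed

text \<open>
  Haar sums have vanishing averages, so an error in the coefficients is damped by \<open>2\<^sup>-\<^sup>j\<^sup>\<alpha>\<close>.
\<close>

lemma RL_haar_diff_lp_le:
  assumes loc: "RL_local_bound \<alpha> C" and q: "1 \<le> q" and B: "lp_le q (haar j (\<lambda>k. c k - d k)) B"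
  shows "lp_le q (\<lambda>t. RL \<alpha> (haar j c) t - RL \<alpha> (haar j d) t) (C * 2 powr (- (real j * \<alpha>)) * B)"
proof (rule lp_le_AE_cong[OF q RL_local_boundD[OF loc q B haar_mean_zero]])
  show "(\<lambda>t. RL \<alpha> (haar j c) t - RL \<alpha> (haar j d) t) \<in> borel_measurable borel"
    by (intro borel_measurable_diff RL_measurable haar_measurable)
  show "RL \<alpha> (haar j c) t - RL \<alpha> (haar j d) t = 0" if "t \<notin> {0..<1}" for t
    using that by (simp add: RL_supp)
  obtain b b' where "lp_le 1 (haar j c) b" "lp_le 1 (haar j d) b'" using haar_lp_le_ex by blast
  from RL_diff[OF RL_local_bound_pos(1)[OF loc] this]
  show "AE t in lborel. RL \<alpha> (haar j c) t - RL \<alpha> (haar j d) t = RL \<alpha> (haar j (\<lambda>k. c k - d k)) t"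
    unfolding haar_diff[abs_def] by eventually_elim simp
qed

lemma three_power_le: "(1 + 4 * (1 / 2)) ^ N * (1 / 2) powr (- M) \<le> 2 powr (2 * real N + M)"
proof -
  have "(3::real) ^ N \<le> 4 ^ N" by (intro power_mono) auto
  also have "(4::real) ^ N = 2 powr (2 * real N)" by (simp add: powr_powr[symmetric] powr_realpow)
  finally have "(1 + 4 * (1 / 2 :: real)) ^ N \<le> 2 powr (2 * real N)" by simp
  moreover have "(1 / 2 :: real) powr (- M) = 2 powr M" by (simp add: powr_divide powr_minus)
  ultimately show ?thesis by (simp add: powr_add)
qed

text \<open>
  Rounding to multiples of a small \<open>\<delta>\<close>. The coefficients have \<open>l\<^sub>1\<close> norm at most \<open>2 2\<^sup>j\<close>, whatever \<open>p\<close> is, and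
  the error is bounded uniformly by \<open>\<delta>\<close>, so that neither \<open>p\<close> nor \<open>q\<close> enters.
\<close>

lemma has_net_haar_low:
  assumes loc: "RL_local_bound \<alpha> C" and p: "1 \<le> p" and q: "1 \<le> q" and \<delta>: "0 < \<delta>" "\<delta> \<le> 1"
  shows "has_net (\<lambda>f. RL \<alpha> (haar j (haar_coef j f))) p q (4 * 2 ^ j / \<delta>) (C * 2 powr (- (real j * \<alpha>)) * \<delta>)"
proof (rule has_net_of_int_vectors[where N = "2 ^ j" and M = "2 * 2 ^ j / \<delta>" and z = "1 / 2"
      and \<Phi> = "\<lambda>m. RL \<alpha> (haar j (\<lambda>k. \<delta> * real_of_int (m k)))"])
  have "2 * 2 ^ j \<le> 2 * 2 ^ j / \<delta>" using \<delta> by (simp add: field_simps)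
  then have "2 powr (2 * real (2 ^ j) + 2 * 2 ^ j / \<delta>) \<le> 2 powr (4 * 2 ^ j / \<delta>)" by (intro powr_mono) auto
  then show "(1 + 4 * (1 / 2)) ^ 2 ^ j * (1 / 2) powr (- (2 * 2 ^ j / \<delta>)) \<le> 2 powr (4 * 2 ^ j / \<delta>)"
    using three_power_le[of "2 ^ j" "2 * 2 ^ j / \<delta>"] by linarith
  show "\<exists>c. lp_le q (RL \<alpha> (haar j (\<lambda>k. \<delta> * real_of_int (m k)))) c" for m
    using haar_lp_le_ex[OF q] RL_local_boundD[OF loc q _ haar_mean_zero] by blast
  show "RL \<alpha> (haar j (\<lambda>k. \<delta> * real_of_int (restrict m {..<2 ^ j} k))) = RL \<alpha> (haar j (\<lambda>k. \<delta> * real_of_int (m k)))" for m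
    by (rule arg_cong[where f = "RL \<alpha>"], rule haar_cong) simp
  fix f
  assume f: "lp_le p f 1"
  let ?c = "haar_coef j f"
  let ?m = "\<lambda>k. round_to_zero (?c k / \<delta>)"
  have "lp_le (ereal 1) (haar j ?c) (2 * 1)"
    using haar_haar_coef_lp_le[OF _ lp_le_antimono_exponent[OF _ p f]] by (simp add: one_ereal_def)
  from haar_coef_sum_le[OF _ this] have s: "(\<Sum>k<2 ^ j. \<bar>?c k\<bar>) \<le> 2 * 2 ^ j" by simp
  have "(\<Sum>k<2 ^ j. real_of_int \<bar>?m k\<bar>) \<le> (\<Sum>k<2 ^ j. \<bar>?c k\<bar> / \<delta>)"
    using round_to_zero(3) \<delta> by (intro sum_mono) (metis abs_div_pos)
  also have "\<dots> \<le> 2 * 2 ^ j / \<delta>" using s \<delta> by (simp add: sum_divide_distrib[symmetric] divide_right_mono)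
  finally have 1: "(\<Sum>k<2 ^ j. real_of_int \<bar>?m k\<bar>) \<le> 2 * 2 ^ j / \<delta>" .
  have "\<bar>?c k - \<delta> * real_of_int (?m k)\<bar> \<le> \<delta>" for k
  proof -
    have "?c k - \<delta> * real_of_int (?m k) = \<delta> * (?c k / \<delta> - real_of_int (?m k))" using \<delta> by (simp add: algebra_simps)
    then show ?thesis using round_to_zero(1)[of "?c k / \<delta>"] \<delta> by (simp add: abs_mult)
  qed
  then have "lp_le q (haar j (\<lambda>k. ?c k - \<delta> * real_of_int (?m k))) \<delta>"
    using \<delta> by (intro haar_lp_le_sup q) auto
  from RL_haar_diff_lp_le[OF loc q this] 1
  show "\<exists>m. (\<Sum>k<2 ^ j. real_of_int \<bar>m k\<bar>) \<le> 2 * 2 ^ j / \<delta> \<and>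
      lp_le q (\<lambda>t. RL \<alpha> (haar j ?c) t - RL \<alpha> (haar j (\<lambda>k. \<delta> * real_of_int (m k))) t) (C * 2 powr (- (real j * \<alpha>)) * \<delta>)"
    by (intro exI[of _ ?m] conjI)
qed simp_all

text \<open>
  Rounding to multiples of a large number, \<open>2\<delta>\<close> with \<open>\<delta>\<^sup>r = 2\<^sup>y\<close>. Chebyshev's inequality bounds the
  \<open>l\<^sub>1\<close> norm of the resulting integer vectors by \<open>M = 2\<^sup>j 2\<^sup>-\<^sup>y\<close>, and the count is made with \<open>z = 2\<^sup>-\<^sup>y\<close>.
\<close>

lemma has_net_haar_high:
  assumes loc: "RL_local_bound \<alpha> C" and r: "1 \<le> r" "ereal r < q" and y: "1 \<le> y"
  shows "has_net (\<lambda>f. RL \<alpha> (haar j (haar_coef j f))) (ereal r) q (2 ^ j * 2 powr (- y) * (8 + y))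
     (C * 2 powr (- (real j * \<alpha>)) * (2 * 2 powr (y * exponent_gap r q)))"
proof -
  have r1: "1 \<le> ereal r" using r by (simp add: one_ereal_def)
  then have q: "1 \<le> q" using r by (cases q) (auto simp: one_ereal_def)
  define \<delta> where "\<delta> = 2 powr (y / r)"
  define M where "M = 2 ^ j * 2 powr (- y)"
  have \<delta>: "\<delta> > 0" by (simp add: \<delta>_def)
  have \<delta>r: "\<delta> powr r = 2 powr y" "\<delta> powr (r * exponent_gap r q) = 2 powr (y * exponent_gap r q)"
    using r by (simp_all add: \<delta>_def powr_powr)
  show ?thesis
  proof (rule has_net_of_int_vectors[where N = "2 ^ j" and M = M and z = "2 powr (- y)"
      and \<Phi> = "\<lambda>m. RL \<alpha> (haar j (\<lambda>k. 2 * (\<delta> * real_of_int (m k))))"])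
    have "2 powr (- y) \<le> 2 powr (- 1)" using y by (intro powr_mono) auto
    then show "2 powr (- y) \<le> 1 / 2" by (simp add: powr_minus_divide)
    have "(1 + 4 * 2 powr (- y)) ^ 2 ^ j \<le> exp (4 * 2 powr (- y)) ^ 2 ^ j"
      by (intro power_mono) (auto simp: exp_ge_add_one_self)
    also have "\<dots> = exp (4 * M)" by (simp add: exp_of_nat_mult[symmetric] M_def)
    also have "\<dots> \<le> 2 powr (8 * M)"
    proof -
      have "exp (1::real) \<le> 2 powr 2" using exp_le by simp
      then have "exp 1 powr (4 * M) \<le> (2 powr 2) powr (4 * M)" by (intro powr_mono2) (auto simp: M_def)
      then show ?thesis by (simp add: powr_powr powr_def)
    qed
    finally have "(1 + 4 * 2 powr (- y)) ^ 2 ^ j * (2 powr (- y)) powr (- M) \<le> 2 powr (8 * M) * 2 powr (y * M)"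
      by (intro mult_mono) (auto simp: powr_powr)
    also have "\<dots> = 2 powr (2 ^ j * 2 powr (- y) * (8 + y))" by (simp add: powr_add[symmetric] M_def algebra_simps)
    finally show "(1 + 4 * 2 powr (- y)) ^ 2 ^ j * (2 powr (- y)) powr (- M) \<le> 2 powr (2 ^ j * 2 powr (- y) * (8 + y))" .
    show "\<exists>c. lp_le q (RL \<alpha> (haar j (\<lambda>k. 2 * (\<delta> * real_of_int (m k))))) c" for m
      using haar_lp_le_ex[OF q] RL_local_boundD[OF loc q _ haar_mean_zero] by blast
    show "RL \<alpha> (haar j (\<lambda>k. 2 * (\<delta> * real_of_int (restrict m {..<2 ^ j} k)))) = RL \<alpha> (haar j (\<lambda>k. 2 * (\<delta> * real_of_int (m k))))" for m
      by (rule arg_cong[where f = "RL \<alpha>"], rule haar_cong) simp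
    fix f
    assume f: "lp_le (ereal r) f 1"
    let ?c = "haar_coef j f"
    \<comment> \<open>half of the Haar sum lies in the unit ball, being half a difference of two averages\<close>
    define b where "b = (\<lambda>k. 1 / 2 * ?c k)"
    define m where "m = (\<lambda>k. round_to_zero (b k / \<delta>))"
    have "lp_le (ereal r) (\<lambda>t. 1 / 2 * haar j ?c t) (\<bar>1 / 2\<bar> * (2 * 1))"
      using r1 f by (intro lp_le_scale haar_haar_coef_lp_le)
    then have D: "lp_le (ereal r) (haar j b) 1" unfolding b_def haar_scale[abs_def] by simp
    have "(\<Sum>k<2 ^ j. real_of_int \<bar>m k\<bar>) \<le> (\<Sum>k<2 ^ j. \<bar>b k / \<delta>\<bar> powr r)"
      unfolding m_def by (intro sum_mono round_to_zero_le_powr r)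
    also have "\<dots> = (\<Sum>k<2 ^ j. \<bar>b k\<bar> powr r) * 2 powr (- y)"
      using \<delta> by (simp add: powr_divide \<delta>r sum_divide_distrib powr_minus field_simps)
    also have "\<dots> \<le> M" using haar_coef_sum_le[OF r(1) D] unfolding M_def by (intro mult_right_mono) auto
    finally have 1: "(\<Sum>k<2 ^ j. real_of_int \<bar>m k\<bar>) \<le> M" .
    have e: "b k - \<delta> * real_of_int (m k) = \<delta> * (b k / \<delta> - real_of_int (m k))" for k using \<delta> by (simp add: algebra_simps)
    have "lp_le q (haar j (\<lambda>k. b k - \<delta> * real_of_int (m k))) (\<delta> powr (r * exponent_gap r q))"
    proof (rule lp_le_truncated[OF r D haar_measurable _ _ \<delta>])
      have "\<bar>\<delta> * (b k / \<delta> - real_of_int (m k))\<bar> \<le> \<bar>b k\<bar>" for k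
        using mult_left_mono[OF round_to_zero(2)[of "b k / \<delta>"], of \<delta>] \<delta> unfolding m_def by (simp add: abs_mult)
      then show "\<bar>haar j (\<lambda>k. b k - \<delta> * real_of_int (m k)) x\<bar> \<le> \<bar>haar j b x\<bar>" for x
        unfolding haar_abs e by (intro mult_left_mono) auto
      have "\<bar>\<delta> * (b k / \<delta> - real_of_int (m k))\<bar> \<le> \<delta>" for k
        using mult_left_mono[OF round_to_zero(1)[of "b k / \<delta>"], of \<delta>] \<delta> unfolding m_def by (simp add: abs_mult)
      then show "\<bar>haar j (\<lambda>k. b k - \<delta> * real_of_int (m k)) x\<bar> \<le> \<delta>" for x
        unfolding haar_abs e using \<delta> by (simp add: indicator_def)
    qed
    from lp_le_scale[OF q this, of 2]
    have "lp_le q (\<lambda>t. 2 * haar j (\<lambda>k. b k - \<delta> * real_of_int (m k)) t) (2 * 2 powr (y * exponent_gap r q))"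
      by (simp add: \<delta>r)
    moreover have "(\<lambda>t. 2 * haar j (\<lambda>k. b k - \<delta> * real_of_int (m k)) t) = haar j (\<lambda>k. ?c k - 2 * (\<delta> * real_of_int (m k)))"
      unfolding haar_scale[symmetric, abs_def] by (simp add: b_def algebra_simps)
    ultimately have "lp_le q (haar j (\<lambda>k. ?c k - 2 * (\<delta> * real_of_int (m k)))) (2 * 2 powr (y * exponent_gap r q))" by simp
    from RL_haar_diff_lp_le[OF loc q this] 1
    show "\<exists>m. (\<Sum>k<2 ^ j. real_of_int \<bar>m k\<bar>) \<le> M \<and>
      lp_le q (\<lambda>t. RL \<alpha> (haar j ?c) t - RL \<alpha> (haar j (\<lambda>k. 2 * (\<delta> * real_of_int (m k)))) t)
        (C * 2 powr (- (real j * \<alpha>)) * (2 * 2 powr (y * exponent_gap r q)))"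
      by blast
  qed simp_all
qed

lemma RL_haar_coef_lp_le:
  assumes loc: "RL_local_bound \<alpha> C" and r: "1 \<le> r" "ereal r < q" and f: "lp_le (ereal r) f 1"
  shows "lp_le q (RL \<alpha> (haar j (haar_coef j f))) (2 * C * 2 powr (- (real j * (\<alpha> - exponent_gap r q))))"
proof -
  have r1: "1 \<le> ereal r" using r by (simp add: one_ereal_def)
  then have q: "1 \<le> q" using r by (cases q) (auto simp: one_ereal_def)
  let ?c = "haar_coef j f"
  define b where "b = (\<lambda>k. 1 / 2 * ?c k)"
  have "lp_le (ereal r) (\<lambda>t. 1 / 2 * haar j ?c t) (\<bar>1 / 2\<bar> * (2 * 1))"
    using r1 f by (intro lp_le_scale haar_haar_coef_lp_le)
  then have D: "lp_le (ereal r) (haar j b) 1" unfolding b_def haar_scale[abs_def] by simp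
  define \<delta> where "\<delta> = 2 powr (real j / r)"
  have \<delta>: "\<delta> > 0" by (simp add: \<delta>_def)
  have b: "\<bar>b k\<bar> \<le> \<delta>" if k: "k < 2 ^ j" for k
  proof -
    have "\<bar>b k\<bar> powr r \<le> (\<Sum>k<2 ^ j. \<bar>b k\<bar> powr r)" using k by (intro member_le_sum) auto
    also have "\<dots> \<le> 2 powr real j" using haar_coef_sum_le[OF r(1) D] by (simp add: powr_realpow)
    finally have "(\<bar>b k\<bar> powr r) powr (1 / r) \<le> (2 powr real j) powr (1 / r)" using r by (intro powr_mono2) auto
    then show ?thesis using r by (simp add: powr_powr \<delta>_def)
  qed
  have "lp_le q (haar j b) (\<delta> powr (r * exponent_gap r q))"
  proof (rule lp_le_truncated[OF r D haar_measurable _ _ \<delta>])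
    show "\<bar>haar j b x\<bar> \<le> \<delta>" for x
      using b[OF cell_less[of x j]] \<delta> by (simp add: haar_abs indicator_def)
  qed simp
  from lp_le_scale[OF q this, of 2]
  have "lp_le q (\<lambda>t. 2 * haar j b t) (2 * 2 powr (real j * exponent_gap r q))"
    using r by (simp add: \<delta>_def powr_powr)
  moreover have "(\<lambda>t. 2 * haar j b t) = haar j ?c"
    unfolding haar_scale[symmetric, abs_def] by (simp add: b_def)
  ultimately have "lp_le q (haar j ?c) (2 * 2 powr (real j * exponent_gap r q))" by simp
  from RL_local_boundD[OF loc q this haar_mean_zero]
  show ?thesis by (simp add: right_diff_distrib powr_add[symmetric] algebra_simps)
qed

lemma has_net_dyadic_mean_0:
  assumes a: "0 < \<alpha>" and p: "1 \<le> p" and q: "1 \<le> q" and \<delta>: "0 < \<delta>" "\<delta> \<le> 1"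
  shows "has_net (\<lambda>f. RL \<alpha> (dyadic_mean 0 f)) p q (3 / \<delta>) (1 / Gamma (\<alpha> + 1) * \<delta>)"
proof (rule has_net_of_int_vectors[where N = 1 and M = "1 / \<delta>" and z = "1 / 2"
      and \<Phi> = "\<lambda>m. RL \<alpha> (\<lambda>t. \<delta> * real_of_int (m 0) * indicator {0..<1} t)"])
  have I: "lp_le r (\<lambda>t. v * indicator {0..<1} t) B" if r: "1 \<le> r" and "\<bar>v\<bar> \<le> B" for v B :: real and r :: ereal
    using that by (intro lp_le_antimono_exponent[OF r, of \<infinity>]) (auto simp: lp_le_infinity indicator_def)
  have "1 \<le> 1 / \<delta>" using \<delta> by simp
  then have "2 powr (2 * real 1 + 1 / \<delta>) \<le> 2 powr (3 / \<delta>)" by (intro powr_mono) auto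
  then show "(1 + 4 * (1 / 2)) ^ 1 * (1 / 2) powr (- (1 / \<delta>)) \<le> 2 powr (3 / \<delta>)"
    using three_power_le[of 1 "1 / \<delta>"] by linarith
  show "\<exists>c. lp_le q (RL \<alpha> (\<lambda>t. \<delta> * real_of_int (m 0) * indicator {0..<1} t)) c" for m
    using RL_lp_le[OF a q I[OF q order_refl]] by blast
  fix f
  assume f: "lp_le p f 1"
  define v where "v = cell_mean 0 f 0"
  have P: "dyadic_mean 0 f = (\<lambda>t. v * indicator {0..<1} t)"
    by (rule ext) (auto simp: dyadic_mean_def v_def indicator_def cell_def floor_eq_iff)
  have "\<bar>v\<bar> \<le> 1"
  proof -
    have D: "dyadic 0 0 = {0..<1}" by (simp add: dyadic_def)
    have "\<bar>v\<bar> = \<bar>LINT s|lborel. f s\<bar>"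
    proof -
      have "(\<lambda>s. f s * indicator {0..<1} s) = f" using lp_le_supp[OF f] by (fastforce simp: indicator_def)
      then show ?thesis by (simp add: v_def cell_mean_def D)
    qed
    also have "\<dots> \<le> (LINT s|lborel. \<bar>f s\<bar>)" by (rule integral_abs_bound)
    also have "\<dots> \<le> 1" by (rule lp_le_integrable(2)[OF p f])
    finally show ?thesis .
  qed
  define k where "k = round_to_zero (v / \<delta>)"
  have k: "real_of_int \<bar>k\<bar> \<le> 1 / \<delta>"
    using round_to_zero(3)[of "v / \<delta>"] \<open>\<bar>v\<bar> \<le> 1\<close> \<delta> divide_right_mono[of "\<bar>v\<bar>" 1 \<delta>] by (simp add: k_def)
  have "v - \<delta> * real_of_int k = \<delta> * (v / \<delta> - real_of_int k)" using \<delta> by (simp add: algebra_simps)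
  then have e: "\<bar>v - \<delta> * real_of_int k\<bar> \<le> \<delta>" using round_to_zero(1)[of "v / \<delta>"] \<delta> by (simp add: abs_mult k_def)
  have "lp_le q (\<lambda>t. RL \<alpha> (dyadic_mean 0 f) t - RL \<alpha> (\<lambda>t. \<delta> * real_of_int k * indicator {0..<1} t) t) (1 / Gamma (\<alpha> + 1) * \<delta>)"
  proof (rule lp_le_AE_cong[OF q RL_lp_le[OF a q I[OF q e]]])
    show "(\<lambda>t. RL \<alpha> (dyadic_mean 0 f) t - RL \<alpha> (\<lambda>t. \<delta> * real_of_int k * indicator {0..<1} t) t) \<in> borel_measurable borel"
      by (intro borel_measurable_diff RL_measurable dyadic_mean_measurable) measurable
    show "AE t in lborel. RL \<alpha> (dyadic_mean 0 f) t - RL \<alpha> (\<lambda>t. \<delta> * real_of_int k * indicator {0..<1} t) t =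
       RL \<alpha> (\<lambda>t. (v - \<delta> * real_of_int k) * indicator {0..<1} t) t"
      using RL_diff[OF a I[OF order_refl order_refl, of v] I[OF order_refl order_refl, of "\<delta> * real_of_int k"]]
      unfolding P left_diff_distrib by eventually_elim simp
  qed (simp add: RL_supp)
  then show "\<exists>m. (\<Sum>k<1::nat. real_of_int \<bar>m k\<bar>) \<le> 1 / \<delta> \<and>
     lp_le q (\<lambda>t. RL \<alpha> (dyadic_mean 0 f) t - RL \<alpha> (\<lambda>t. \<delta> * real_of_int (m 0) * indicator {0..<1} t) t) (1 / Gamma (\<alpha> + 1) * \<delta>)"
    using k by (intro exI[of _ "\<lambda>_. k"]) simp
qed simp_all

section \<open>Equal exponents, small order\<close>

text \<open>
  The value \<open>1 / (1 - 2\<^sup>-\<^sup>s)\<close> of the geometric series with ratio \<open>2\<^sup>-\<^sup>s\<close>.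
\<close>

definition geo_bound :: "real \<Rightarrow> real" where
  "geo_bound s = 1 / (1 - 2 powr (- s))"

lemma powr_neg_lt_1: "0 < s \<Longrightarrow> 2 powr (- s) < (1::real)"
  using powr_less_mono[of "- s" 0 2] by simp

lemma geo_bound_pos: "0 < s \<Longrightarrow> 0 < geo_bound s"
  using powr_neg_lt_1[of s] by (simp add: geo_bound_def)

lemma sum_powr_le_geo_bound:
  assumes "0 < s"
  shows "(\<Sum>i<n. 2 powr (- (real i * s))) \<le> geo_bound s"
proof -
  let ?x = "2 powr (- s)"
  have x: "0 \<le> ?x" "?x < 1" using powr_neg_lt_1[OF assms] by auto
  have e: "2 powr (- (real i * s)) = ?x ^ i" for i
    by (simp add: powr_powr mult.commute flip: powr_realpow)
  have "(\<Sum>i<n. ?x ^ i) \<le> (\<Sum>i. ?x ^ i)"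
    using x by (intro sum_le_suminf summable_geometric) auto
  also have "\<dots> = geo_bound s" using x by (simp add: suminf_geometric geo_bound_def)
  finally show ?thesis by (simp add: e)
qed

lemma sum_powr_reversed_le_geo_bound:
  assumes "0 < s"
  shows "(\<Sum>j<J. 2 powr (- ((real J - real j) * s))) \<le> geo_bound s"
proof -
  have "(\<Sum>j<J. 2 powr (- ((real J - real j) * s))) = (\<Sum>i<J. 2 powr (- ((real J - real (J - Suc i)) * s)))"
    by (rule sum.nat_diff_reindex[symmetric])
  also have "\<dots> \<le> (\<Sum>i<J. 2 powr (- (real i * s)))"
  proof (rule sum_mono)
    fix i
    assume "i \<in> {..<J}"
    then have "real J - real (J - Suc i) = real (Suc i)" by auto
    then show "2 powr (- ((real J - real (J - Suc i)) * s)) \<le> 2 powr (- (real i * s))"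
      using assms by (intro powr_mono) (auto simp: mult_right_mono)
  qed
  also have "\<dots> \<le> geo_bound s" by (rule sum_powr_le_geo_bound[OF assms])
  finally show ?thesis .
qed

lemma sum_powr_Suc_le_geo_bound:
  assumes "0 < s"
  shows "(\<Sum>i<n. 2 powr (- (real i * s)) * real (Suc i)) \<le> geo_bound s ^ 2"
proof -
  let ?x = "2 powr (- s)"
  have x: "0 \<le> ?x" "?x < 1" using powr_neg_lt_1[OF assms] by auto
  have e: "2 powr (- (real i * s)) = ?x ^ i" for i
    by (simp add: powr_powr mult.commute flip: powr_realpow)
  have s: "(\<lambda>n. of_nat (Suc n) * ?x ^ n) sums (1 / (1 - ?x)^2)"
    using x by (intro geometric_deriv_sums) auto
  have "(\<Sum>i<n. of_nat (Suc i) * ?x ^ i) \<le> 1 / (1 - ?x)^2"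
    unfolding sums_unique[OF s] using x by (intro sum_le_suminf sums_summable[OF s]) auto
  then show ?thesis unfolding e geo_bound_def power_divide by (simp add: mult.commute)
qed

text \<open>
  The contribution of the coarsest average and of the Haar levels below \<open>J\<close>.
\<close>

definition low_part :: "real \<Rightarrow> nat \<Rightarrow> (real \<Rightarrow> real) \<Rightarrow> real \<Rightarrow> real" where
  "low_part \<alpha> J f t = RL \<alpha> (dyadic_mean 0 f) t + (\<Sum>j<J. RL \<alpha> (haar j (haar_coef j f)) t)"

lemma RL_decompose:
  assumes a: "0 < \<alpha>" and p: "1 \<le> p" and f: "lp_le p f c"
  shows "AE t in lborel. RL \<alpha> f t = low_part \<alpha> J f t + RL \<alpha> (\<lambda>s. f s - dyadic_mean J f s) t"
    and "AE t in lborel. RL \<alpha> (dyadic_mean J f) t = low_part \<alpha> J f t"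
proof -
  have f1: "lp_le 1 f c" using lp_le_antimono_exponent[OF _ p f] by simp
  have P: "lp_le 1 (dyadic_mean J f) c" for J using f1 by (intro dyadic_mean_lp_le) auto
  have H: "lp_le 1 (haar j (haar_coef j f)) (2 * c)" for j using f1 by (intro haar_haar_coef_lp_le) auto
  have i: "integrable lborel f" by (rule lp_le_1_integrable(1)[OF f1])
  have e: "dyadic_mean J f = (\<lambda>s. dyadic_mean 0 f s + (\<Sum>j<J. haar j (haar_coef j f) s))"
  proof (induction J)
    case (Suc J)
    then show ?case using dyadic_mean_Suc_diff[OF i, of J] by (auto simp: fun_eq_iff algebra_simps)
  qed simp
  have S: "lp_le 1 (\<lambda>s. \<Sum>j<J. haar j (haar_coef j f) s) (\<Sum>j<J. 2 * c)"
    using H by (intro lp_le_sum) auto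
  have "AE t in lborel. RL \<alpha> (\<lambda>s. dyadic_mean 0 f s + (\<Sum>j<J. haar j (haar_coef j f) s)) t
    = RL \<alpha> (dyadic_mean 0 f) t + RL \<alpha> (\<lambda>s. \<Sum>j<J. haar j (haar_coef j f) s) t"
    by (rule RL_add[OF a P S])
  moreover have "AE t in lborel. RL \<alpha> (\<lambda>s. \<Sum>j<J. haar j (haar_coef j f) s) t = (\<Sum>j<J. RL \<alpha> (haar j (haar_coef j f)) t)"
    using H by (intro RL_sum[OF a]) auto
  ultimately show 1: "AE t in lborel. RL \<alpha> (dyadic_mean J f) t = low_part \<alpha> J f t"
    unfolding e[symmetric] low_part_def by eventually_elim simp
  have "AE t in lborel. RL \<alpha> (\<lambda>s. f s - dyadic_mean J f s) t = RL \<alpha> f t - RL \<alpha> (dyadic_mean J f) t"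
    by (rule RL_diff[OF a f1 P])
  with 1 show "AE t in lborel. RL \<alpha> f t = low_part \<alpha> J f t + RL \<alpha> (\<lambda>s. f s - dyadic_mean J f s) t"
    by eventually_elim simp
qed

text \<open>
  The low levels with \<open>O(2\<^sup>J)\<close> bits up to an error \<open>O(2\<^sup>-\<^sup>J\<^sup>\<alpha>)\<close>, uniformly in the exponents and in
  \<open>\<alpha> \<le> \<alpha>0\<close>.
\<close>

lemma has_net_low_part:
  assumes loc: "RL_local_bound \<alpha> C" and p: "1 \<le> p" and q: "1 \<le> q"
    and \<alpha>0: "\<alpha> \<le> \<alpha>0" "\<alpha>0 < 1" and s: "s = (1 - \<alpha>0) / 2"
  shows "has_net (low_part \<alpha> J) p q ((3 + 4 * geo_bound s) * 2 ^ J) ((1 / Gamma (\<alpha> + 1) + C * geo_bound s) * 2 powr (- (real J * \<alpha>)))"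
proof -
  note a = RL_local_bound_pos[OF loc]
  have s0: "0 < s" using s \<alpha>0 by simp
  \<comment> \<open>the rate 1 - s lies midway between \<open>\<alpha>0\<close> and 1: bits and errors both decay at least like \<open>2\<close> to the power \<open>- s (J - j)\<close>\<close>
  define \<delta> where "\<delta> = (\<lambda>j. 2 powr (- ((real J - real j) * (1 - s))))"
  have \<delta>: "0 < \<delta> j" "\<delta> j \<le> 1" if "j \<in> {..<J}" for j
  proof -
    have "2 powr (- ((real J - real j) * (1 - s))) \<le> 2 powr (0::real)"
      using that s \<alpha>0 a by (intro powr_mono) auto
    then show "0 < \<delta> j" "\<delta> j \<le> 1" by (auto simp: \<delta>_def)
  qed
  define \<delta>' where "\<delta>' = 2 powr (- (real J * \<alpha>))"
  have \<delta>': "0 < \<delta>'" "\<delta>' \<le> 1"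
  proof -
    have "2 powr (- (real J * \<alpha>)) \<le> 2 powr (0::real)" using a by (intro powr_mono) auto
    then show "0 < \<delta>'" "\<delta>' \<le> 1" by (auto simp: \<delta>'_def)
  qed
  have "has_net (\<lambda>f t. \<Sum>j<J. RL \<alpha> (haar j (haar_coef j f)) t) p q (\<Sum>j<J. 4 * 2 ^ j / \<delta> j) (\<Sum>j<J. C * 2 powr (- (real j * \<alpha>)) * \<delta> j)"
    using \<delta> by (intro has_net_sum q has_net_haar_low loc p) auto
  from has_net_add[OF q has_net_dyadic_mean_0[OF a(1) p q \<delta>'] this]
  have c: "has_net (low_part \<alpha> J) p q (3 / \<delta>' + (\<Sum>j<J. 4 * 2 ^ j / \<delta> j)) (1 / Gamma (\<alpha> + 1) * \<delta>' + (\<Sum>j<J. C * 2 powr (- (real j * \<alpha>)) * \<delta> j))"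
    by (simp add: low_part_def[abs_def])
  show ?thesis
  proof (rule has_net_mono[OF q c])
    have "4 * 2 ^ j / \<delta> j = 4 * 2 ^ J * 2 powr (- ((real J - real j) * s))" for j
    proof -
      have "2 ^ j / \<delta> j = 2 powr (real j + (real J - real j) * (1 - s))"
        by (simp add: \<delta>_def powr_minus_divide powr_realpow[symmetric] powr_add)
      also have "real j + (real J - real j) * (1 - s) = real J + - ((real J - real j) * s)" by (simp add: algebra_simps)
      also have "2 powr \<dots> = 2 ^ J * 2 powr (- ((real J - real j) * s))" unfolding powr_add by (simp add: powr_realpow)
      finally show ?thesis by simp
    qed
    then have "(\<Sum>j<J. 4 * 2 ^ j / \<delta> j) = 4 * 2 ^ J * (\<Sum>j<J. 2 powr (- ((real J - real j) * s)))"
      by (simp add: sum_distrib_left)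
    also have "\<dots> \<le> 4 * 2 ^ J * geo_bound s" using sum_powr_reversed_le_geo_bound[OF s0] by (intro mult_left_mono) auto
    finally have 1: "(\<Sum>j<J. 4 * 2 ^ j / \<delta> j) \<le> 4 * 2 ^ J * geo_bound s" .
    have "1 / \<delta>' = 2 powr (real J * \<alpha>)" by (simp add: \<delta>'_def powr_minus_divide)
    also have "\<dots> \<le> 2 powr real J" using a mult_left_mono[of \<alpha> 1 "real J"] by (intro powr_mono) auto
    finally have "1 / \<delta>' \<le> 2 ^ J" by (simp add: powr_realpow)
    then show "3 / \<delta>' + (\<Sum>j<J. 4 * 2 ^ j / \<delta> j) \<le> (3 + 4 * geo_bound s) * 2 ^ J"
      using 1 by (simp add: algebra_simps)
    have "(\<Sum>j<J. C * 2 powr (- (real j * \<alpha>)) * \<delta> j) \<le> (\<Sum>j<J. C * 2 powr (- (real J * \<alpha>)) * 2 powr (- ((real J - real j) * s)))"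
    proof (rule sum_mono)
      fix j
      assume j: "j \<in> {..<J}"
      have "2 powr (- (real j * \<alpha>)) * \<delta> j = 2 powr (- (real j * \<alpha>) - (real J - real j) * (1 - s))"
        by (simp add: \<delta>_def powr_add[symmetric])
      also have "\<dots> \<le> 2 powr (- (real J * \<alpha>) - (real J - real j) * s)"
      proof (rule powr_mono)
        have "0 \<le> (real J - real j) * (1 - s - \<alpha> - s)" using j s \<alpha>0 by (intro mult_nonneg_nonneg) auto
        then show "- (real j * \<alpha>) - (real J - real j) * (1 - s) \<le> - (real J * \<alpha>) - (real J - real j) * s"
          by (simp add: algebra_simps)
      qed simp
      also have "\<dots> = 2 powr (- (real J * \<alpha>)) * 2 powr (- ((real J - real j) * s))" by (simp add: powr_add[symmetric])
      finally show "C * 2 powr (- (real j * \<alpha>)) * \<delta> j \<le> C * 2 powr (- (real J * \<alpha>)) * 2 powr (- ((real J - real j) * s))"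
        using a(3) by (simp add: mult.assoc mult_left_mono)
    qed
    also have "\<dots> = C * 2 powr (- (real J * \<alpha>)) * (\<Sum>j<J. 2 powr (- ((real J - real j) * s)))"
      by (simp add: sum_distrib_left)
    also have "\<dots> \<le> C * 2 powr (- (real J * \<alpha>)) * geo_bound s"
      using sum_powr_reversed_le_geo_bound[OF s0] a(3) by (intro mult_left_mono) auto
    finally show "1 / Gamma (\<alpha> + 1) * \<delta>' + (\<Sum>j<J. C * 2 powr (- (real j * \<alpha>)) * \<delta> j)
        \<le> (1 / Gamma (\<alpha> + 1) + C * geo_bound s) * 2 powr (- (real J * \<alpha>))"
      by (simp add: \<delta>'_def algebra_simps)
  qed
qed

text \<open>
  From \<open>A 2\<^sup>J\<close> bits for integers \<open>J\<close> to an arbitrary number \<open>x \<ge> 0\<close> of bits. For \<open>x < A\<close> a single ball is used.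
\<close>

lemma has_net_powr_of_dyadic:
  assumes q: "1 \<le> q" and \<alpha>: "0 < \<alpha>" "\<alpha> \<le> 1" and A: "1 \<le> A" and B: "0 \<le> B"
    and dy: "\<And>J. has_net S p q (A * 2 ^ J) (A * 2 powr (- (real J * \<alpha>)))" and bd: "has_net S p q 0 B" and x: "0 \<le> x"
  shows "has_net S p q x (A * (4 * A) * (1 + B) * (x + 1) powr (- \<alpha>))"
proof -
  have K0: "K1 * (x + 1) powr (- \<alpha>) \<le> A * (4 * A) * (1 + B) * (x + 1) powr (- \<alpha>)" if "K1 \<le> A * (4 * A) * (1 + B)" for K1
    using that by (intro mult_right_mono) auto
  show ?thesis
  proof (cases "x < A")
    case True
    have "1 = (x + 1) powr \<alpha> * (x + 1) powr (- \<alpha>)" using x by (simp add: powr_add[symmetric])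
    also have "\<dots> \<le> (2 * A) * (x + 1) powr (- \<alpha>)"
    proof (rule mult_right_mono)
      have "(x + 1) powr \<alpha> \<le> (x + 1) powr 1" using x \<alpha> by (intro powr_mono) auto
      then show "(x + 1) powr \<alpha> \<le> 2 * A" using x True A by simp
    qed simp
    finally have "B * 1 \<le> B * (2 * A * (x + 1) powr (- \<alpha>))" using B by (rule mult_left_mono)
    also have "\<dots> = (B * (2 * A)) * (x + 1) powr (- \<alpha>)" by simp
    also have "\<dots> \<le> A * (4 * A) * (1 + B) * (x + 1) powr (- \<alpha>)"
    proof (rule K0)
      have "B * (2 * A) \<le> (1 + B) * (4 * A)" using A B by (intro mult_mono) auto
      also have "\<dots> \<le> A * ((1 + B) * (4 * A))" using A B mult_right_mono[of 1 A "(1 + B) * (4 * A)"] by simp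
      finally show "B * (2 * A) \<le> A * (4 * A) * (1 + B)" by (simp add: mult_ac)
    qed
    finally show ?thesis using has_net_mono[OF q bd x] by simp
  next
    case False
    define J where "J = nat \<lfloor>log 2 (x / A)\<rfloor>"
    have xA: "1 \<le> x / A" using False A by simp
    then have l: "0 \<le> log 2 (x / A)" by simp
    have J: "real J \<le> log 2 (x / A)" "log 2 (x / A) < real J + 1" using l by (auto simp: J_def)
    have "2 powr real J \<le> x / A" using J(1) xA by (simp add: le_log_iff)
    then have J1: "A * 2 ^ J \<le> x" using A by (simp add: powr_realpow field_simps)
    have "x / A < 2 powr (real J + 1)" using J(2) xA by (simp add: log_less_iff)
    then have "x < 2 powr (real J + 1) * A" using A by (simp add: divide_less_eq)
    also have "\<dots> = 2 * A * 2 powr real J" by (simp add: powr_add)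
    finally have "x < 2 * A * 2 powr real J" .
    moreover have "x + 1 \<le> 2 * x" using False A by simp
    ultimately have "x + 1 \<le> 4 * A * 2 powr real J" by linarith
    then have "(4 * A * 2 powr real J) powr (- \<alpha>) \<le> (x + 1) powr (- \<alpha>)"
      using x \<alpha> by (intro powr_mono2') auto
    then have "(4 * A) powr (- \<alpha>) * 2 powr (- (real J * \<alpha>)) \<le> (x + 1) powr (- \<alpha>)"
      using A by (simp add: powr_mult powr_powr)
    then have "(4 * A) powr \<alpha> * ((4 * A) powr (- \<alpha>) * 2 powr (- (real J * \<alpha>))) \<le> (4 * A) powr \<alpha> * (x + 1) powr (- \<alpha>)"
      by (intro mult_left_mono) auto
    then have "2 powr (- (real J * \<alpha>)) \<le> (4 * A) powr \<alpha> * (x + 1) powr (- \<alpha>)"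
      using A by (simp add: powr_minus field_simps)
    also have "\<dots> \<le> (4 * A) * (x + 1) powr (- \<alpha>)"
      using A \<alpha> powr_mono[of \<alpha> 1 "4 * A"] by (intro mult_right_mono) auto
    finally have "A * 2 powr (- (real J * \<alpha>)) \<le> A * (4 * A) * (x + 1) powr (- \<alpha>)"
      using A by (simp add: mult.assoc)
    also have "\<dots> \<le> A * (4 * A) * (1 + B) * (x + 1) powr (- \<alpha>)"
      using A B by (intro K0) (simp add: distrib_left)
    finally show ?thesis using has_net_mono[OF q dy J1] by simp
  qed
qed

lemma RL_meas_supp:
  assumes "lp_le p f 1"
  shows "RL \<alpha> f \<in> borel_measurable borel" "t \<notin> {0..<1} \<Longrightarrow> RL \<alpha> f t = 0"
  using assms RL_measurable lp_le_meas by (auto simp: RL_supp)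

lemma has_net_RL_same_exponent_small:
  assumes \<alpha>0: "\<alpha>0 < 1"
  shows "\<exists>K>0. \<forall>\<alpha> p x. 0 < \<alpha> \<and> \<alpha> \<le> \<alpha>0 \<and> 1 \<le> p \<and> 0 \<le> x \<longrightarrow> has_net (RL \<alpha>) p p x (K * (x + 1) powr (- \<alpha>))"
proof -
  obtain C where C: "\<forall>\<alpha>. 0 < \<alpha> \<and> \<alpha> \<le> \<alpha>0 \<longrightarrow> RL_local_bound \<alpha> C" using RL_local_bound_ex[OF \<alpha>0] by (elim exE)
  obtain G :: real where G: "G > 0" and G1: "\<forall>\<alpha>. 0 < \<alpha> \<and> \<alpha> \<le> 1 \<longrightarrow> 1 / Gamma (\<alpha> + 1) \<le> G"
    using inverse_Gamma_bounded by (elim exE conjE)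
  define s where "s = (1 - \<alpha>0) / 2"
  have s: "0 < s" using \<alpha>0 by (simp add: s_def)
  have g: "0 < geo_bound s" by (rule geo_bound_pos[OF s])
  define A where "A = (3 + 4 * geo_bound s) + (G + \<bar>C\<bar> * geo_bound s + 2 * \<bar>C\<bar>)"
  have "0 \<le> \<bar>C\<bar> * geo_bound s" using g by simp
  then have A1: "1 \<le> A" using g G unfolding A_def by linarith
  define K where "K = A * (4 * A) * (1 + G)"
  have "has_net (RL \<alpha>) p p x (K * (x + 1) powr (- \<alpha>))" if a: "0 < \<alpha>" "\<alpha> \<le> \<alpha>0" and p: "1 \<le> p" and x: "0 \<le> x" for \<alpha> p x
  proof -
    have loc: "RL_local_bound \<alpha> C" using C a by blast
    have Cp: "C > 0" by (rule RL_local_bound_pos(3)[OF loc])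
    have a1: "\<alpha> \<le> 1" using a \<alpha>0 by simp
    have G2: "1 / Gamma (\<alpha> + 1) \<le> G" using G1 a a1 by blast
    have dy: "has_net (RL \<alpha>) p p (A * 2 ^ J) (A * 2 powr (- (real J * \<alpha>)))" for J
    proof -
      have t: "has_net (\<lambda>f. RL \<alpha> (\<lambda>s. f s - dyadic_mean J f s)) p p 0 (C * 2 powr (- (real J * \<alpha>)) * (1 + 1))"
        by (intro has_net_of_bounded RL_local_boundD[OF loc p] lp_le_diff p dyadic_mean_lp_le mean_zero_diff_dyadic_mean lp_le_integrable(1)[OF p])
      have c: "has_net (\<lambda>f t. low_part \<alpha> J f t + RL \<alpha> (\<lambda>s. f s - dyadic_mean J f s) t) p p ((3 + 4 * geo_bound s) * 2 ^ J + 0)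
         ((1 / Gamma (\<alpha> + 1) + C * geo_bound s) * 2 powr (- (real J * \<alpha>)) + C * 2 powr (- (real J * \<alpha>)) * (1 + 1))"
        by (rule has_net_add[OF p has_net_low_part[OF loc p p a(2) \<alpha>0 s_def] t])
      show ?thesis
      proof (rule has_net_mono[OF p has_net_AE_cong[OF p c RL_meas_supp RL_decompose(1)[OF a(1) p]]])
        show "(3 + 4 * geo_bound s) * 2 ^ J + 0 \<le> A * 2 ^ J"
          using G g unfolding A_def by simp
        have "(1 / Gamma (\<alpha> + 1) + C * geo_bound s) * 2 powr (- (real J * \<alpha>)) + C * 2 powr (- (real J * \<alpha>)) * (1 + 1)
           = (1 / Gamma (\<alpha> + 1) + C * geo_bound s + 2 * C) * 2 powr (- (real J * \<alpha>))" by (simp add: algebra_simps)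
        also have "\<dots> \<le> A * 2 powr (- (real J * \<alpha>))"
          using G2 Cp g by (intro mult_right_mono) (auto simp: A_def)
        finally show "(1 / Gamma (\<alpha> + 1) + C * geo_bound s) * 2 powr (- (real J * \<alpha>)) + C * 2 powr (- (real J * \<alpha>)) * (1 + 1) \<le> A * 2 powr (- (real J * \<alpha>))" .
      qed
    qed
    have bd: "has_net (RL \<alpha>) p p 0 G"
    proof (rule has_net_of_bounded)
      fix f
      assume "lp_le p f 1"
      from lp_le_mono[OF p RL_lp_le[OF a(1) p this], of G] show "lp_le p (RL \<alpha> f) G" using G2 by simp
    qed
    show ?thesis unfolding K_def using G by (intro has_net_powr_of_dyadic[OF p a(1) a1 A1 _ dy bd x]) simp
  qed
  moreover have "K > 0" using A1 G unfolding K_def by (intro mult_pos_pos) auto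
  ultimately show ?thesis by (intro exI[of _ K] conjI allI impI) simp_all
qed

section \<open>Increasing exponents and composition\<close>

lemma low_part_add: "low_part \<alpha> (L + m) f t = low_part \<alpha> L f t + (\<Sum>i<m. RL \<alpha> (haar (L + i) (haar_coef (L + i) f)) t)"
  by (induction m) (simp_all add: low_part_def)

lemma exponent_gap_pos:
  assumes "1 \<le> r" "ereal r < q"
  shows "0 < exponent_gap r q"
  using assms by (cases q) (auto simp: exponent_gap_def frac_less2)

text \<open>
  The tail is bounded level by level in \<open>L\<^sub>q\<close>; that the Haar levels sum up to the tail
  is known almost everywhere along a subsequence, which suffices for Fatou's lemma.
\<close>

lemma RL_tail_lp_le:
  assumes loc: "RL_local_bound \<alpha> C" and r: "1 \<le> r" "ereal r < q" and gap: "exponent_gap r q < \<alpha>" and f: "lp_le (ereal r) f 1"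
  shows "lp_le q (RL \<alpha> (\<lambda>s. f s - dyadic_mean L f s)) (2 * C * geo_bound (\<alpha> - exponent_gap r q) * 2 powr (- (real L * (\<alpha> - exponent_gap r q))))"
proof -
  define \<sigma> where "\<sigma> = \<alpha> - exponent_gap r q"
  have \<sigma>: "0 < \<sigma>" using gap by (simp add: \<sigma>_def)
  note a = RL_local_bound_pos[OF loc]
  have r1: "1 \<le> ereal r" using r by (simp add: one_ereal_def)
  then have q: "1 \<le> q" using r by (cases q) (auto simp: one_ereal_def)
  have f1: "lp_le 1 f 1" using lp_le_antimono_exponent[OF _ r1 f] by simp
  obtain \<rho> where \<rho>: "strict_mono \<rho>" "AE t in lborel. (\<lambda>n. RL \<alpha> (\<lambda>s. f s - dyadic_mean (\<rho> n) f s) t) \<longlonglongrightarrow> 0"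
    using RL_dyadic_mean_AE_subseq[OF a(1,2) f1] by blast
  define m where "m = (\<lambda>i. \<rho> (i + L) - L)"
  have m: "L + m i = \<rho> (i + L)" for i using seq_suble[OF \<rho>(1), of "i + L"] by (simp add: m_def)
  define g where "g = (\<lambda>i t. \<Sum>k<m i. RL \<alpha> (haar (L + k) (haar_coef (L + k) f)) t)"
  show ?thesis
  proof (rule lp_le_limit[where g = g, OF q])
    fix i
    have 1: "lp_le q (g i) (\<Sum>k<m i. 2 * C * 2 powr (- (real (L + k) * \<sigma>)))"
      unfolding g_def \<sigma>_def by (intro lp_le_sum q RL_haar_coef_lp_le loc r f) auto
    have "(\<Sum>k<m i. 2 * C * 2 powr (- (real (L + k) * \<sigma>))) = 2 * C * 2 powr (- (real L * \<sigma>)) * (\<Sum>k<m i. 2 powr (- (real k * \<sigma>)))"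
      by (simp add: sum_distrib_left powr_add[symmetric] algebra_simps)
    also have "\<dots> \<le> 2 * C * 2 powr (- (real L * \<sigma>)) * geo_bound \<sigma>"
      using sum_powr_le_geo_bound[OF \<sigma>] a(3) by (intro mult_left_mono) auto
    finally show "lp_le q (g i) (2 * C * geo_bound (\<alpha> - exponent_gap r q) * 2 powr (- (real L * (\<alpha> - exponent_gap r q))))"
      using lp_le_mono[OF q 1] by (simp add: \<sigma>_def mult_ac)
  next
    show "RL \<alpha> (\<lambda>s. f s - dyadic_mean L f s) \<in> borel_measurable borel"
      by (intro RL_measurable borel_measurable_diff lp_le_meas[OF f] dyadic_mean_measurable)
    have "AE t in lborel. \<forall>J. RL \<alpha> f t = low_part \<alpha> J f t + RL \<alpha> (\<lambda>s. f s - dyadic_mean J f s) t"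
      using RL_decompose(1)[OF a(1) r1 f] by (subst AE_all_countable) blast
    with \<rho>(2) show "AE t in lborel. (\<lambda>i. g i t) \<longlonglongrightarrow> RL \<alpha> (\<lambda>s. f s - dyadic_mean L f s) t"
    proof eventually_elim
      case (elim t)
      have "g i t = RL \<alpha> (\<lambda>s. f s - dyadic_mean L f s) t - RL \<alpha> (\<lambda>s. f s - dyadic_mean (\<rho> (i + L)) f s) t" for i
        using elim(2)[rule_format, of L] elim(2)[rule_format, of "\<rho> (i + L)"] low_part_add[of \<alpha> L "m i" f t]
        by (simp add: m g_def)
      moreover have "(\<lambda>i. RL \<alpha> (\<lambda>s. f s - dyadic_mean L f s) t - RL \<alpha> (\<lambda>s. f s - dyadic_mean (\<rho> (i + L)) f s) t)
        \<longlonglongrightarrow> RL \<alpha> (\<lambda>s. f s - dyadic_mean L f s) t - 0"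
        by (intro tendsto_diff tendsto_const LIMSEQ_ignore_initial_segment[OF elim(1)])
      ultimately show ?case by simp
    qed
  qed (simp add: RL_supp)
qed

lemma has_net_zero_bits:
  assumes q: "1 \<le> q" and S: "has_net S p q x \<epsilon>"
  shows "\<exists>B\<ge>0. has_net S p q 0 B"
proof (rule has_netE[OF S])
  fix Y
  assume Y: "finite Y" "real (card Y) \<le> 2 powr x" "\<And>y. y \<in> Y \<Longrightarrow> \<exists>c. lp_le q y c"
    "\<And>f. lp_le p f 1 \<Longrightarrow> \<exists>y\<in>Y. lp_le q (\<lambda>t. S f t - y t) \<epsilon>"
  from Y(3) obtain c where c: "\<And>y. y \<in> Y \<Longrightarrow> lp_le q y (c y)" by metis
  have c0: "0 \<le> c y" if "y \<in> Y" for y using lp_le_nonneg[OF c[OF that]] .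
  define B where "B = \<bar>\<epsilon>\<bar> + (\<Sum>y\<in>Y. c y)"
  have "has_net S p q 0 B"
  proof (rule has_net_of_bounded)
    fix f
    assume "lp_le p f 1"
    then obtain y where y: "y \<in> Y" "lp_le q (\<lambda>t. S f t - y t) \<epsilon>" using Y(4) by blast
    have "lp_le q (\<lambda>t. S f t - y t + y t) (\<epsilon> + c y)" by (rule lp_le_add[OF q y(2) c[OF y(1)]])
    then have 1: "lp_le q (S f) (\<epsilon> + c y)" by simp
    have "c y \<le> (\<Sum>y\<in>Y. c y)" using Y(1) y(1) c0 by (intro member_le_sum) auto
    then show "lp_le q (S f) B" by (intro lp_le_mono[OF q 1]) (simp add: B_def)
  qed
  moreover have "0 \<le> B" using c0 by (simp add: B_def sum_nonneg)
  ultimately show ?thesis by blast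
qed

text \<open>
  The estimate for \<open>p < q\<close> and one fixed order between \<open>1/p - 1/q\<close> and \<open>1\<close>. Here the constant may depend on all
  parameters.
\<close>

lemma has_net_RL_block:
  assumes r: "1 \<le> r" "ereal r < q" and \<alpha>: "exponent_gap r q < \<alpha>" "\<alpha> < 1"
  shows "\<exists>K>0. \<forall>x\<ge>0. has_net (RL \<alpha>) (ereal r) q x (K * (x + 1) powr (- \<alpha>))"
proof -
  define d where "d = exponent_gap r q"
  have d: "0 < d" "d < \<alpha>" using exponent_gap_pos[OF r] \<alpha> by (auto simp: d_def)
  have a0: "0 < \<alpha>" "\<alpha> \<le> 1" using d \<alpha> by auto
  have r1: "1 \<le> ereal r" using r by (simp add: one_ereal_def)
  then have q: "1 \<le> q" using r by (cases q) (auto simp: one_ereal_def)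
  obtain C where loc: "RL_local_bound \<alpha> C" using RL_local_bound_ex[OF \<alpha>(2)] a0 by blast
  have C: "C > 0" by (rule RL_local_bound_pos(3)[OF loc])
  \<comment> \<open>\<open>\<omega> > 1\<close> makes the bits of the high levels summable, and \<open>\<omega> d < \<alpha>\<close> their errors\<close>
  define \<omega> where "\<omega> = (1 + \<alpha> / d) / 2"
  have \<omega>: "1 < \<omega>" "\<omega> * d < \<alpha>" using d by (auto simp: \<omega>_def field_simps)
  define s where "s = (1 - \<alpha>) / 2"
  have s: "0 < s" using \<alpha> by (simp add: s_def)
  define \<sigma> where "\<sigma> = \<alpha> - d"
  have \<sigma>: "0 < \<sigma>" using d by (simp add: \<sigma>_def)
  define b1 where "b1 = (8 + \<omega>) * geo_bound (\<omega> - 1) ^ 2"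
  define e0 where "e0 = 1 / Gamma (\<alpha> + 1) + C * geo_bound s"
  define e1 where "e1 = 2 * C * 2 powr (\<omega> * d) * geo_bound (\<alpha> - \<omega> * d)"
  define A where "A = (3 + 4 * geo_bound s) + b1 + (e0 + e1 + 1)"
  have g: "0 < geo_bound s" "0 < geo_bound (\<omega> - 1)" "0 < geo_bound (\<alpha> - \<omega> * d)" "0 < geo_bound \<sigma>"
    using s \<omega> \<sigma> by (auto intro: geo_bound_pos)
  have "0 \<le> b1" "0 \<le> e0" "0 \<le> e1" using g C \<omega> a0 Gamma_real_pos[of "\<alpha> + 1"] by (auto simp: b1_def e0_def e1_def)
  note nn = this
  have A1: "1 \<le> A" using nn g(1) unfolding A_def by linarith
  have dy: "has_net (RL \<alpha>) (ereal r) q (A * 2 ^ J) (A * 2 powr (- (real J * \<alpha>)))" for J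
  proof -
    define \<epsilon> where "\<epsilon> = 2 powr (- (real J * \<alpha>))"
    have \<epsilon>: "\<epsilon> > 0" by (simp add: \<epsilon>_def)
    \<comment> \<open>from level J + m on, everything is approximated by 0\<close>
    obtain m where "(2 powr (- \<sigma>)) ^ m < \<epsilon> / (2 * C * geo_bound \<sigma>)"
      using real_arch_pow_inv[of "\<epsilon> / (2 * C * geo_bound \<sigma>)" "2 powr (- \<sigma>)"] \<epsilon> C g powr_neg_lt_1[OF \<sigma>] by auto
    then have "2 powr (- (real m * \<sigma>)) < \<epsilon> / (2 * C * geo_bound \<sigma>)"
      by (simp add: powr_powr mult.commute flip: powr_realpow)
    then have m: "2 * C * geo_bound \<sigma> * 2 powr (- (real m * \<sigma>)) \<le> \<epsilon>" using C g by (simp add: field_simps)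
    have t: "has_net (\<lambda>f. RL \<alpha> (\<lambda>s. f s - dyadic_mean (J + m) f s)) (ereal r) q 0 \<epsilon>"
    proof (rule has_net_of_bounded)
      fix f
      assume f: "lp_le (ereal r) f 1"
      have "2 * C * geo_bound \<sigma> * 2 powr (- (real (J + m) * \<sigma>)) \<le> 2 * C * geo_bound \<sigma> * 2 powr (- (real m * \<sigma>))"
        using C g \<sigma> by (intro mult_left_mono powr_mono) auto
      with m have "2 * C * geo_bound \<sigma> * 2 powr (- (real (J + m) * \<sigma>)) \<le> \<epsilon>" by linarith
      with RL_tail_lp_le[OF loc r \<alpha>(1) f, of "J + m"]
      show "lp_le q (RL \<alpha> (\<lambda>s. f s - dyadic_mean (J + m) f s)) \<epsilon>"
        unfolding \<sigma>_def d_def by (rule lp_le_mono[OF q])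
    qed
    define y where "y = (\<lambda>i::nat. \<omega> * real (Suc i))"
    have y: "1 \<le> y i" for i
    proof -
      have "1 * 1 \<le> \<omega> * real (Suc i)" using \<omega> by (intro mult_mono) auto
      then show ?thesis by (simp add: y_def)
    qed
    have h: "has_net (\<lambda>f t. \<Sum>i<m. RL \<alpha> (haar (J + i) (haar_coef (J + i) f)) t) (ereal r) q
       (\<Sum>i<m. 2 ^ (J + i) * 2 powr (- y i) * (8 + y i)) (\<Sum>i<m. C * 2 powr (- (real (J + i) * \<alpha>)) * (2 * 2 powr (y i * d)))"
      unfolding d_def by (intro has_net_sum q has_net_haar_high loc r y) auto
    have "(\<Sum>i<m. 2 ^ (J + i) * 2 powr (- y i) * (8 + y i)) \<le> (\<Sum>i<m. 2 ^ J * (8 + \<omega>) * (2 powr (- (real i * (\<omega> - 1))) * real (Suc i)))"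
    proof (rule sum_mono)
      fix i
      have "2 ^ (J + i) * 2 powr (- y i) = 2 ^ J * 2 powr (real i - y i)"
        by (simp add: power_add powr_diff powr_minus_divide powr_realpow)
      also have "\<dots> \<le> 2 ^ J * 2 powr (- (real i * (\<omega> - 1)))"
        using \<omega> by (intro mult_left_mono powr_mono) (auto simp: y_def algebra_simps)
      finally have 1: "2 ^ (J + i) * 2 powr (- y i) \<le> 2 ^ J * 2 powr (- (real i * (\<omega> - 1)))" .
      have 2: "8 + y i \<le> (8 + \<omega>) * real (Suc i)" by (simp add: y_def algebra_simps)
      have "2 ^ (J + i) * 2 powr (- y i) * (8 + y i) \<le> 2 ^ J * 2 powr (- (real i * (\<omega> - 1))) * ((8 + \<omega>) * real (Suc i))"
        by (rule mult_mono[OF 1 2]) (use y[of i] in auto)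
      then show "2 ^ (J + i) * 2 powr (- y i) * (8 + y i) \<le> 2 ^ J * (8 + \<omega>) * (2 powr (- (real i * (\<omega> - 1))) * real (Suc i))"
        by (simp only: mult_ac)
    qed
    also have "\<dots> = 2 ^ J * (8 + \<omega>) * (\<Sum>i<m. 2 powr (- (real i * (\<omega> - 1))) * real (Suc i))"
      by (simp add: sum_distrib_left)
    also have "\<dots> \<le> 2 ^ J * (8 + \<omega>) * geo_bound (\<omega> - 1) ^ 2"
      using \<omega> by (intro mult_left_mono sum_powr_Suc_le_geo_bound) auto
    finally have bits: "(\<Sum>i<m. 2 ^ (J + i) * 2 powr (- y i) * (8 + y i)) \<le> b1 * 2 ^ J" by (simp add: b1_def mult_ac)
    have "(\<Sum>i<m. C * 2 powr (- (real (J + i) * \<alpha>)) * (2 * 2 powr (y i * d)))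
        = 2 * C * 2 powr (\<omega> * d) * \<epsilon> * (\<Sum>i<m. 2 powr (- (real i * (\<alpha> - \<omega> * d))))"
      unfolding sum_distrib_left
    proof (rule sum.cong)
      fix i
      have "2 powr (- (real (J + i) * \<alpha>)) * 2 powr (y i * d) = 2 powr (\<omega> * d) * \<epsilon> * 2 powr (- (real i * (\<alpha> - \<omega> * d)))"
        by (simp add: \<epsilon>_def y_def powr_add[symmetric] algebra_simps)
      then show "C * 2 powr (- (real (J + i) * \<alpha>)) * (2 * 2 powr (y i * d)) = 2 * C * 2 powr (\<omega> * d) * \<epsilon> * 2 powr (- (real i * (\<alpha> - \<omega> * d)))"
        by (simp add: mult_ac)
    qed simp
    also have "\<dots> \<le> 2 * C * 2 powr (\<omega> * d) * \<epsilon> * geo_bound (\<alpha> - \<omega> * d)"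
      using C \<epsilon> \<omega> by (intro mult_left_mono sum_powr_le_geo_bound) auto
    finally have err: "(\<Sum>i<m. C * 2 powr (- (real (J + i) * \<alpha>)) * (2 * 2 powr (y i * d))) \<le> e1 * \<epsilon>"
      by (simp add: e1_def mult_ac)
    have l: "has_net (low_part \<alpha> J) (ereal r) q ((3 + 4 * geo_bound s) * 2 ^ J) (e0 * \<epsilon>)"
      unfolding e0_def \<epsilon>_def by (rule has_net_low_part[OF loc r1 q order_refl \<alpha>(2) s_def])
    note c = has_net_add[OF q has_net_add[OF q l h] t]
    show ?thesis
    proof (rule has_net_mono[OF q has_net_AE_cong[OF q c RL_meas_supp]])
      fix f
      assume f: "lp_le (ereal r) f 1"
      show "AE t in lborel. RL \<alpha> f t = low_part \<alpha> J f t + (\<Sum>i<m. RL \<alpha> (haar (J + i) (haar_coef (J + i) f)) t) + RL \<alpha> (\<lambda>s. f s - dyadic_mean (J + m) f s) t"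
        using RL_decompose(1)[OF a0(1) r1 f, of "J + m"] by (simp add: low_part_add)
    next
      have "(3 + 4 * geo_bound s) * 2 ^ J + (\<Sum>i<m. 2 ^ (J + i) * 2 powr (- y i) * (8 + y i)) + 0 \<le> (3 + 4 * geo_bound s + b1) * 2 ^ J"
        using bits by (simp add: algebra_simps)
      also have "\<dots> \<le> A * 2 ^ J" using nn by (intro mult_right_mono) (auto simp: A_def)
      finally show "(3 + 4 * geo_bound s) * 2 ^ J + (\<Sum>i<m. 2 ^ (J + i) * 2 powr (- y i) * (8 + y i)) + 0 \<le> A * 2 ^ J" .
      have "e0 * \<epsilon> + (\<Sum>i<m. C * 2 powr (- (real (J + i) * \<alpha>)) * (2 * 2 powr (y i * d))) + \<epsilon> \<le> (e0 + e1 + 1) * \<epsilon>"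
        using err by (simp add: algebra_simps)
      also have "\<dots> \<le> A * \<epsilon>" using nn g(1) \<epsilon> by (intro mult_right_mono) (auto simp: A_def)
      finally show "e0 * \<epsilon> + (\<Sum>i<m. C * 2 powr (- (real (J + i) * \<alpha>)) * (2 * 2 powr (y i * d))) + \<epsilon> \<le> A * 2 powr (- (real J * \<alpha>))"
        by (simp add: \<epsilon>_def)
    qed
  qed
  obtain B where B: "B \<ge> 0" "has_net (RL \<alpha>) (ereal r) q 0 B" using has_net_zero_bits[OF q dy[of 0]] by blast
  have "A * (4 * A) * (1 + B) > 0" using A1 B by (intro mult_pos_pos) auto
  then show ?thesis using has_net_powr_of_dyadic[OF q a0 A1 B(1) dy B(2)] by blast
qed

lemma has_net_RL_compose:
  assumes ab: "0 < \<alpha>" "0 < \<beta>" and p: "1 \<le> p" and r: "1 \<le> r" and q: "1 \<le> q"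
    and \<beta>: "has_net (RL \<beta>) p r x \<epsilon>" and \<alpha>: "has_net (RL \<alpha>) r q x' \<epsilon>'" and \<epsilon>: "0 < \<epsilon>"
  shows "has_net (RL (\<alpha> + \<beta>)) p q (x + x') (\<epsilon> * \<epsilon>')"
proof (rule has_net_AE_cong[OF q has_net_RL_comp[OF ab(1) r q \<beta> \<alpha> \<epsilon>] RL_meas_supp])
  fix f
  assume f: "lp_le p f 1"
  have "lp_le 1 f 1" using lp_le_antimono_exponent[OF _ p f] by simp
  from RL_semigroup[OF ab this] show "AE t in lborel. RL (\<alpha> + \<beta>) f t = RL \<alpha> (RL \<beta> f) t"
    by eventually_elim simp
qed

text \<open>
  The available bits are shared equally by the two factors.
\<close>

lemma has_net_RL_compose_powr:
  assumes ab: "0 < \<alpha>" "0 < \<beta>" and p: "1 \<le> p" and r: "1 \<le> r" and q: "1 \<le> q" and K: "0 < K" "0 < K'"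
    and \<beta>: "\<And>x. 0 \<le> x \<Longrightarrow> has_net (RL \<beta>) p r x (K * (x + 1) powr (- \<beta>))"
    and \<alpha>: "\<And>x. 0 \<le> x \<Longrightarrow> has_net (RL \<alpha>) r q x (K' * (x + 1) powr (- \<alpha>))"
    and x: "0 \<le> x"
  shows "has_net (RL (\<alpha> + \<beta>)) p q x (K * K' * 2 powr (\<alpha> + \<beta>) * (x + 1) powr (- (\<alpha> + \<beta>)))"
proof -
  have c: "has_net (RL (\<alpha> + \<beta>)) p q (x / 2 + x / 2) (K * (x / 2 + 1) powr (- \<beta>) * (K' * (x / 2 + 1) powr (- \<alpha>)))"
    by (intro has_net_RL_compose[OF ab p r q \<beta> \<alpha>]) (use x K in auto)
  have "(x / 2 + 1) powr (- \<beta>) * (x / 2 + 1) powr (- \<alpha>) = (x / 2 + 1) powr (- (\<alpha> + \<beta>))"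
    by (simp add: powr_add[symmetric] algebra_simps)
  also have "\<dots> \<le> ((x + 1) / 2) powr (- (\<alpha> + \<beta>))" using x ab by (intro powr_mono2') auto
  also have "\<dots> = 2 powr (\<alpha> + \<beta>) * (x + 1) powr (- (\<alpha> + \<beta>))"
  proof -
    have "((x + 1) / 2) powr (- c) = 2 powr c * (x + 1) powr (- c)" for c
      using x by (simp add: powr_divide powr_minus_divide field_simps)
    then show ?thesis .
  qed
  finally have "K * K' * ((x / 2 + 1) powr (- \<beta>) * (x / 2 + 1) powr (- \<alpha>)) \<le> K * K' * (2 powr (\<alpha> + \<beta>) * (x + 1) powr (- (\<alpha> + \<beta>)))"
    using K by (intro mult_left_mono) auto
  then show ?thesis by (intro has_net_mono[OF q c]) (simp_all add: mult_ac)
qed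

text \<open>
  Orders up to \<open>b\<close> are reduced to orders up to \<open>1/2\<close> by taking an \<open>m\<close>-th root of the operator, where \<open>m \<ge> 2b\<close> does not depend on
  the order.
\<close>

lemma has_net_RL_same_exponent:
  assumes b: "0 < b"
  shows "\<exists>K>0. \<forall>\<alpha> p x. 0 < \<alpha> \<and> \<alpha> \<le> b \<and> 1 \<le> p \<and> 0 \<le> x \<longrightarrow> has_net (RL \<alpha>) p p x (K * (x + 1) powr (- \<alpha>))"
proof -
  have half: "1 / 2 < (1::real)" by simp
  obtain K where K: "K > 0" and K1: "\<forall>\<alpha> p x. 0 < \<alpha> \<and> \<alpha> \<le> 1 / 2 \<and> 1 \<le> p \<and> 0 \<le> x \<longrightarrow> has_net (RL \<alpha>) p p x (K * (x + 1) powr (- \<alpha>))"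
    using has_net_RL_same_exponent_small[OF half] by (elim exE conjE)
  define m where "m = nat \<lceil>2 * b\<rceil>"
  have m: "2 * b \<le> real m" "0 < m" using b by (auto simp: m_def)
  have "has_net (RL \<alpha>) p p x (K ^ m * real m powr b * (x + 1) powr (- \<alpha>))"
    if a: "0 < \<alpha>" "\<alpha> \<le> b" and p: "1 \<le> p" and x: "0 \<le> x" for \<alpha> p x
  proof -
    define \<beta> where "\<beta> = \<alpha> / real m"
    define y where "y = x / real m"
    have y: "0 \<le> y" using x by (simp add: y_def)
    have \<beta>: "0 < \<beta>" "\<beta> \<le> 1 / 2" using a m by (auto simp: \<beta>_def field_simps)
    define e where "e = K * (y + 1) powr (- \<beta>)"
    have e: "e > 0" using K y by (simp add: e_def)
    have c: "has_net (RL \<beta>) p p y e" unfolding e_def using K1 \<beta> p y by blast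
    have it: "has_net (RL (real (Suc i) * \<beta>)) p p (real (Suc i) * y) (e ^ Suc i)" for i
    proof (induction i)
      case (Suc i)
      have "has_net (RL (\<beta> + real (Suc i) * \<beta>)) p p (real (Suc i) * y + y) (e ^ Suc i * e)"
        using e \<beta> by (intro has_net_RL_compose[OF _ _ p p p Suc.IH c]) auto
      then show ?case by (simp add: algebra_simps)
    qed (use c in simp)
    have "has_net (RL (real m * \<beta>)) p p (real m * y) (e ^ m)" using it[of "m - 1"] m by simp
    then have c2: "has_net (RL \<alpha>) p p x (e ^ m)" using m by (simp add: \<beta>_def y_def)
    have "e ^ m = K ^ m * (y + 1) powr (- \<alpha>)"
      using m y by (simp add: e_def power_mult_distrib powr_realpow[symmetric] powr_powr \<beta>_def)
    also have "\<dots> \<le> K ^ m * (real m powr b * (x + 1) powr (- \<alpha>))"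
    proof (rule mult_left_mono)
      have "(y + 1) powr (- \<alpha>) \<le> ((x + 1) / real m) powr (- \<alpha>)"
        using x m a by (intro powr_mono2') (auto simp: y_def field_simps)
      also have "\<dots> = real m powr \<alpha> * (x + 1) powr (- \<alpha>)"
        using x m by (simp add: powr_divide powr_minus_divide field_simps)
      also have "\<dots> \<le> real m powr b * (x + 1) powr (- \<alpha>)"
        using m a by (intro mult_right_mono powr_mono) auto
      finally show "(y + 1) powr (- \<alpha>) \<le> real m powr b * (x + 1) powr (- \<alpha>)" .
    qed (use K in simp)
    finally show ?thesis by (intro has_net_mono[OF p c2]) (simp_all add: mult_ac)
  qed
  moreover have "0 < K ^ m * real m powr b" using K m by simp
  ultimately show ?thesis by (intro exI[of _ "K ^ m * real m powr b"] conjI allI impI) simp_all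
qed

text \<open>
  Some order below \<open>a\<close> is admissible. An order below \<open>1\<close> exists unless \<open>p = 1\<close> and \<open>q = \<infinity>\<close>, where the operator is
  factored through \<open>L\<^sub>2\<close> with two equal orders between \<open>1/2\<close> and \<open>1\<close>.
\<close>

lemma has_net_RL_increasing_some:
  assumes r: "1 \<le> r" "ereal r < q" and a: "exponent_gap r q < a"
  shows "\<exists>\<beta> K. 0 < \<beta> \<and> \<beta> < a \<and> 0 < K \<and> (\<forall>x\<ge>0. has_net (RL \<beta>) (ereal r) q x (K * (x + 1) powr (- \<beta>)))"
proof (cases "exponent_gap r q < 1")
  case True
  define \<beta> where "\<beta> = (exponent_gap r q + min a 1) / 2"
  have \<beta>: "exponent_gap r q < \<beta>" "\<beta> < 1" "\<beta> < a" using True a by (auto simp: \<beta>_def min_def field_simps)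
  obtain K where "K > 0" "\<forall>x\<ge>0. has_net (RL \<beta>) (ereal r) q x (K * (x + 1) powr (- \<beta>))"
    using has_net_RL_block[OF r \<beta>(1,2)] by (elim exE conjE)
  then show ?thesis using \<beta> exponent_gap_pos[OF r] by (intro exI[of _ \<beta>] exI[of _ K] conjI) auto
next
  case False
  have "q = \<infinity>"
  proof (rule ccontr)
    assume "q \<noteq> \<infinity>"
    then obtain u where u: "q = ereal u" "r < u" using r by (cases q) auto
    then have "1 / u > 0" "1 / r \<le> 1" using r by auto
    moreover have "exponent_gap r q = 1 / r - 1 / u" using u by (simp add: exponent_gap_def)
    ultimately show False using False by linarith
  qed
  moreover have "r = 1" using False r \<open>q = \<infinity>\<close> by (simp add: exponent_gap_def)
  ultimately have q: "ereal r = ereal 1" "q = \<infinity>" by auto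
  have a1: "1 < a" using a q \<open>r = 1\<close> by (simp add: exponent_gap_def)
  define \<gamma> where "\<gamma> = (1 + min a 2) / 4"
  have \<gamma>: "1 / 2 < \<gamma>" "\<gamma> < 1" "\<gamma> + \<gamma> < a" using a1 by (auto simp: \<gamma>_def min_def field_simps)
  obtain K1 where K1: "K1 > 0" "\<forall>x\<ge>0. has_net (RL \<gamma>) (ereal 1) (ereal 2) x (K1 * (x + 1) powr (- \<gamma>))"
    using has_net_RL_block[of 1 "ereal 2" \<gamma>] \<gamma> by (auto simp: exponent_gap_def)
  obtain K2 where K2: "K2 > 0" "\<forall>x\<ge>0. has_net (RL \<gamma>) (ereal 2) \<infinity> x (K2 * (x + 1) powr (- \<gamma>))"
    using has_net_RL_block[of 2 \<infinity> \<gamma>] \<gamma> by (auto simp: exponent_gap_def)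
  have "has_net (RL (\<gamma> + \<gamma>)) (ereal 1) \<infinity> x (K1 * K2 * 2 powr (\<gamma> + \<gamma>) * (x + 1) powr (- (\<gamma> + \<gamma>)))" if "0 \<le> x" for x
    using that K1 K2 \<gamma> by (intro has_net_RL_compose_powr[where r = "ereal 2"]) (auto simp: one_ereal_def)
  then show ?thesis unfolding q using \<gamma> K1 K2
    by (intro exI[of _ "\<gamma> + \<gamma>"] exI[of _ "K1 * K2 * 2 powr (\<gamma> + \<gamma>)"]) auto
qed

lemma has_net_RL_increasing_exponent:
  assumes r: "1 \<le> r" "ereal r < q" and a: "exponent_gap r q < a" "a < b"
  shows "\<exists>K>0. \<forall>\<alpha> x. a \<le> \<alpha> \<and> \<alpha> \<le> b \<and> 0 \<le> x \<longrightarrow> has_net (RL \<alpha>) (ereal r) q x (K * (x + 1) powr (- \<alpha>))"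
proof -
  have r1: "1 \<le> ereal r" using r by (simp add: one_ereal_def)
  then have q: "1 \<le> q" using r by (cases q) (auto simp: one_ereal_def)
  obtain \<beta> K1 where \<beta>: "0 < \<beta>" "\<beta> < a" and K1: "0 < K1" "\<forall>x\<ge>0. has_net (RL \<beta>) (ereal r) q x (K1 * (x + 1) powr (- \<beta>))"
    using has_net_RL_increasing_some[OF r a(1)] by (elim exE conjE)
  have "0 < b" using \<beta> a by simp
  obtain K2 where K2: "0 < K2" "\<forall>\<alpha> p x. 0 < \<alpha> \<and> \<alpha> \<le> b \<and> 1 \<le> p \<and> 0 \<le> x \<longrightarrow> has_net (RL \<alpha>) p p x (K2 * (x + 1) powr (- \<alpha>))"
    using has_net_RL_same_exponent[OF \<open>0 < b\<close>] by (elim exE conjE)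
  have "has_net (RL \<alpha>) (ereal r) q x (K1 * K2 * 2 powr b * (x + 1) powr (- \<alpha>))" if \<alpha>: "a \<le> \<alpha>" "\<alpha> \<le> b" and x: "0 \<le> x" for \<alpha> x
  proof -
    have c1: "has_net (RL \<beta>) (ereal r) q z (K1 * (z + 1) powr (- \<beta>))" if "0 \<le> z" for z
      using K1(2) that by blast
    have c2: "has_net (RL (\<alpha> - \<beta>)) q q z (K2 * (z + 1) powr (- (\<alpha> - \<beta>)))" if "0 \<le> z" for z
      by (rule K2(2)[rule_format]) (use that \<alpha> \<beta> q in auto)
    have "has_net (RL (\<alpha> - \<beta> + \<beta>)) (ereal r) q x (K1 * K2 * 2 powr (\<alpha> - \<beta> + \<beta>) * (x + 1) powr (- (\<alpha> - \<beta> + \<beta>)))"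
      by (rule has_net_RL_compose_powr[OF _ \<beta>(1) r1 q q K1(1) K2(1) c1 c2 x]) (use \<alpha> \<beta> in simp_all)
    then have c: "has_net (RL \<alpha>) (ereal r) q x (K1 * K2 * 2 powr \<alpha> * (x + 1) powr (- \<alpha>))" by simp
    have "K1 * K2 * 2 powr \<alpha> * (x + 1) powr (- \<alpha>) \<le> K1 * K2 * 2 powr b * (x + 1) powr (- \<alpha>)"
      using K1 K2 \<alpha> by (intro mult_right_mono mult_left_mono powr_mono) auto
    then show ?thesis by (rule has_net_mono[OF q c order_refl])
  qed
  moreover have "0 < K1 * K2 * 2 powr b" using K1 K2 by simp
  ultimately show ?thesis by (intro exI[of _ "K1 * K2 * 2 powr b"] conjI allI impI) simp_all
qed

section \<open>Entropy numbers of the operators on the unit interval\<close>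

lemma nn_integral_lebesgue_on_unit:
  fixes h F :: "real \<Rightarrow> real"
  assumes ae: "AE x in lborel. x \<in> {0..<1} \<longrightarrow> F x = h x" and supp: "\<And>x. x \<notin> {0..<1} \<Longrightarrow> h x = 0"
  shows "(\<integral>\<^sup>+x. ennreal (F x) \<partial>lebesgue_on {0..1}) = (\<integral>\<^sup>+x. ennreal (h x) \<partial>lborel)"
proof -
  have n1: "AE x in lborel. x \<noteq> (1::real)" by (rule AE_lborel_singleton)
  have "(\<integral>\<^sup>+x. ennreal (F x) \<partial>lebesgue_on {0..1}) = (\<integral>\<^sup>+x. ennreal (F x) * indicator {0..1} x \<partial>lebesgue)"
    by (rule nn_integral_restrict_space) simp
  also have "\<dots> = (\<integral>\<^sup>+x. ennreal (h x) \<partial>lebesgue)"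
  proof (rule nn_integral_cong_AE, rule AE_completion)
    show "AE x in lborel. ennreal (F x) * indicator {0..1} x = ennreal (h x)"
      using ae n1
    proof eventually_elim
      case (elim x)
      then show ?case using supp[of x] by (cases "x \<in> {0..<1}") (auto simp: indicator_def)
    qed
  qed
  also have "\<dots> = (\<integral>\<^sup>+x. ennreal (h x) \<partial>lborel)"
    by (rule nn_integral_completion)
  finally show ?thesis .
qed

lemma AE_lebesgue_on_unit:
  fixes P :: "real \<Rightarrow> bool"
  assumes "AE x in lborel. x \<in> {0..<1} \<longrightarrow> P x"
  shows "AE x in lebesgue_on {0..1}. P x"
proof -
  have n1: "AE x in lborel. x \<noteq> (1::real)" by (rule AE_lborel_singleton)
  have "AE x in lborel. x \<in> {0..1} \<longrightarrow> P x"
    using assms n1 by eventually_elim auto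
  then have "AE x in lebesgue. x \<in> {0..1} \<longrightarrow> P x" by (rule AE_completion)
  then show ?thesis by (subst AE_restrict_space_iff) auto
qed

lemma L01_of_lp_le:
  assumes q: "1 \<le> q" and g: "lp_le q g c" and G: "\<And>t. t \<in> {0..<1} \<Longrightarrow> G t = g t"
  shows "G \<in> L01 q" "norm01 q G \<le> c"
proof -
  have [measurable]: "g \<in> borel_measurable borel" using g by (rule lp_le_meas)
  have c: "0 \<le> c" using g by (rule lp_le_nonneg)
  have "(\<lambda>t. if t = 1 then G 1 else g t) \<in> borel_measurable (lebesgue_on {0..1})"
    by (intro measurable_restrict_space1 measurable_completion) measurable
  moreover have "(if t = 1 then G 1 else g t) = G t" if "t \<in> space (lebesgue_on {0..1})" for t
    using that G[of t] by auto
  ultimately have Gm[measurable]: "G \<in> borel_measurable (lebesgue_on {0..1})"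
    by (subst (asm) measurable_cong)
  have "G \<in> L01 q \<and> norm01 q G \<le> c"
    using q
  proof (cases rule: exponent_cases)
    case (fin r)
    have e: "(\<integral>\<^sup>+x. ennreal (\<bar>G x\<bar> powr r) \<partial>lebesgue_on {0..1}) = (\<integral>\<^sup>+x. ennreal (\<bar>g x\<bar> powr r) \<partial>lborel)"
      using fin G lp_le_supp[OF g] by (intro nn_integral_lebesgue_on_unit) auto
    also have "\<dots> \<le> ennreal (c powr r)" using g fin by (simp add: lp_le_ereal)
    finally have b: "(\<integral>\<^sup>+x. ennreal (\<bar>G x\<bar> powr r) \<partial>lebesgue_on {0..1}) \<le> ennreal (c powr r)" .
    have i: "integrable (lebesgue_on {0..1}) (\<lambda>x. \<bar>G x\<bar> powr r)"
      using le_less_trans[OF b ennreal_less_top] by (intro integrableI_bounded) auto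
    have "ennreal (\<integral>x. \<bar>G x\<bar> powr r \<partial>lebesgue_on {0..1}) \<le> ennreal (c powr r)"
      using b nn_integral_eq_integral[OF i] by simp
    then have "(\<integral>x. \<bar>G x\<bar> powr r \<partial>lebesgue_on {0..1}) \<le> c powr r" by (simp add: ennreal_le_iff)
    then have "(\<integral>x. \<bar>G x\<bar> powr r \<partial>lebesgue_on {0..1}) powr (1 / r) \<le> (c powr r) powr (1 / r)"
      using fin by (intro powr_mono2) auto
    also have "\<dots> = c" using fin c by (simp add: powr_powr)
    finally show ?thesis using i fin Gm by (simp add: Lp_space_def Lp_norm_def)
  next
    case inf
    have "AE x in lborel. \<bar>g x\<bar> \<le> c" using g inf by (simp add: lp_le_infinity)
    then have "AE x in lborel. x \<in> {0..<1} \<longrightarrow> \<bar>G x\<bar> \<le> c" by eventually_elim (use G in auto)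
    then have ae: "AE x in lebesgue_on {0..1}. \<bar>G x\<bar> \<le> c" by (rule AE_lebesgue_on_unit)
    have le: "esssup (lebesgue_on {0..1}) (\<lambda>x. ereal \<bar>G x\<bar>) \<le> ereal c"
      using ae by (intro esssup_I) auto
    moreover have "real_of_ereal (esssup (lebesgue_on {0..1}) (\<lambda>x. ereal \<bar>G x\<bar>)) \<le> c"
      using le c by (cases "esssup (lebesgue_on {0..1}) (\<lambda>x. ereal \<bar>G x\<bar>)") auto
    ultimately show ?thesis using inf Gm by (auto simp: Lp_space_def Lp_norm_def)
  qed
  then show "G \<in> L01 q" "norm01 q G \<le> c" by auto
qed

lemma L01_borel_representative:
  assumes p: "1 \<le> p" and f: "f \<in> L01 p" "norm01 p f \<le> 1"
  obtains g where "lp_le p g 1" "AE x in lborel. x \<in> {0..<1} \<longrightarrow> f x = g x"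
proof -
  have fm[measurable]: "f \<in> borel_measurable (lebesgue_on {0..1})" using f by (simp add: Lp_space_def)
  then have "(\<lambda>x. if x \<in> {0..1} then f x else 0) \<in> borel_measurable lebesgue"
    by (subst borel_measurable_if) simp_all
  then obtain g' where g': "g' \<in> borel_measurable lborel" "AE x in lborel. (if x \<in> {0..1} then f x else 0) = g' x"
    using completion_ex_borel_measurable_real by blast
  define g where "g = (\<lambda>x. g' x * indicator {0..<1} x)"
  have [measurable]: "g \<in> borel_measurable borel" using g'(1) unfolding g_def by measurable
  have ae: "AE x in lborel. x \<in> {0..<1} \<longrightarrow> f x = g x"
    using g'(2) by eventually_elim (auto simp: g_def)
  have supp: "g x = 0" if "x \<notin> {0..<1}" for x using that by (simp add: g_def)
  have "lp_le p g 1"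
    using p
  proof (cases rule: exponent_cases)
    case (fin r)
    have i: "integrable (lebesgue_on {0..1}) (\<lambda>x. \<bar>f x\<bar> powr r)" using f fin by (simp add: Lp_space_def)
    define I where "I = (\<integral>x. \<bar>f x\<bar> powr r \<partial>lebesgue_on {0..1})"
    have "I powr (1 / r) \<le> 1" using f(2) fin by (simp add: Lp_norm_def I_def)
    moreover have "1 < I powr (1 / r)" if "1 < I" using that fin by (intro gr_one_powr) auto
    ultimately have "I \<le> 1" by linarith
    have "(\<integral>\<^sup>+x. ennreal (\<bar>f x\<bar> powr r) \<partial>lebesgue_on {0..1}) = (\<integral>\<^sup>+x. ennreal (\<bar>g x\<bar> powr r) \<partial>lborel)"
      using fin ae supp by (intro nn_integral_lebesgue_on_unit) (auto elim: AE_mp)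
    moreover have "(\<integral>\<^sup>+x. ennreal (\<bar>f x\<bar> powr r) \<partial>lebesgue_on {0..1}) = ennreal I"
      using nn_integral_eq_integral[OF i] by (simp add: I_def)
    ultimately have "(\<integral>\<^sup>+x. ennreal (\<bar>g x\<bar> powr r) \<partial>lborel) = ennreal I" by simp
    also have "\<dots> \<le> ennreal 1" using \<open>I \<le> 1\<close> by (rule ennreal_leI)
    finally show ?thesis using fin supp by (simp add: lp_le_ereal)
  next
    case inf
    let ?s = "esssup (lebesgue_on {0..1}) (\<lambda>x. ereal \<bar>f x\<bar>)"
    have s: "?s < \<infinity>" "real_of_ereal ?s \<le> 1" using f inf by (auto simp: Lp_space_def Lp_norm_def)
    then have s1: "?s \<le> 1" by (cases ?s) (auto simp: one_ereal_def)
    have "AE x in lebesgue_on {0..1}. ereal \<bar>f x\<bar> \<le> ?s" by (rule esssup_AE)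
    then have "AE x in lebesgue. x \<in> {0..1} \<longrightarrow> ereal \<bar>f x\<bar> \<le> ?s" by (subst (asm) AE_restrict_space_iff) auto
    moreover have "AE x in lebesgue. x \<in> {0..<1} \<longrightarrow> f x = g x" by (rule AE_completion[OF ae])
    ultimately have "AE x in lebesgue. \<bar>g x\<bar> \<le> 1"
    proof eventually_elim
      case (elim x)
      show ?case
      proof (cases "x \<in> {0..<1}")
        case True
        then have "ereal \<bar>g x\<bar> \<le> ?s" using elim by auto
        then have "ereal \<bar>g x\<bar> \<le> 1" using s1 by (rule order_trans)
        then show ?thesis by (simp add: one_ereal_def)
      qed (simp add: supp)
    qed
    then have "AE x in lborel. \<bar>g x\<bar> \<le> 1" by (subst (asm) AE_completion_iff) auto
    then show ?thesis using inf supp by (simp add: lp_le_infinity)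
  qed
  then show ?thesis using ae that by blast
qed

text \<open>
  On \<open>[0,1)\<close> the operator on Lebesgue measurable functions agrees pointwise with \<open>RL\<close> applied to a
  Borel representative. The remaining point \<open>1\<close> is a null set.
\<close>

lemma riemann_liouville_eq_RL:
  assumes g[measurable]: "g \<in> borel_measurable borel" and supp: "\<And>x. x \<notin> {0..<1} \<Longrightarrow> g x = 0"
    and f: "f \<in> borel_measurable (lebesgue_on {0..1})" and ae: "AE x in lborel. x \<in> {0..<1} \<longrightarrow> f x = g x"
    and t: "t \<in> {0..<1}"
  shows "riemann_liouville \<alpha> f t = RL \<alpha> g t"
proof -
  let ?F = "\<lambda>x. if x \<in> {0..1} then f x else 0"
  have F: "?F \<in> borel_measurable lebesgue" using f by (subst borel_measurable_if) simp_all
  define k where "k = (\<lambda>s. indicator {0..t} s * (t - s) powr (\<alpha> - 1))"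
  have k[measurable]: "k \<in> borel_measurable borel" unfolding k_def by measurable
  have kl: "k \<in> borel_measurable lebesgue" using k by (intro measurable_completion) simp
  have gl: "g \<in> borel_measurable lebesgue" using g by (intro measurable_completion) simp
  have "(LINT s:{0..t}|lebesgue. (t - s) powr (\<alpha> - 1) * f s) = (LINT s|lebesgue. k s * ?F s)"
    unfolding set_lebesgue_integral_def using t by (intro Bochner_Integration.integral_cong) (auto simp: k_def indicator_def)
  also have "\<dots> = (LINT s|lebesgue. k s * g s)"
  proof (rule integral_cong_AE)
    show "(\<lambda>s. k s * ?F s) \<in> borel_measurable lebesgue" using kl F by (rule borel_measurable_times)
    show "(\<lambda>s. k s * g s) \<in> borel_measurable lebesgue" using kl gl by (rule borel_measurable_times)
    have "AE s in lborel. k s * ?F s = k s * g s"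
      using ae by eventually_elim (use t in \<open>auto simp: k_def indicator_def\<close>)
    then show "AE s in lebesgue. k s * ?F s = k s * g s" by (rule AE_completion)
  qed
  also have "\<dots> = (LINT s|lborel. k s * g s)" by (rule integral_completion) simp
  finally have "riemann_liouville \<alpha> f t = (LINT s|lborel. 1 / Gamma \<alpha> * (k s * g s))"
    by (simp only: riemann_liouville_def integral_mult_right_zero)
  also have "\<dots> = (LINT s|lborel. rl_kernel \<alpha> (t - s) * g s)"
  proof (rule Bochner_Integration.integral_cong)
    fix s
    show "1 / Gamma \<alpha> * (k s * g s) = rl_kernel \<alpha> (t - s) * g s"
    proof (cases "0 \<le> s")
      case True
      then show ?thesis by (auto simp: k_def rl_kernel_def indicator_def not_less)
    next
      case False
      then show ?thesis using supp[of s] by simp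
    qed
  qed simp
  finally show ?thesis using t by (simp add: RL_def)
qed

lemma entropy_number_le_of_cov:
  assumes p: "1 \<le> p" and q: "1 \<le> q" and c: "has_net (RL \<alpha>) p q (real n - 1) \<epsilon>" and n: "n \<ge> 1" and \<epsilon>: "0 < \<epsilon>"
  shows "entropy_number n (L01 p) (norm01 p) (L01 q) (norm01 q) (riemann_liouville \<alpha>) \<le> ennreal \<epsilon>"
proof (rule has_netE[OF c])
  fix Y
  assume Y: "finite Y" "real (card Y) \<le> 2 powr (real n - 1)" "\<And>y. y \<in> Y \<Longrightarrow> \<exists>c. lp_le q y c"
    "\<And>f. lp_le p f 1 \<Longrightarrow> \<exists>y\<in>Y. lp_le q (\<lambda>t. RL \<alpha> f t - y t) \<epsilon>"
  have "2 powr (real n - 1) = real (2 ^ (n - 1))" using n by (simp add: powr_realpow[symmetric] of_nat_diff)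
  then have "card Y \<le> 2 ^ (n - 1)" using Y(2) by (metis of_nat_le_iff)
  then have "card Y \<le> card {1..(2::nat) ^ (n - 1)}" by simp
  then obtain h where h: "h ` Y \<subseteq> {1..(2::nat) ^ (n - 1)}" "inj_on h Y"
    using Y(1) card_le_inj[of Y "{1..(2::nat) ^ (n - 1)}"] by auto
  define y where "y = (\<lambda>j. if j \<in> h ` Y then inv_into Y h j else (\<lambda>_. 0))"
  have yh: "y (h w) = w" if "w \<in> Y" for w using that h by (simp add: y_def inv_into_f_f)
  have yb: "\<exists>c. lp_le q (y j) c" for j
  proof (cases "j \<in> h ` Y")
    case True
    then show ?thesis using Y(3) inv_into_into[of j h Y] by (simp add: y_def)
  next
    case False
    then show ?thesis using lp_le_zero[of 0 q] by (auto simp: y_def)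
  qed
  have yF: "y j \<in> L01 q" for j using yb[of j] L01_of_lp_le(1)[OF q] by blast
  have "riemann_liouville \<alpha> ` {x \<in> L01 p. norm01 p x \<le> 1}
     \<subseteq> (\<Union>j\<in>{1..2 ^ (n - 1)}. {z \<in> L01 q. norm01 q (z - y j) \<le> \<epsilon>})"
  proof
    fix z
    assume "z \<in> riemann_liouville \<alpha> ` {x \<in> L01 p. norm01 p x \<le> 1}"
    then obtain f where f: "f \<in> L01 p" "norm01 p f \<le> 1" and z: "z = riemann_liouville \<alpha> f" by auto
    obtain g where g: "lp_le p g 1" "AE x in lborel. x \<in> {0..<1} \<longrightarrow> f x = g x"
      using L01_borel_representative[OF p f] by blast
    have zt: "z t = RL \<alpha> g t" if "t \<in> {0..<1}" for t
      unfolding z using f(1) g(2) that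
      by (intro riemann_liouville_eq_RL lp_le_meas[OF g(1)] lp_le_supp[OF g(1)]) (auto simp: Lp_space_def)
    obtain w where w: "w \<in> Y" "lp_le q (\<lambda>t. RL \<alpha> g t - w t) \<epsilon>" using Y(4)[OF g(1)] by blast
    obtain d where d: "lp_le q w d" using Y(3)[OF w(1)] by blast
    have "lp_le q (RL \<alpha> g) (\<epsilon> + d)" using lp_le_add[OF q w(2) d] by simp
    then have "z \<in> L01 q" using zt by (rule L01_of_lp_le(1)[OF q])
    moreover have "norm01 q (z - w) \<le> \<epsilon>" using zt by (intro L01_of_lp_le(2)[OF q w(2)]) simp
    ultimately show "z \<in> (\<Union>j\<in>{1..2 ^ (n - 1)}. {z \<in> L01 q. norm01 q (z - y j) \<le> \<epsilon>})"
      using h(1) w(1) yh[OF w(1)] by (intro UN_I[of "h w"]) auto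
  qed
  then show ?thesis
    unfolding entropy_number_def using yF \<epsilon> by (intro Inf_lower) blast
qed

lemma entropy_number_RL_le:
  assumes p: "1 \<le> p" and q: "1 \<le> q" and K: "K > 0" and n: "n \<ge> 1"
    and c: "has_net (RL \<alpha>) p q (real n - 1) (K * (real n - 1 + 1) powr (- \<alpha>))"
  shows "entropy_number n (L01 p) (norm01 p) (L01 q) (norm01 q) (riemann_liouville \<alpha>) \<le> ennreal (K * real n powr (- \<alpha>))"
  using c K n by (intro entropy_number_le_of_cov p q) auto

theorem theorem6p2:
  shows "(\<forall>b::real. b > 0 \<longrightarrow> (\<exists>c::real. c > 0 \<and>
           (\<forall>p q :: ereal. 1 \<le> q \<and> q \<le> p \<longrightarrow>
             (\<forall>n::nat. n \<ge> 1 \<longrightarrow> (\<forall>\<alpha>::real. 0 < \<alpha> \<and> \<alpha> \<le> b \<longrightarrow>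
               entropy_number n (L01 p) (norm01 p) (L01 q) (norm01 q) (riemann_liouville \<alpha>)
                 \<le> ennreal (c * real n powr (- \<alpha>)))))))
       \<and> (\<forall>p q :: ereal. 1 \<le> p \<and> p < q \<longrightarrow>
           (\<forall>a b :: real. ereal a > 1 / p - 1 / q \<and> b > a \<longrightarrow> (\<exists>c::real. c > 0 \<and>
             (\<forall>n::nat. n \<ge> 1 \<longrightarrow> (\<forall>\<alpha>::real. a \<le> \<alpha> \<and> \<alpha> \<le> b \<longrightarrow>
               entropy_number n (L01 p) (norm01 p) (L01 q) (norm01 q) (riemann_liouville \<alpha>)
                 \<le> ennreal (c * real n powr (- \<alpha>)))))))"
proof (rule conjI)
  show "\<forall>b::real. b > 0 \<longrightarrow> (\<exists>c::real. c > 0 \<and>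
           (\<forall>p q :: ereal. 1 \<le> q \<and> q \<le> p \<longrightarrow>
             (\<forall>n::nat. n \<ge> 1 \<longrightarrow> (\<forall>\<alpha>::real. 0 < \<alpha> \<and> \<alpha> \<le> b \<longrightarrow>
               entropy_number n (L01 p) (norm01 p) (L01 q) (norm01 q) (riemann_liouville \<alpha>)
                 \<le> ennreal (c * real n powr (- \<alpha>))))))"
  proof (intro allI impI)
    fix b :: real
    assume b: "b > 0"
    obtain K where K: "K > 0" and
      has_net: "\<forall>\<alpha> p x. 0 < \<alpha> \<and> \<alpha> \<le> b \<and> 1 \<le> p \<and> 0 \<le> x \<longrightarrow> has_net (RL \<alpha>) p p x (K * (x + 1) powr (- \<alpha>))"
      using has_net_RL_same_exponent[OF b] by (elim exE conjE)
    show "\<exists>c::real. c > 0 \<and>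
           (\<forall>p q :: ereal. 1 \<le> q \<and> q \<le> p \<longrightarrow>
             (\<forall>n::nat. n \<ge> 1 \<longrightarrow> (\<forall>\<alpha>::real. 0 < \<alpha> \<and> \<alpha> \<le> b \<longrightarrow>
               entropy_number n (L01 p) (norm01 p) (L01 q) (norm01 q) (riemann_liouville \<alpha>)
                 \<le> ennreal (c * real n powr (- \<alpha>)))))"
    proof (intro exI[of _ K] conjI allI impI K; elim conjE)
      fix p q :: ereal and n :: nat and \<alpha> :: real
      assume pq: "1 \<le> q" "q \<le> p" and n: "n \<ge> 1" and \<alpha>: "0 < \<alpha>" "\<alpha> \<le> b"
      have "has_net (RL \<alpha>) q q (real n - 1) (K * (real n - 1 + 1) powr (- \<alpha>))"
        by (rule has_net[rule_format]) (use pq \<alpha> n in auto)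
      from has_net_antimono_exponent[OF pq this] K n pq
      show "entropy_number n (L01 p) (norm01 p) (L01 q) (norm01 q) (riemann_liouville \<alpha>) \<le> ennreal (K * real n powr (- \<alpha>))"
        by (intro entropy_number_RL_le) auto
    qed
  qed
  show "\<forall>p q :: ereal. 1 \<le> p \<and> p < q \<longrightarrow>
           (\<forall>a b :: real. ereal a > 1 / p - 1 / q \<and> b > a \<longrightarrow> (\<exists>c::real. c > 0 \<and>
             (\<forall>n::nat. n \<ge> 1 \<longrightarrow> (\<forall>\<alpha>::real. a \<le> \<alpha> \<and> \<alpha> \<le> b \<longrightarrow>
               entropy_number n (L01 p) (norm01 p) (L01 q) (norm01 q) (riemann_liouville \<alpha>)
                 \<le> ennreal (c * real n powr (- \<alpha>))))))"
  proof (intro allI impI; elim conjE)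
    fix p q :: ereal and a b :: real
    assume p: "1 \<le> p" and pq: "p < q" and a: "ereal a > 1 / p - 1 / q" and b: "b > a"
    have q: "1 \<le> q" using p pq by simp
    obtain r where r: "p = ereal r" "1 \<le> r" using p pq by (cases rule: exponent_cases) auto
    have rq: "ereal r < q" using pq r by simp
    have gap: "exponent_gap r q < a"
      using a r rq by (cases q) (auto simp: exponent_gap_def one_ereal_def)
    obtain K where K: "K > 0" and
      has_net: "\<forall>\<alpha> x. a \<le> \<alpha> \<and> \<alpha> \<le> b \<and> 0 \<le> x \<longrightarrow> has_net (RL \<alpha>) (ereal r) q x (K * (x + 1) powr (- \<alpha>))"
      using has_net_RL_increasing_exponent[OF r(2) rq gap b] by (elim exE conjE)
    show "\<exists>c::real. c > 0 \<and>
             (\<forall>n::nat. n \<ge> 1 \<longrightarrow> (\<forall>\<alpha>::real. a \<le> \<alpha> \<and> \<alpha> \<le> b \<longrightarrow>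
               entropy_number n (L01 p) (norm01 p) (L01 q) (norm01 q) (riemann_liouville \<alpha>)
                 \<le> ennreal (c * real n powr (- \<alpha>))))"
    proof (intro exI[of _ K] conjI allI impI K; elim conjE)
      fix n :: nat and \<alpha> :: real
      assume n: "n \<ge> 1" and \<alpha>: "a \<le> \<alpha>" "\<alpha> \<le> b"
      have "has_net (RL \<alpha>) p q (real n - 1) (K * (real n - 1 + 1) powr (- \<alpha>))"
        unfolding r(1) by (rule has_net[rule_format]) (use \<alpha> n in auto)
      then show "entropy_number n (L01 p) (norm01 p) (L01 q) (norm01 q) (riemann_liouville \<alpha>) \<le> ennreal (K * real n powr (- \<alpha>))"
        by (rule entropy_number_RL_le[OF p q K n])
    qed
  qed
qed

end
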